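(* Let $d\in\{1,2,3\}$, $1\le\alpha<2$, $\lambda\ge 0$, and let $\Omega=(a_1,b_1)\times\cdots\times(a_d,b_d)\subset\mathbb{R}^d$ be a bounded box. Let $(-\Delta+\lambda)^{\alpha/2}$ be the tempered integral fractional Laplacian, and for $h=L/N$ with $L=\max_i(b_i-a_i)$ and $N\ge 1$ an integer, let $(-\Delta+\lambda)^{\alpha/2}_{h,\gamma}$ be its finite difference approximation with splitting parameter $\gamma$ (both defined in the context). Let $u:\mathbb{R}^d\to\mathbb{R}$ satisfy $u=0$ on $\mathbb{R}^d\setminus\Omega$, and put $$e^h_{\alpha,\gamma}(\mathbf{x})=(-\Delta+\lambda)^{\alpha/2}u(\mathbf{x})-(-\Delta+\lambda)^{\alpha/2}_{h,\gamma}u(\mathbf{x}),\qquad \mathbf{x}\in\Omega,\qquad \|e^h_{\alpha,\gamma}\|_\infty=\sup_{\mathbf{x}\in\Omega}|e^h_{\alpha,\gamma}(\mathbf{x})|.$$ Let $0<\varepsilon\le 2-\alpha$. Then: (i) if $u\in C^{1,\alpha-1+\varepsilon}(\mathbb{R}^d)$ and $\gamma\in(\alpha,2]$, there is a constant $C>0$ independent of $h$ such that $\|e^h_{\alpha,\gamma}\|_\infty\le C h^{\varepsilon}$; (ii) if $u\in C^{3,\alpha-1+\varepsilon}(\mathbb{R}^d)$ and $\gamma=2$, there is a constant $C>0$ independent of $h$ such that $\|e^h_{\alpha,2}\|_\infty\le C h^{2}$.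
   Context: Function spaces. For $k\in\mathbb{N}\cup\{0\}$ and $0\le s\le 1$, $C^{k,s}(\mathbb{R}^d)$ is the space of functions $u:\mathbb{R}^d\to\mathbb{R}$ with continuous (partial) derivatives of order $\le k$ whose $k$-th order partial derivatives are uniformly Hölder continuous with exponent $s$. Tempered fractional Laplacian. For $\alpha\in(0,2)$, $\lambda\ge0$, $$(-\Delta+\lambda)^{\alpha/2}u(\mathbf{x})=c_d^{\alpha,\lambda}\,\mathrm{P.V.}\int_{\mathbb{R}^d}\frac{u(\mathbf{x})-u(\mathbf{y})}{e^{\lambda|\mathbf{x}-\mathbf{y}|}|\mathbf{x}-\mathbf{y}|^{d+\alpha}}\,d\mathbf{y},$$ where $|\cdot|$ is the Euclidean norm, P.V. denotes the principal value, and $$c_d^{\alpha,\lambda}=\frac{1}{2\sqrt{\pi^d}}\begin{cases}2^\alpha\alpha\,\Gamma\big(\tfrac{d+\alpha}{2}\big)/\Gamma\big(1-\tfrac{\alpha}{2}\big),&\lambda=0\text{ or }\alpha=1,\\[2pt] \Gamma\big(\tfrac d2\big)/|\Gamma(-\alpha)|,&\text{otherwise.}\end{cases}$$ Finite difference approximation. Let $\gamma\in(\alpha,2]$. For $\boldsymbol{\xi}\in[0,\infty)^d\setminus\{\mathbf{0}\}$ put $$\varphi_{d,\gamma}(\mathbf{x},\boldsymbol{\xi})=\frac{1}{|\boldsymbol{\xi}|^\gamma}\Big(\sum_{\mathbf{m}\in\{0,1\}^d}u\big(\mathbf{x}+((-1)^{m_1}\xi^{(1)},\dots,(-1)^{m_d}\xi^{(d)})\big)-2^d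 u(\mathbf{x})\Big),\qquad w_{\lambda,\gamma}(\boldsymbol{\xi})=e^{-\lambda|\boldsymbol{\xi}|}|\boldsymbol{\xi}|^{\gamma-(d+\alpha)}.$$ With $L=\max_{1\le i\le d}(b_i-a_i)$, $h=L/N$, for $\mathbf{k}\in\{0,\dots,N-1\}^d$ let $I_{\mathbf{k}}=\prod_{i=1}^d[k_ih,(k_i+1)h]$, and let $\boldsymbol{\xi}_{\mathbf{k}}=h\mathbf{k}$ for $\mathbf{k}\in\{0,\dots,N\}^d$. Let $D_d=[0,\infty)^d\setminus[0,L]^d$. For $\mathbf{n}\in\{0,1\}^d\setminus\{\mathbf{0}\}$ define $c^\gamma_{\mathbf{n}}=1$ if $\gamma\in(\alpha,2)$, and for $\gamma=2$: $c^{2}_{\mathbf{n}}=2^d/d$ if $|\mathbf{n}|=1$, $c^{2}_{\mathbf{n}}=0$ if $|\mathbf{n}|\ne1$. Then for $\mathbf{x}\in\Omega$ the approximation (weighted trapezoidal rule on each element) is $$(-\Delta+\lambda)^{\alpha/2}_{h,\gamma}u(\mathbf{x})=-c_d^{\alpha,\lambda}\bigg[\frac{1}{2^d}\sum_{\mathbf{n}\in\{0,1\}^d\setminus\{\mathbf{0}\}}c^\gamma_{\mathbf{n}}\varphi_{d,\gamma}(\mathbf{x},\boldsymbol{\xi}_{\mathbf{n}})\int_{I_{\mathbf{0}}}w_{\lambda,\gamma}\,d\boldsymbol{\xi}+\sum_{\mathbf{k}\in\{0,\dots,N-1\}^d\setminus\{\mathbf{0}\}}\frac{1}{2^d}\Big(\sum_{\mathbf{n}\in\{0,1\}^d}\varphi_{d,\gamma}(\mathbf{x},\boldsymbol{\xi}_{\mathbf{k}+\mathbf{n}})\Big)\int_{I_{\mathbf{k}}}w_{\lambda,\gamma}\,d\boldsymbol{\xi}-2^d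 u(\mathbf{x})\int_{D_d}e^{-\lambda|\boldsymbol{\xi}|}|\boldsymbol{\xi}|^{-(d+\alpha)}d\boldsymbol{\xi}\bigg].$$ *)

theory Defs
  imports "HOL-Analysis.Analysis"
begin

section \<open>The spaces $C^{k,s}(R^d)$\<close>

definition partial_deriv :: "'d \<Rightarrow> (real^'d \<Rightarrow> real) \<Rightarrow> real^'d \<Rightarrow> real" where
  "partial_deriv i u x = deriv (\<lambda>t. u (x + t *\<^sub>R axis i 1)) 0"

definition has_partial_derivs :: "(real^'d \<Rightarrow> real) \<Rightarrow> bool" where
  "has_partial_derivs u \<longleftrightarrow> (\<forall>i x. (\<lambda>t. u (x + t *\<^sub>R axis i 1)) differentiable (at 0))"

text \<open>\<open>iter_partial is u\<close> is the iterated partial derivative along the list \<open>is\<close> of directions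
  (the last entry is applied first); its order is \<open>length is\<close>.\<close>

definition iter_partial :: "'d list \<Rightarrow> (real^'d \<Rightarrow> real) \<Rightarrow> real^'d \<Rightarrow> real" where
  "iter_partial is u = foldr partial_deriv is u"

definition holder_continuous :: "real \<Rightarrow> (real^'d \<Rightarrow> real) \<Rightarrow> bool" where
  "holder_continuous s f \<longleftrightarrow> (\<exists>K. \<forall>x y. \<bar>f x - f y\<bar> \<le> K * norm (x - y) powr s)"

definition holder_space :: "nat \<Rightarrow> real \<Rightarrow> (real^'d \<Rightarrow> real) set" where
  "holder_space k s = {u.
     (\<forall>is. length is < k \<longrightarrow> has_partial_derivs (iter_partial is u)) \<and>
     (\<forall>is. length is \<le> k \<longrightarrow> continuous_on UNIV (iter_partial is u)) \<and>
     (\<forall>is. length is = k \<longrightarrow> holder_continuous s (iter_partial is u))}"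


section \<open>The tempered fractional Laplacian\<close>

text \<open>Principal value of \<open>\<integral> f\<close> at the singularity \<open>x\<close>. The integrability clause
  excludes the default value of the Bochner integral.\<close>

definition has_pv_integral :: "(real^'d::finite \<Rightarrow> real) \<Rightarrow> real^'d \<Rightarrow> real \<Rightarrow> bool" where
  "has_pv_integral f x I \<longleftrightarrow>
     (\<forall>\<delta>>0. set_integrable lborel (- ball x \<delta>) f) \<and>
     ((\<lambda>\<delta>. LINT y:(- ball x \<delta>)|lborel. f y) \<longlongrightarrow> I) (at_right 0)"

definition pv_integral :: "(real^'d::finite \<Rightarrow> real) \<Rightarrow> real^'d \<Rightarrow> real" where
  "pv_integral f x = (THE I. has_pv_integral f x I)"

definition tfl_const :: "nat \<Rightarrow> real \<Rightarrow> real \<Rightarrow> real" where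
  "tfl_const d \<alpha> lam = 1 / (2 * sqrt (pi ^ d)) *
     (if lam = 0 \<or> \<alpha> = 1
      then 2 powr \<alpha> * \<alpha> * Gamma ((real d + \<alpha>) / 2) / Gamma (1 - \<alpha> / 2)
      else Gamma (real d / 2) / \<bar>Gamma (- \<alpha>)\<bar>)"

definition tfl_integrand ::
  "real \<Rightarrow> real \<Rightarrow> (real^'d \<Rightarrow> real) \<Rightarrow> real^'d \<Rightarrow> real^'d \<Rightarrow> real" where
  "tfl_integrand \<alpha> lam u x y =
     (u x - u y) / (exp (lam * norm (x - y)) * norm (x - y) powr (real CARD('d) + \<alpha>))"

definition tempered_frac_laplacian ::
  "real \<Rightarrow> real \<Rightarrow> (real^'d::finite \<Rightarrow> real) \<Rightarrow> real^'d \<Rightarrow> real" where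
  "tempered_frac_laplacian \<alpha> lam u x =
     tfl_const CARD('d) \<alpha> lam * pv_integral (tfl_integrand \<alpha> lam u x) x"

definition tfl_well_defined_on ::
  "(real^'d::finite) set \<Rightarrow> real \<Rightarrow> real \<Rightarrow> (real^'d \<Rightarrow> real) \<Rightarrow> bool" where
  "tfl_well_defined_on S \<alpha> lam u \<longleftrightarrow>
     (\<forall>x\<in>S. \<exists>I. has_pv_integral (tfl_integrand \<alpha> lam u x) x I)"


section \<open>The finite difference approximation\<close>

definition multi_indices :: "nat \<Rightarrow> (nat^'d) set" where
  "multi_indices M = {k. \<forall>i. k $ i < M}"

lemma finite_multi_indices: "finite (multi_indices M :: (nat^'d::finite) set)"
proof -
  have "multi_indices M \<subseteq> vec_lambda ` (Pi\<^sub>E UNIV (\<lambda>_::'d. {..<M}))"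
  proof
    fix k :: "nat^'d" assume "k \<in> multi_indices M"
    then have "vec_nth k \<in> Pi\<^sub>E UNIV (\<lambda>_::'d. {..<M})"
      by (auto simp: multi_indices_def)
    then show "k \<in> vec_lambda ` (Pi\<^sub>E UNIV (\<lambda>_::'d. {..<M}))"
      by (metis image_eqI vec_nth_inverse)
  qed
  then show ?thesis
    by (rule finite_subset) (auto intro!: finite_imageI finite_PiE)
qed

text \<open>In particular, \<open>{0,1}\<^sup>d\<close> is \<open>multi_indices 2\<close>.\<close>

definition reflect :: "nat^'d \<Rightarrow> real^'d \<Rightarrow> real^'d" where
  "reflect m \<xi> = (\<chi> i. (-1) ^ (m $ i) * \<xi> $ i)"

definition grid_point :: "real \<Rightarrow> nat^'d \<Rightarrow> real^'d" where
  "grid_point h k = (\<chi> i. h * real (k $ i))"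

definition grid_cell :: "real \<Rightarrow> nat^'d::finite \<Rightarrow> (real^'d) set" where
  "grid_cell h k = cbox (grid_point h k) (grid_point h (k + 1))"

definition fd_phi ::
  "real \<Rightarrow> (real^'d \<Rightarrow> real) \<Rightarrow> real^'d \<Rightarrow> real^'d \<Rightarrow> real" where
  "fd_phi \<gamma> u x \<xi> = 1 / norm \<xi> powr \<gamma> *
     ((\<Sum>m\<in>multi_indices 2. u (x + reflect m \<xi>)) - 2 ^ CARD('d) * u x)"

definition fd_weight :: "real \<Rightarrow> real \<Rightarrow> real \<Rightarrow> real^'d \<Rightarrow> real" where
  "fd_weight \<alpha> lam \<gamma> \<xi> = exp (- lam * norm \<xi>) * norm \<xi> powr (\<gamma> - (real CARD('d) + \<alpha>))"

definition fd_coeff :: "real \<Rightarrow> nat^'d \<Rightarrow> real" where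
  "fd_coeff \<gamma> n =
     (if \<gamma> = 2 then (if (\<Sum>i\<in>UNIV. n $ i) = 1 then 2 ^ CARD('d) / real CARD('d) else 0) else 1)"

definition box_length :: "real^'d \<Rightarrow> real^'d \<Rightarrow> real" where
  "box_length a b = Max (range (\<lambda>i. b $ i - a $ i))"

definition far_region :: "real \<Rightarrow> (real^'d::finite) set" where
  "far_region L = {\<xi>. \<forall>i. 0 \<le> \<xi> $ i} - cbox 0 (\<chi> i. L)"

text \<open>The number of cells per direction is \<open>N\<close> and the mesh size is \<open>h = L / N\<close>.\<close>

definition fd_tempered_frac_laplacian ::
  "real^'d::finite \<Rightarrow> real^'d \<Rightarrow> nat \<Rightarrow> real \<Rightarrow> real \<Rightarrow> real \<Rightarrow> (real^'d \<Rightarrow> real) \<Rightarrow> real^'d \<Rightarrow> real" where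
  "fd_tempered_frac_laplacian a b N \<alpha> lam \<gamma> u x =
    (let L = box_length a b; h = L / real N in
     - tfl_const CARD('d) \<alpha> lam *
       (1 / 2 ^ CARD('d) *
          (\<Sum>n\<in>multi_indices 2 - {0}. fd_coeff \<gamma> n * fd_phi \<gamma> u x (grid_point h n) *
             (LINT \<xi>:grid_cell h (0 :: nat^'d)|lborel. fd_weight \<alpha> lam \<gamma> \<xi>))
        + (\<Sum>k\<in>multi_indices N - {0}.
             1 / 2 ^ CARD('d) * (\<Sum>n\<in>multi_indices 2. fd_phi \<gamma> u x (grid_point h (k + n))) *
             (LINT \<xi>:grid_cell h k|lborel. fd_weight \<alpha> lam \<gamma> \<xi>))
        - 2 ^ CARD('d) * u x *
             (LINT \<xi>:(far_region L :: (real^'d) set)|lborel.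
                exp (- lam * norm \<xi>) * norm \<xi> powr (- (real CARD('d) + \<alpha>)))))"

definition fd_error ::
  "real^'d::finite \<Rightarrow> real^'d \<Rightarrow> nat \<Rightarrow> real \<Rightarrow> real \<Rightarrow> real \<Rightarrow> (real^'d \<Rightarrow> real) \<Rightarrow> real^'d \<Rightarrow> real" where
  "fd_error a b N \<alpha> lam \<gamma> u x =
     tempered_frac_laplacian \<alpha> lam u x - fd_tempered_frac_laplacian a b N \<alpha> lam \<gamma> u x"

text \<open>The supremum is taken in the extended reals, so it is \<open>\<infinity>\<close> for unbounded functions.\<close>

definition sup_norm_on :: "'a set \<Rightarrow> ('a \<Rightarrow> real) \<Rightarrow> ereal" where
  "sup_norm_on S f = (SUP x\<in>S. ereal \<bar>f x\<bar>)"

end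

theory Submission
  imports Defs
begin

text \<open>Averaging over the reflections of the coordinates turns the principal value into minus the integral
  over the positive orthant of the symmetric second difference
  \<open>\<psi> \<xi> = (\<Sum>m. u (x + reflect m \<xi>)) - 2 ^ d * u x\<close> against the kernel
  \<open>exp (- lam * norm \<xi>) * norm \<xi> powr (- (d + \<alpha>))\<close>. Outside \<open>[0, L]\<^sup>d\<close> the scheme is exact, because
  there \<open>\<psi>\<close> equals \<open>- 2 ^ d * u x\<close>. So, up to the constant, the error is that of the weighted trapezoidal
  rule for \<open>\<psi> \<xi> / norm \<xi> powr \<gamma>\<close>. On a cell away from the origin the affine part of the integrand only
  costs the oscillation of the weight; if \<open>\<psi>\<close> is of size \<open>norm \<xi> powr p\<close> with an expansion of order
  \<open>\<theta>\<close>, the error of the cell is at most a multiple of \<open>h powr \<theta>\<close> times the integral of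
  \<open>norm \<xi> powr (p - \<theta> - \<alpha> - d)\<close> over the cell.

  For \<open>u\<close> with one derivative, \<open>p = \<theta> = \<alpha> + \<epsilon>\<close>, and integrating over \<open>norm \<xi> \<ge> h\<close> yields
  \<open>h powr \<epsilon>\<close>. This uses the Hoelder exponent of the gradient of \<open>\<psi>\<close> and thus avoids a logarithm at
  \<open>\<alpha> = \<epsilon> = 1\<close>. For \<open>u\<close> with three derivatives, the quadratic part of \<open>\<psi>\<close> is a combination of the
  \<open>(\<xi> $ i)\<^sup>2\<close>; its cell errors are too large to be summed, but for \<open>\<gamma> = 2\<close> they cancel exactly, because
  grid and weight are invariant under permutations of the coordinates. The rest has \<open>p = 2 + \<alpha> + \<epsilon>\<close>
  and \<open>\<theta> = 2\<close>, so that the errors add up to \<open>h\<^sup>2\<close>.\<close>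

subsection \<open>Taylor expansion in Hoelder spaces\<close>

text \<open>Estimating the quotient by its gradient alone, that is with \<theta> = 1, would in the
  first part leave the integral of \<open>norm \<xi> powr (\<epsilon> - 1 - d)\<close> over the
  cells outside the origin cell, which is logarithmic in h when \<epsilon> = 1. With \<theta> = p
  the exponent is - \<alpha> - d, integrable at infinity for every \<epsilon>. The quadratic part is
  the obstacle in the second part: it has p = \<theta> = 2, and adding the absolute values of its
  cell errors gives only the order 2 - \<alpha>. For \<gamma> = 2, however, the quotients of all the
  squares add up to the constant 1, which the rule reproduces on every cell. On the origin cell this
  is the effect of the coefficients 2 ^ d / d at the d unit corners. The origin cell allows no
  expansion. There the integral and the value of the rule are bounded separately, each of order p -
  \<alpha>, which is \<epsilon> in the first part and 2 + \<epsilon> for the remainder in the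
  second. The sup norm requires bounds that are uniform in x; this is why the constant of
  \<open>holder_profile\<close> is an explicit parameter, and why every estimate is linear in
  it.\<close>

primrec dir_deriv :: "nat \<Rightarrow> (real^'d::finite \<Rightarrow> real) \<Rightarrow> real^'d \<Rightarrow> real^'d \<Rightarrow> real" where
  "dir_deriv 0 f x v = f x"
| "dir_deriv (Suc j) f x v = (\<Sum>i\<in>UNIV. v $ i * dir_deriv j (partial_deriv i f) x v)"

lemma dir_deriv_scaleR: "dir_deriv j f x (t *\<^sub>R v) = t ^ j * dir_deriv j f x v"
  by (induction j arbitrary: f) (simp_all add: sum_distrib_left algebra_simps)

lemma dir_deriv_uminus: "dir_deriv j f x (- v) = (- 1) ^ j * dir_deriv j f x v"
  using dir_deriv_scaleR[of j f x "- 1" v] by simp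

lemma iter_partial_simps:
  "iter_partial [] u = u"
  "iter_partial (is @ [i]) u = iter_partial is (partial_deriv i u)"
  by (simp_all add: iter_partial_def)

lemma holder_space_0: "u \<in> holder_space 0 s \<Longrightarrow> holder_continuous s u"
  by (auto simp: holder_space_def iter_partial_def)

lemma holder_space_continuous: "u \<in> holder_space k s \<Longrightarrow> continuous_on UNIV u"
  unfolding holder_space_def by (metis (lifting) iter_partial_simps(1) le0 list.size(3) mem_Collect_eq)

lemma partial_deriv_holder_space:
  assumes "u \<in> holder_space (Suc k) s"
  shows "partial_deriv i u \<in> holder_space k s"
proof -
  have "length is < Suc k \<longrightarrow> has_partial_derivs (iter_partial is u)"
    "length is \<le> Suc k \<longrightarrow> continuous_on UNIV (iter_partial is u)"
    "length is = Suc k \<longrightarrow> holder_continuous s (iter_partial is u)" for "is"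
    using assms unfolding holder_space_def by blast+
  \<comment> \<open>The last entry of the list is applied first, so appending \<open>i\<close> at
    the end passes from \<open>u\<close> to \<open>partial_deriv i u\<close>.\<close>
  from this[of "_ @ [i]"] show ?thesis
    unfolding holder_space_def iter_partial_simps by simp
qed

lemma holder_space_has_partial_derivs:
  "u \<in> holder_space (Suc k) s \<Longrightarrow> has_partial_derivs u"
  unfolding holder_space_def
  by (metis (lifting) iter_partial_simps(1) list.size(3) mem_Collect_eq zero_less_Suc)

lemma has_real_derivative_partial_deriv:
  assumes "has_partial_derivs f"
  shows "((\<lambda>t. f (x + t *\<^sub>R axis i 1)) has_real_derivative
           partial_deriv i f (x + t *\<^sub>R axis i 1)) (at t)"
proof -
  let ?g = "\<lambda>r. f ((x + t *\<^sub>R axis i 1) + r *\<^sub>R axis i 1)"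
  have "?g differentiable (at 0)"
    using assms unfolding has_partial_derivs_def by blast
  then have "(?g has_real_derivative deriv ?g 0) (at 0)"
    by (simp add: DERIV_deriv_iff_real_differentiable)
  then have "((\<lambda>r. f (x + (r + t) *\<^sub>R axis i 1)) has_real_derivative
      partial_deriv i f (x + t *\<^sub>R axis i 1)) (at 0)"
    by (simp add: partial_deriv_def algebra_simps)
  then show ?thesis
    by (simp add: DERIV_shift[of "\<lambda>r. f (x + r *\<^sub>R axis i 1)" _ 0 t, simplified])
qed

text \<open>The induction adds one coordinate direction at a time; this is where continuity of the partial
  derivatives enters.\<close>

lemma has_real_derivative_along_partial:
  fixes f :: "real^'d::finite \<Rightarrow> real"
  assumes f: "has_partial_derivs f" and cont: "\<And>i. continuous_on UNIV (partial_deriv i f)"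
    and "finite S"
  shows "((\<lambda>t. f (x + t *\<^sub>R (\<Sum>i\<in>S. v $ i *\<^sub>R axis i 1))) has_real_derivative
           (\<Sum>i\<in>S. v $ i * partial_deriv i f (x + t *\<^sub>R (\<Sum>i\<in>S. v $ i *\<^sub>R axis i 1)))) (at t)"
  using \<open>finite S\<close>
proof (induction S arbitrary: x t)
  case empty
  then show ?case by simp
next
  case (insert j S)
  define w where "w = (\<Sum>i\<in>S. v $ i *\<^sub>R (axis i 1 :: real^'d))"
  define e where "e = (axis j 1 :: real^'d)"
  define D where "D = (\<Sum>i\<in>S. v $ i * partial_deriv i f (x + t *\<^sub>R (v $ j *\<^sub>R e + w)))"
  define fy where "fy = (\<lambda>p q. (v $ j * partial_deriv j f (x + p *\<^sub>R w + (q * v $ j) *\<^sub>R e)) *\<^sub>R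
      (id_blinfun :: real \<Rightarrow>\<^sub>L real))"
  \<comment> \<open>The direction is split into \<open>w\<close> and the new axis \<open>e\<close>,
    each with its own parameter. Joint differentiability at (t, t) follows from differentiability in
    \<open>p\<close> there, by induction, and a derivative in \<open>q\<close> that exists
    everywhere and is continuous. Composition with the diagonal gives the claim.\<close>
  have "((\<lambda>(p, q). f (x + p *\<^sub>R w + (q * v $ j) *\<^sub>R e)) has_derivative
      (\<lambda>(tp, tq). tp * D + blinfun_apply (fy t t) tq)) (at (t, t) within UNIV \<times> UNIV)"
  proof (rule has_derivative_partialsI[where fy = fy and fx = "\<lambda>tp. tp * D"])
    have "((\<lambda>p. f ((x + (t * v $ j) *\<^sub>R e) + p *\<^sub>R w)) has_real_derivative
        (\<Sum>i\<in>S. v $ i * partial_deriv i f ((x + (t * v $ j) *\<^sub>R e) + t *\<^sub>R w))) (at t)"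
      unfolding w_def by (rule insert.IH)
    then have "((\<lambda>p. f (x + p *\<^sub>R w + (t * v $ j) *\<^sub>R e)) has_real_derivative D) (at t)"
      by (simp add: D_def algebra_simps)
    then show "((\<lambda>p. f (x + p *\<^sub>R w + (t * v $ j) *\<^sub>R e)) has_derivative (\<lambda>tp. tp * D)) (at t)"
      by (simp add: has_field_derivative_def mult_commute_abs)
  next
    fix p q :: real
    have "((\<lambda>q. f ((x + p *\<^sub>R w) + q *\<^sub>R e)) has_real_derivative
        partial_deriv j f ((x + p *\<^sub>R w) + (q * v $ j) *\<^sub>R e)) (at (q * v $ j))"
      unfolding e_def by (rule has_real_derivative_partial_deriv[OF f])
    moreover have "((\<lambda>q. q * v $ j) has_real_derivative v $ j) (at q)"
      by (auto intro!: derivative_eq_intros)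
    ultimately have "((\<lambda>q. f (x + p *\<^sub>R w + (q * v $ j) *\<^sub>R e)) has_real_derivative
        partial_deriv j f ((x + p *\<^sub>R w) + (q * v $ j) *\<^sub>R e) * v $ j) (at q)"
      by (rule DERIV_chain2[where f = "\<lambda>r. f ((x + p *\<^sub>R w) + r *\<^sub>R e)"])
    then show "((\<lambda>q. f (x + p *\<^sub>R w + (q * v $ j) *\<^sub>R e)) has_derivative
        blinfun_apply (fy p q)) (at q)"
      by (rule has_field_derivative_imp_has_derivative[THEN has_derivative_eq_rhs])
        (simp add: fy_def scaleR_blinfun.rep_eq id_blinfun.rep_eq fun_eq_iff)
  next
    have "continuous_on UNIV (\<lambda>z::real \<times> real. partial_deriv j f (x + fst z *\<^sub>R w + (snd z * v $ j) *\<^sub>R e))"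
      by (rule continuous_on_compose2[OF cont[of j]]) (auto intro!: continuous_intros)
    then have "continuous_on UNIV (\<lambda>(p, q). fy p q)"
      unfolding fy_def case_prod_unfold by (intro continuous_intros)
    then show "continuous (at (t, t) within UNIV \<times> UNIV) (\<lambda>(p, q). fy p q)"
      by (simp add: continuous_on_eq_continuous_at)
  qed simp_all
  moreover have "((\<lambda>r. (r, r)) has_derivative (\<lambda>r. (r, r))) (at t)"
    by (auto intro!: derivative_eq_intros)
  ultimately have "((\<lambda>r. f (x + r *\<^sub>R w + (r * v $ j) *\<^sub>R e)) has_derivative
      (\<lambda>r. r * D + blinfun_apply (fy t t) r)) (at t)"
    using has_derivative_compose[of "\<lambda>r. (r, r)" "\<lambda>r. (r, r)" t UNIV
        "\<lambda>(p, q). f (x + p *\<^sub>R w + (q * v $ j) *\<^sub>R e)"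
        "\<lambda>(tp, tq). tp * D + blinfun_apply (fy t t) tq"] by simp
  moreover have "(\<lambda>r. r * D + blinfun_apply (fy t t) r) =
      (*) (\<Sum>i\<in>insert j S. v $ i * partial_deriv i f (x + t *\<^sub>R (v $ j *\<^sub>R e + w)))"
    using insert.hyps
    by (simp add: fun_eq_iff fy_def D_def e_def scaleR_blinfun.rep_eq id_blinfun.rep_eq algebra_simps)
  ultimately show ?case
    using insert.hyps
    by (simp add: has_field_derivative_def w_def[symmetric] e_def[symmetric] algebra_simps)
qed

lemma has_real_derivative_along_line:
  fixes u :: "real^'d::finite \<Rightarrow> real"
  assumes "u \<in> holder_space (Suc k) s"
  shows "((\<lambda>t. u (x + t *\<^sub>R v)) has_real_derivative
           (\<Sum>i\<in>UNIV. v $ i * partial_deriv i u (x + t *\<^sub>R v))) (at t)"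
proof -
  have "(\<Sum>i\<in>UNIV. v $ i *\<^sub>R axis i 1) = v"
    using basis_expansion[of v] by (simp add: scalar_mult_eq_scaleR)
  then show ?thesis
    using has_real_derivative_along_partial[of u UNIV x v t]
      holder_space_has_partial_derivs[OF assms]
      holder_space_continuous[OF partial_deriv_holder_space[OF assms]]
    by simp
qed

text \<open>Induction on \<open>k\<close>: since \<open>dir_deriv (Suc j)\<close> takes one partial
  derivative of the function first, the derivative along the segment of the Taylor remainder of
  \<open>u\<close> is a combination, with coefficients \<open>v $ i\<close>, of the remainders of
  order \<open>k\<close> of the partial derivatives. The mean value theorem then gains one power of
  \<open>norm v\<close>. The constant depends neither on \<open>x\<close> nor on
  \<open>v\<close>.\<close>

lemma holder_space_taylor:
  fixes u :: "real^'d::finite \<Rightarrow> real"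
  assumes "u \<in> holder_space k s" "0 < s"
  shows "\<exists>K\<ge>0. \<forall>x v. \<bar>u (x + v) - (\<Sum>j\<le>k. dir_deriv j u x v / fact j)\<bar> \<le> K * norm v powr (k + s)"
  using assms(1)
proof (induction k arbitrary: u)
  case 0
  then obtain K where K: "\<And>x y. \<bar>u x - u y\<bar> \<le> K * norm (x - y) powr s"
    using holder_space_0 unfolding holder_continuous_def by blast
  have "\<bar>u (x + v) - u x\<bar> \<le> \<bar>K\<bar> * norm v powr s" for x v
    using K[of "x + v" x] mult_right_mono[OF abs_ge_self[of K] powr_ge_zero[of "norm v" s]] by simp
  then show ?case by (intro exI[of _ "\<bar>K\<bar>"]) auto
next
  case (Suc k)
  have "\<forall>i. \<exists>K\<ge>0. \<forall>x v. \<bar>partial_deriv i u (x + v) - (\<Sum>j\<le>k. dir_deriv j (partial_deriv i u) x v / fact j)\<bar>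
      \<le> K * norm v powr (k + s)"
    using Suc.IH[OF partial_deriv_holder_space[OF Suc.prems]] ..
  from choice[OF this] obtain K where "\<forall>i. 0 \<le> K i \<and> (\<forall>x v. \<bar>partial_deriv i u (x + v) -
        (\<Sum>j\<le>k. dir_deriv j (partial_deriv i u) x v / fact j)\<bar> \<le> K i * norm v powr (k + s))"
    by blast
  then have K0: "\<And>i. 0 \<le> K i" and
    K: "\<And>i x v. \<bar>partial_deriv i u (x + v) - (\<Sum>j\<le>k. dir_deriv j (partial_deriv i u) x v / fact j)\<bar>
      \<le> K i * norm v powr (k + s)" by blast+
  have "\<bar>u (x + v) - (\<Sum>j\<le>Suc k. dir_deriv j u x v / fact j)\<bar> \<le> (\<Sum>i\<in>UNIV. K i) * norm v powr (Suc k + s)"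
    for x v
  proof -
    define g where "g t = u (x + t *\<^sub>R v) - (\<Sum>j\<le>Suc k. t ^ j * (dir_deriv j u x v / fact j))" for t
    define g' where "g' t = (\<Sum>i\<in>UNIV. v $ i * (partial_deriv i u (x + t *\<^sub>R v) -
        (\<Sum>j\<le>k. dir_deriv j (partial_deriv i u) x (t *\<^sub>R v) / fact j)))" for t
    have poly: "((\<lambda>t. \<Sum>j\<le>Suc k. t ^ j * (dir_deriv j u x v / fact j)) has_real_derivative
        (\<Sum>i\<in>UNIV. v $ i * (\<Sum>j\<le>k. dir_deriv j (partial_deriv i u) x (t *\<^sub>R v) / fact j))) (at t)" for t
    proof -
      have "((\<lambda>t. \<Sum>j\<le>k. t ^ Suc j * (dir_deriv (Suc j) u x v / fact (Suc j))) has_real_derivative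
          (\<Sum>j\<le>k. real (Suc j) * t ^ j * (dir_deriv (Suc j) u x v / fact (Suc j)))) (at t)"
        by (auto intro!: derivative_eq_intros sum.cong simp del: fact_Suc power_Suc dir_deriv.simps)
      moreover have "real (Suc j) * t ^ j * (dir_deriv (Suc j) u x v / fact (Suc j)) =
          (\<Sum>i\<in>UNIV. v $ i * (dir_deriv j (partial_deriv i u) x (t *\<^sub>R v) / fact j))" for j
      proof -
        have "real (Suc j) * t ^ j * (dir_deriv (Suc j) u x v / fact (Suc j)) =
            t ^ j * (dir_deriv (Suc j) u x v / fact j)"
          by (simp del: dir_deriv.simps of_nat_Suc)
        then show ?thesis
          by (simp add: dir_deriv_scaleR sum_distrib_left sum_divide_distrib algebra_simps)
      qed
      ultimately have "((\<lambda>t. \<Sum>j\<le>k. t ^ Suc j * (dir_deriv (Suc j) u x v / fact (Suc j))) has_real_derivative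
          (\<Sum>j\<le>k. \<Sum>i\<in>UNIV. v $ i * (dir_deriv j (partial_deriv i u) x (t *\<^sub>R v) / fact j))) (at t)"
        by simp
      then have "((\<lambda>t. \<Sum>j\<le>k. t ^ Suc j * (dir_deriv (Suc j) u x v / fact (Suc j))) has_real_derivative
          (\<Sum>i\<in>UNIV. v $ i * (\<Sum>j\<le>k. dir_deriv j (partial_deriv i u) x (t *\<^sub>R v) / fact j))) (at t)"
        by (subst (asm) sum.swap) (simp add: sum_distrib_left)
      moreover have "(\<lambda>t. \<Sum>j\<le>Suc k. t ^ j * (dir_deriv j u x v / fact j)) =
          (\<lambda>t. u x + (\<Sum>j\<le>k. t ^ Suc j * (dir_deriv (Suc j) u x v / fact (Suc j))))"
        by (subst sum.atMost_Suc_shift) simp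
      ultimately show ?thesis
        using DERIV_add[OF DERIV_const[of "u x"]] by (simp only: add_0)
    qed
    have deriv: "(g has_real_derivative g' t) (at t)" for t
    proof -
      have "(g has_real_derivative (\<Sum>i\<in>UNIV. v $ i * partial_deriv i u (x + t *\<^sub>R v)) -
         (\<Sum>i\<in>UNIV. v $ i * (\<Sum>j\<le>k. dir_deriv j (partial_deriv i u) x (t *\<^sub>R v) / fact j))) (at t)"
        unfolding g_def by (intro DERIV_diff poly has_real_derivative_along_line[OF Suc.prems])
      then show ?thesis
        by (simp add: g'_def sum_subtractf right_diff_distrib)
    qed
    have "\<exists>z. 0 < z \<and> z < 1 \<and> g 1 - g 0 = (1 - 0) * g' z"
      using deriv by (intro MVT2) simp_all
    then obtain z where z: "0 < z" "z < 1" "g 1 - g 0 = (1 - 0) * g' z"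
      by blast
    have "\<bar>g' z\<bar> \<le> (\<Sum>i\<in>UNIV. norm v * (K i * norm v powr (k + s)))"
      unfolding g'_def
    proof (rule order_trans[OF sum_abs], rule sum_mono)
      fix i :: 'd
      have "norm (z *\<^sub>R v) powr (k + s) \<le> norm v powr (k + s)"
        using z assms(2) by (intro powr_mono2) (auto simp: mult_left_le_one_le)
      then have le: "K i * norm (z *\<^sub>R v) powr (k + s) \<le> K i * norm v powr (k + s)"
        by (intro mult_left_mono K0)
      then show "\<bar>v $ i * (partial_deriv i u (x + z *\<^sub>R v) -
          (\<Sum>j\<le>k. dir_deriv j (partial_deriv i u) x (z *\<^sub>R v) / fact j))\<bar>
          \<le> norm v * (K i * norm v powr (k + s))"
        unfolding abs_mult
        by (intro mult_mono component_le_norm_cart order_trans[OF K le]) (auto simp: K0)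
    qed
    also have "\<dots> = (\<Sum>i\<in>UNIV. K i) * norm v powr (Suc k + s)"
    proof (cases "v = 0")
      case False
      then have "norm v powr (Suc k + s) = norm v * norm v powr (k + s)"
        using powr_add[of "norm v" 1 "k + s"] by (simp add: algebra_simps)
      then show ?thesis by (simp add: sum_distrib_left sum_distrib_right algebra_simps)
    qed simp
    finally have "\<bar>g 1 - g 0\<bar> \<le> (\<Sum>i\<in>UNIV. K i) * norm v powr (Suc k + s)"
      using z by simp
    moreover have "g 0 = 0"
      unfolding g_def by (subst sum.atMost_Suc_shift) simp
    ultimately show ?thesis by (simp add: g_def)
  qed
  moreover have "0 \<le> (\<Sum>i\<in>UNIV. K i)" by (simp add: K0 sum_nonneg)
  ultimately show ?case by blast
qed

subsection \<open>Reflections\<close>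

lemma card_multi_indices: "card (multi_indices M :: (nat^'d::finite) set) = M ^ CARD('d)"
proof -
  have "bij_betw vec_nth (multi_indices M :: (nat^'d) set) (Pi\<^sub>E UNIV (\<lambda>_. {..<M}))"
    by (rule bij_betwI[where g = vec_lambda]) (auto simp: multi_indices_def vec_lambda_inverse)
  then show ?thesis
    by (simp add: bij_betw_same_card card_PiE)
qed

lemma multi_indices_2: "m \<in> multi_indices 2 \<longleftrightarrow> (\<forall>i. m $ i = 0 \<or> m $ i = 1)"
  by (auto simp: multi_indices_def less_2_cases_iff)

lemma reflect_linear: "linear (reflect m)"
  by (rule linearI) (simp_all add: reflect_def vec_eq_iff algebra_simps)

lemmas reflect_add = linear_add[OF reflect_linear]
lemmas reflect_scaleR = linear_scale[OF reflect_linear]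

lemma reflect_reflect [simp]: "reflect m (reflect m \<xi>) = \<xi>"
  by (simp add: reflect_def vec_eq_iff flip: power_add mult.assoc)

lemma norm_reflect [simp]: "norm (reflect m \<xi>) = norm (\<xi> :: real^'d::finite)"
  by (simp add: norm_vec_def reflect_def abs_mult power_abs)

text \<open>Toggling 0/1 labels. On sign patterns this reverses the signs of the coordinates in
  \<open>S\<close>; on the corner labels of a cell, with \<open>S = UNIV\<close>, it passes to the
  opposite corner.\<close>

definition flip :: "'d set \<Rightarrow> nat^'d \<Rightarrow> nat^'d" where
  "flip S m = (\<chi> i. if i \<in> S then 1 - m $ i else m $ i)"

lemma reflect_flip:
  "m \<in> multi_indices 2 \<Longrightarrow> reflect (flip S m) \<xi> $ i = (if i \<in> S then - 1 else 1) * reflect m \<xi> $ i"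
  unfolding multi_indices_2 by (drule spec[of _ i]) (auto simp: reflect_def flip_def)

lemma reflect_flip_UNIV: "m \<in> multi_indices 2 \<Longrightarrow> reflect (flip UNIV m) \<xi> = - reflect m \<xi>"
  by (simp add: vec_eq_iff reflect_flip)

lemma flip_multi_indices_2: "m \<in> multi_indices 2 \<Longrightarrow> flip S m \<in> multi_indices 2"
  by (auto simp: multi_indices_def flip_def)

lemma flip_flip: "m \<in> multi_indices 2 \<Longrightarrow> flip S (flip S m) = m"
  unfolding multi_indices_2 by (auto simp: flip_def vec_eq_iff) (metis diff_zero diff_self_eq_0)

lemma sum_multi_indices_flip:
  fixes F :: "nat^'d::finite \<Rightarrow> real"
  shows "(\<Sum>m\<in>multi_indices 2. F (flip S m)) = (\<Sum>m\<in>multi_indices 2. F m)"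
  by (rule sum.reindex_bij_witness[where i = "flip S" and j = "flip S"])
    (simp_all add: flip_multi_indices_2 flip_flip)

text \<open>Toggling permutes the labels, so the sum equals its own negative. All parity
  cancellations, of Taylor terms as well as of cell corners, are instances of this.\<close>

lemma sum_multi_indices_odd:
  fixes F :: "nat^'d \<Rightarrow> real"
  assumes "\<And>m. m \<in> multi_indices 2 \<Longrightarrow> F (flip S m) = - F m"
  shows "(\<Sum>m\<in>multi_indices 2. F m) = 0"
proof -
  have "(\<Sum>m\<in>multi_indices 2. F m) = (\<Sum>m\<in>multi_indices 2. - F m)"
    using assms by (subst sum_multi_indices_flip[symmetric, of F S]) simp
  then show ?thesis by (simp add: sum_negf)
qed

text \<open>For distinct coordinates, reversing the sign of \<open>i\<close> alone cancels the sum.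
  Hence mixed second derivatives disappear from the second difference and only squares of
  coordinates survive.\<close>

lemma sum_reflect_nth_mult:
  fixes v w :: "real^'d::finite"
  shows "(\<Sum>m\<in>multi_indices 2. reflect m v $ i * reflect m w $ j) =
           (if i = j then 2 ^ CARD('d) * (v $ i * w $ i) else 0)"
proof (cases "i = j")
  case True
  have "reflect m v $ i * reflect m w $ i = v $ i * w $ i" for m
    by (simp add: reflect_def)
  with True show ?thesis by (simp add: card_multi_indices)
next
  case False
  then show ?thesis
    by (simp add: sum_multi_indices_odd[where S = "{i}"] reflect_flip)
qed

lemma sum_reflect_dir_deriv_odd:
  "odd j \<Longrightarrow> (\<Sum>m\<in>multi_indices 2. dir_deriv j f x (reflect m \<xi>)) = 0"
  by (rule sum_multi_indices_odd[where S = UNIV])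
    (simp add: reflect_flip_UNIV dir_deriv_uminus)

lemma sum_reflect_nth_dir_deriv_even:
  "even j \<Longrightarrow> (\<Sum>m\<in>multi_indices 2. reflect m v $ i * dir_deriv j f x (reflect m \<xi>)) = 0"
  by (rule sum_multi_indices_odd[where S = UNIV])
    (simp add: reflect_flip_UNIV dir_deriv_uminus)

lemma sum_reflect_nth_nth_dir_deriv_odd:
  "odd j \<Longrightarrow> (\<Sum>m\<in>multi_indices 2. reflect m v $ i * reflect m w $ i' * dir_deriv j f x (reflect m \<xi>)) = 0"
  by (rule sum_multi_indices_odd[where S = UNIV])
    (simp add: reflect_flip_UNIV dir_deriv_uminus)

subsection \<open>Symmetric second differences\<close>

definition second_diff :: "(real^'d::finite \<Rightarrow> real) \<Rightarrow> real^'d \<Rightarrow> real^'d \<Rightarrow> real" where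
  "second_diff u x \<xi> = (\<Sum>m\<in>multi_indices 2. u (x + reflect m \<xi>)) - 2 ^ CARD('d) * u x"

text \<open>The derivative of \<open>second_diff u x\<close> at \<open>\<xi>\<close> along
  \<open>v\<close>: by linearity of \<open>reflect m\<close>, the inner derivative of each summand
  is \<open>reflect m v\<close>.\<close>

definition second_diff_grad :: "(real^'d::finite \<Rightarrow> real) \<Rightarrow> real^'d \<Rightarrow> real^'d \<Rightarrow> real^'d \<Rightarrow> real" where
  "second_diff_grad u x \<xi> v =
     (\<Sum>i\<in>UNIV. \<Sum>m\<in>multi_indices 2. reflect m v $ i * partial_deriv i u (x + reflect m \<xi>))"

lemma linear_second_diff_grad: "linear (second_diff_grad u x \<xi>)"
  by (rule linearI)
    (simp_all add: second_diff_grad_def reflect_add reflect_scaleR algebra_simps sum.distrib sum_distrib_left)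

text \<open>Models a function that is homogeneous of degree \<open>p\<close>: a derivative costs a factor \<open>norm \<xi>\<close>, and
  the first-order expansion at \<open>\<xi>\<close> has a remainder of order \<open>\<theta>\<close>.\<close>

definition holder_profile :: "real \<Rightarrow> real \<Rightarrow> real \<Rightarrow> (real^'d::finite \<Rightarrow> real) \<Rightarrow> bool" where
  "holder_profile A p \<theta> \<psi> \<longleftrightarrow> (\<exists>\<psi>'. (\<forall>\<xi>. linear (\<psi>' \<xi>)) \<and>
     (\<forall>\<xi>. \<bar>\<psi> \<xi>\<bar> \<le> A * norm \<xi> powr p) \<and>
     (\<forall>\<xi> v. \<bar>\<psi>' \<xi> v\<bar> \<le> A * norm \<xi> powr (p - 1) * norm v) \<and>
     (\<forall>\<xi> v. norm v \<le> norm \<xi> \<longrightarrow>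
        \<bar>\<psi> (\<xi> + v) - \<psi> \<xi> - \<psi>' \<xi> v\<bar> \<le> A * norm v powr \<theta> * norm \<xi> powr (p - \<theta>)))"

lemma holder_profileI:
  assumes "\<And>\<xi>. linear (\<psi>' \<xi>)" "\<And>\<xi>. \<bar>\<psi> \<xi>\<bar> \<le> A * norm \<xi> powr p"
    and "\<And>\<xi> v. \<bar>\<psi>' \<xi> v\<bar> \<le> B * norm \<xi> powr (p - 1) * norm v"
    and "\<And>\<xi> v. norm v \<le> norm \<xi> \<Longrightarrow>
        \<bar>\<psi> (\<xi> + v) - \<psi> \<xi> - \<psi>' \<xi> v\<bar> \<le> C * norm v powr \<theta> * norm \<xi> powr (p - \<theta>)"
    and "0 \<le> A" "0 \<le> B" "0 \<le> C"
  shows "holder_profile (A + B + C) p \<theta> \<psi>"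
  unfolding holder_profile_def
proof (intro exI[of _ \<psi>'] conjI allI impI)
  show "\<bar>\<psi> \<xi>\<bar> \<le> (A + B + C) * norm \<xi> powr p" for \<xi>
    by (rule order_trans[OF assms(2)]) (use assms(5-7) in \<open>auto intro!: mult_right_mono\<close>)
  show "\<bar>\<psi>' \<xi> v\<bar> \<le> (A + B + C) * norm \<xi> powr (p - 1) * norm v" for \<xi> v
    by (rule order_trans[OF assms(3)]) (use assms(5-7) in \<open>auto intro!: mult_right_mono\<close>)
  show "\<bar>\<psi> (\<xi> + v) - \<psi> \<xi> - \<psi>' \<xi> v\<bar> \<le> (A + B + C) * norm v powr \<theta> * norm \<xi> powr (p - \<theta>)"
    if "norm v \<le> norm \<xi>" for \<xi> v
    by (rule order_trans[OF assms(4)[OF that]]) (use assms(5-7) in \<open>auto intro!: mult_right_mono\<close>)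
qed (use assms(1) in auto)

lemma abs_sum_mult_le:
  fixes f g :: "'a \<Rightarrow> real"
  assumes "\<And>m. m \<in> S \<Longrightarrow> \<bar>f m\<bar> \<le> a" "\<And>m. m \<in> S \<Longrightarrow> \<bar>g m\<bar> \<le> b"
  shows "\<bar>\<Sum>m\<in>S. f m * g m\<bar> \<le> real (card S) * (a * b)"
proof -
  have "\<bar>\<Sum>m\<in>S. f m * g m\<bar> \<le> (\<Sum>m\<in>S. a * b)"
    using assms by (intro order_trans[OF sum_abs] sum_mono) (force simp: abs_mult intro!: mult_mono)
  then show ?thesis by simp
qed

lemma abs_sum_le_card:
  fixes f :: "'a \<Rightarrow> real"
  assumes "\<And>m. m \<in> S \<Longrightarrow> \<bar>f m\<bar> \<le> a"
  shows "\<bar>\<Sum>m\<in>S. f m\<bar> \<le> real (card S) * a"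
  using abs_sum_mult_le[of S f a "\<lambda>_. 1" 1] assms by simp

lemma reflect_component_le: "\<bar>reflect m v $ i\<bar> \<le> norm (v :: real^'d::finite)"
  using component_le_norm_cart[of "reflect m v" i] by simp

lemma second_diff_taylor:
  "second_diff u x \<xi> - (\<Sum>j\<in>{1..k}. (\<Sum>m\<in>multi_indices 2. dir_deriv j u x (reflect m \<xi>)) / fact j) =
    (\<Sum>m\<in>multi_indices 2. u (x + reflect m \<xi>) - (\<Sum>j\<le>k. dir_deriv j u x (reflect m \<xi>) / fact j))"
proof -
  have "(\<Sum>m\<in>multi_indices 2. \<Sum>j\<le>k. dir_deriv j u x (reflect m \<xi>) / fact j) =
      (\<Sum>j\<le>k. (\<Sum>m\<in>multi_indices 2. dir_deriv j u x (reflect m \<xi>)) / fact j)"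
    by (subst sum.swap) (simp add: sum_divide_distrib)
  also have "\<dots> = 2 ^ CARD('a) * u x +
      (\<Sum>j\<in>{1..k}. (\<Sum>m\<in>multi_indices 2. dir_deriv j u x (reflect m \<xi>)) / fact j)"
    by (subst atMost_atLeast0, subst sum.atLeast_Suc_atMost) (simp_all add: card_multi_indices)
  finally show ?thesis
    by (simp add: second_diff_def sum_subtractf)
qed

text \<open>The linear Taylor term of \<open>u\<close> at \<open>x\<close> cancels by parity, so the
  size is that of the remainder. The expansion at \<xi> is the sum of the first-order expansions of
  \<open>u\<close> at the reflected points; its remainder depends on \<open>v\<close> only, whence
  \<theta> = p.\<close>

proposition holder_profile_second_diff_1:
  fixes u :: "real^'d::finite \<Rightarrow> real"
  assumes u: "u \<in> holder_space 1 s" and s: "0 < s"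
  shows "\<exists>A\<ge>0. \<forall>x. holder_profile A (1 + s) (1 + s) (second_diff u x)"
proof -
  let ?I = "multi_indices 2 :: (nat^'d) set"
  obtain K where K0: "0 \<le> K" and
    "\<And>x v. \<bar>u (x + v) - (\<Sum>j\<le>1. dir_deriv j u x v / fact j)\<bar> \<le> K * norm v powr (1 + s)"
    using holder_space_taylor[OF u s] by auto
  then have K: "\<And>x v. \<bar>u (x + v) - u x - (\<Sum>i\<in>UNIV. v $ i * partial_deriv i u x)\<bar> \<le> K * norm v powr (1 + s)"
    by (simp add: algebra_simps)
  have "\<forall>i. \<exists>K\<ge>0. \<forall>x v. \<bar>partial_deriv i u (x + v) - partial_deriv i u x\<bar> \<le> K * norm v powr s"
    using holder_space_taylor[OF partial_deriv_holder_space[of u 0 s] s] u by simp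
  from choice[OF this] obtain K1 where K1: "\<And>i. 0 \<le> K1 i"
    "\<And>i x v. \<bar>partial_deriv i u (x + v) - partial_deriv i u x\<bar> \<le> K1 i * norm v powr s"
    by blast
  have "holder_profile (2 ^ CARD('d) * K + 2 ^ CARD('d) * (\<Sum>i\<in>UNIV. K1 i) + 2 ^ CARD('d) * K)
      (1 + s) (1 + s) (second_diff u x)" for x
  proof (rule holder_profileI[where \<psi>' = "second_diff_grad u x"])
    fix \<xi> v :: "real^'d"
    show "linear (second_diff_grad u x \<xi>)" by (rule linear_second_diff_grad)
    have odd: "(\<Sum>m\<in>?I. \<Sum>i\<in>UNIV. reflect m \<xi> $ i * partial_deriv i u x) = 0"
      using sum_reflect_dir_deriv_odd[of 1 u x \<xi>] by simp
    have "second_diff u x \<xi> =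
        (\<Sum>m\<in>?I. u (x + reflect m \<xi>) - u x - (\<Sum>i\<in>UNIV. reflect m \<xi> $ i * partial_deriv i u x))"
      by (simp only: sum_subtractf odd) (simp add: second_diff_def card_multi_indices)
    also have "\<bar>\<dots>\<bar> \<le> real (card ?I) * (K * norm \<xi> powr (1 + s))"
      by (rule abs_sum_le_card, rule K[where v = "reflect _ _", unfolded norm_reflect])
    finally show "\<bar>second_diff u x \<xi>\<bar> \<le> 2 ^ CARD('d) * K * norm \<xi> powr (1 + s)"
      by (simp add: card_multi_indices mult.assoc)
    \<comment> \<open>The constants \<open>partial_deriv i u x\<close> may be subtracted because the
      components \<open>reflect m v $ i\<close> add up to zero over \<open>m\<close>. This is what
      makes the gradient small near the origin.\<close>
    have "second_diff_grad u x \<xi> v = (\<Sum>i\<in>UNIV. \<Sum>m\<in>?I.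
        reflect m v $ i * (partial_deriv i u (x + reflect m \<xi>) - partial_deriv i u x))"
      using sum_reflect_nth_dir_deriv_even[of 0 v _ "partial_deriv _ u" x]
      by (simp add: second_diff_grad_def right_diff_distrib sum_subtractf)
    also have "\<bar>\<dots>\<bar> \<le> (\<Sum>i\<in>UNIV. real (card ?I) * (norm v * (K1 i * norm \<xi> powr s)))"
      by (rule order_trans[OF sum_abs], rule sum_mono, rule abs_sum_mult_le[OF reflect_component_le],
          rule K1(2)[where v = "reflect _ _", unfolded norm_reflect])
    also have "\<dots> = 2 ^ CARD('d) * (\<Sum>i\<in>UNIV. K1 i) * norm \<xi> powr (1 + s - 1) * norm v"
      by (simp add: card_multi_indices sum_distrib_left sum_distrib_right mult_ac)
    finally show "\<bar>second_diff_grad u x \<xi> v\<bar> \<le> \<dots>" .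
    have "second_diff u x (\<xi> + v) - second_diff u x \<xi> - second_diff_grad u x \<xi> v =
        (\<Sum>m\<in>?I. u ((x + reflect m \<xi>) + reflect m v) - u (x + reflect m \<xi>) -
          (\<Sum>i\<in>UNIV. reflect m v $ i * partial_deriv i u (x + reflect m \<xi>)))"
      unfolding second_diff_grad_def second_diff_def
      by (subst sum.swap) (simp add: sum_subtractf reflect_add add.assoc)
    also have "\<bar>\<dots>\<bar> \<le> real (card ?I) * (K * norm v powr (1 + s))"
      by (rule abs_sum_le_card, rule K[where v = "reflect _ _", unfolded norm_reflect])
    finally have le: "\<bar>second_diff u x (\<xi> + v) - second_diff u x \<xi> - second_diff_grad u x \<xi> v\<bar>
        \<le> 2 ^ CARD('d) * K * norm v powr (1 + s)"
      by (simp add: card_multi_indices mult.assoc)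
    assume "norm v \<le> norm \<xi>"
    \<comment> \<open>Since \<open>0 powr 0 = 0\<close>, the last factor vanishes at
      \<open>\<xi> = 0\<close> instead of being 1; but there \<open>norm v \<le> norm \<xi>\<close>
      forces \<open>v = 0\<close>, so both sides are zero.\<close>
    with le show "\<bar>second_diff u x (\<xi> + v) - second_diff u x \<xi> - second_diff_grad u x \<xi> v\<bar>
        \<le> 2 ^ CARD('d) * K * norm v powr (1 + s) * norm \<xi> powr (1 + s - (1 + s))"
      by (cases "\<xi> = 0") auto
  qed (auto simp: K0 K1 sum_nonneg)
  moreover have "0 \<le> 2 ^ CARD('d) * K + 2 ^ CARD('d) * (\<Sum>i\<in>UNIV. K1 i) + 2 ^ CARD('d) * K"
    by (simp add: K0 K1 sum_nonneg)
  ultimately show ?thesis by blast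
qed

lemma second_order_remainder:
  fixes f f' f'' :: "real \<Rightarrow> real"
  assumes f: "\<And>t. 0 \<le> t \<Longrightarrow> t \<le> 1 \<Longrightarrow> (f has_real_derivative f' t) (at t)"
    and f': "\<And>t. 0 \<le> t \<Longrightarrow> t \<le> 1 \<Longrightarrow> (f' has_real_derivative f'' t) (at t)"
    and f'': "\<And>t. 0 \<le> t \<Longrightarrow> t \<le> 1 \<Longrightarrow> \<bar>f'' t\<bar> \<le> M"
  shows "\<bar>f 1 - f 0 - f' 0\<bar> \<le> M"
proof -
  have "\<exists>z. 0 < z \<and> z < 1 \<and> f 1 - f 0 = (1 - 0) * f' z"
    using f by (intro MVT2) simp_all
  then obtain z where z: "0 < z" "z < 1" "f 1 - f 0 = f' z" by auto
  have "\<exists>y. 0 < y \<and> y < z \<and> f' z - f' 0 = (z - 0) * f'' y"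
    using z f' by (intro MVT2) simp_all
  then obtain y where y: "0 < y" "y < z" "f' z - f' 0 = z * f'' y" by auto
  have "\<bar>z * f'' y\<bar> \<le> 1 * M"
    unfolding abs_mult using z y f''[of y] by (intro mult_mono) auto
  with z y show ?thesis by simp
qed

text \<open>The even part of second order in the expansion is split off, since it does not decay fast
  enough; all terms of odd order cancel.\<close>

proposition holder_profile_second_diff_3:
  fixes u :: "real^'d::finite \<Rightarrow> real"
  assumes u: "u \<in> holder_space 3 s" and s: "0 < s"
  shows "\<exists>A\<ge>0. \<forall>x. holder_profile A (3 + s) 2 (\<lambda>\<xi>. second_diff u x \<xi> -
           (\<Sum>i\<in>UNIV. 2 ^ CARD('d) / 2 * partial_deriv i (partial_deriv i u) x * (\<xi> $ i)\<^sup>2))"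
proof -
  let ?I = "multi_indices 2 :: (nat^'d) set"
  let ?c = "2 ^ CARD('d) :: real"
  let ?D1 = "\<lambda>i. partial_deriv i u"
  let ?D2 = "\<lambda>i j. partial_deriv j (partial_deriv i u)"
  have u1: "?D1 i \<in> holder_space 2 s" for i
    using partial_deriv_holder_space[of u 2 s] u by (simp add: eval_nat_numeral)
  have u2: "?D2 i j \<in> holder_space 1 s" for i j
    using partial_deriv_holder_space[of "?D1 i" 1 s] u1 by (simp add: eval_nat_numeral)
  obtain K where K0: "0 \<le> K" and
    K: "\<And>x v. \<bar>u (x + v) - (\<Sum>j\<le>3. dir_deriv j u x v / fact j)\<bar> \<le> K * norm v powr (3 + s)"
    using holder_space_taylor[OF u s] by auto
  have "\<forall>i. \<exists>K\<ge>0. \<forall>x v. \<bar>?D1 i (x + v) - (\<Sum>j\<le>2. dir_deriv j (?D1 i) x v / fact j)\<bar> \<le> K * norm v powr (2 + s)"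
    using holder_space_taylor[OF u1 s] by simp
  from choice[OF this] obtain K1 where K1: "\<And>i. 0 \<le> K1 i"
    "\<And>i x v. \<bar>?D1 i (x + v) - (\<Sum>j\<le>2. dir_deriv j (?D1 i) x v / fact j)\<bar> \<le> K1 i * norm v powr (2 + s)"
    by blast
  let ?P = "\<lambda>i j K. 0 \<le> K \<and> (\<forall>x v. \<bar>?D2 i j (x + v) -
      (\<Sum>l\<le>1. dir_deriv l (?D2 i j) x v / fact l)\<bar> \<le> K * norm v powr (real 1 + s))"
  define K2 where "K2 i j = (SOME K. ?P i j K)" for i j
  have "?P i j (K2 i j)" for i j
    unfolding K2_def by (rule someI_ex, rule holder_space_taylor[OF u2 s])
  then have K2: "\<And>i j. 0 \<le> K2 i j"
    "\<And>i j x v. \<bar>?D2 i j (x + v) - (\<Sum>l\<le>1. dir_deriv l (?D2 i j) x v / fact l)\<bar> \<le> K2 i j * norm v powr (1 + s)"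
    by auto
  \<comment> \<open>These collect the Taylor constants of \<open>u\<close>, of its first and of its
    second partial derivatives. The factor \<open>2 powr (1 + s)\<close> pays for replacing
    \<open>norm (\<xi> + t *\<^sub>R v)\<close> by \<open>norm \<xi>\<close> along the
    segment.\<close>
  define A B C where "A = ?c * K" and "B = ?c * (\<Sum>i\<in>UNIV. K1 i)" and
    "C = ?c * (\<Sum>i\<in>UNIV. \<Sum>j\<in>UNIV. K2 i j) * 2 powr (1 + s)"
  have ABC: "0 \<le> A" "0 \<le> B" "0 \<le> C"
    by (simp_all add: A_def B_def C_def K0 K1 K2 sum_nonneg)
  have "holder_profile (A + B + C) (3 + s) 2
      (\<lambda>\<xi>. second_diff u x \<xi> - (\<Sum>i\<in>UNIV. ?c / 2 * ?D2 i i x * (\<xi> $ i)\<^sup>2))" for x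
  proof (rule holder_profileI[where \<psi>' =
        "\<lambda>\<xi> v. second_diff_grad u x \<xi> v - (\<Sum>i\<in>UNIV. ?c * ?D2 i i x * (\<xi> $ i * v $ i))"])
    fix \<xi> v :: "real^'d"
    show "linear (\<lambda>v. second_diff_grad u x \<xi> v - (\<Sum>i\<in>UNIV. ?c * ?D2 i i x * (\<xi> $ i * v $ i)))"
      by (intro linear_compose_sub linear_second_diff_grad)
        (rule linearI; simp add: sum_distrib_left algebra_simps sum.distrib)
    have D2: "(\<Sum>m\<in>?I. dir_deriv 2 u x (reflect m \<xi>)) = ?c * (\<Sum>i\<in>UNIV. ?D2 i i x * (\<xi> $ i)\<^sup>2)"
    proof -
      have "(\<Sum>m\<in>?I. dir_deriv 2 u x (reflect m \<xi>)) =
          (\<Sum>m\<in>?I. \<Sum>i\<in>UNIV. \<Sum>j\<in>UNIV. reflect m \<xi> $ i * reflect m \<xi> $ j * ?D2 i j x)"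
        by (simp add: numeral_2_eq_2 sum_distrib_left mult.assoc)
      also have "\<dots> = (\<Sum>i\<in>UNIV. \<Sum>m\<in>?I. \<Sum>j\<in>UNIV. reflect m \<xi> $ i * reflect m \<xi> $ j * ?D2 i j x)"
        by (rule sum.swap)
      also have "\<dots> = (\<Sum>i\<in>UNIV. \<Sum>j\<in>UNIV. \<Sum>m\<in>?I. reflect m \<xi> $ i * reflect m \<xi> $ j * ?D2 i j x)"
      proof -
        have "(\<Sum>m\<in>?I. \<Sum>j\<in>UNIV. reflect m \<xi> $ i * reflect m \<xi> $ j * ?D2 i j x) =
            (\<Sum>j\<in>UNIV. \<Sum>m\<in>?I. reflect m \<xi> $ i * reflect m \<xi> $ j * ?D2 i j x)" for i
          by (rule sum.swap)
        then show ?thesis by (simp only:)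
      qed
      also have "\<dots> = (\<Sum>i\<in>UNIV. \<Sum>j\<in>UNIV. (\<Sum>m\<in>?I. reflect m \<xi> $ i * reflect m \<xi> $ j) * ?D2 i j x)"
        by (simp only: sum_distrib_right)
      also have "\<dots> = (\<Sum>i\<in>UNIV. ?c * ((\<xi> $ i)\<^sup>2 * ?D2 i i x))"
        by (simp add: sum_reflect_nth_mult if_distrib[of "\<lambda>y. y * _"] power2_eq_square mult.assoc
            cong: if_cong)
      finally show ?thesis by (simp add: sum_distrib_left mult_ac)
    qed
    have "second_diff u x \<xi> - (\<Sum>i\<in>UNIV. ?c / 2 * ?D2 i i x * (\<xi> $ i)\<^sup>2) = second_diff u x \<xi> -
        (\<Sum>j\<in>{1..3}. (\<Sum>m\<in>?I. dir_deriv j u x (reflect m \<xi>)) / fact j)"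
    proof -
      have "{1..3::nat} = {1, 2, 3}" by auto
      then have "(\<Sum>j\<in>{1..3}. (\<Sum>m\<in>?I. dir_deriv j u x (reflect m \<xi>)) / fact j) =
          (\<Sum>m\<in>?I. dir_deriv 2 u x (reflect m \<xi>)) / 2"
        using sum_reflect_dir_deriv_odd[of 1 u x \<xi>] sum_reflect_dir_deriv_odd[of 3 u x \<xi>]
        by (simp del: dir_deriv.simps)
      then show ?thesis
        unfolding D2 by (simp add: sum_distrib_left sum_divide_distrib mult_ac)
    qed
    also have "\<bar>\<dots>\<bar> \<le> real (card ?I) * (K * norm \<xi> powr (3 + s))"
      unfolding second_diff_taylor
      by (rule abs_sum_le_card, rule K[where v = "reflect _ _", unfolded norm_reflect])
    finally show "\<bar>second_diff u x \<xi> - (\<Sum>i\<in>UNIV. ?c / 2 * ?D2 i i x * (\<xi> $ i)\<^sup>2)\<bar> \<le> A * norm \<xi> powr (3 + s)"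
      by (simp add: A_def card_multi_indices mult.assoc)
    \<comment> \<open>Taylor terms of even order cancel against the odd factor
      \<open>reflect m v $ i\<close>. What survives is the linear term, which is precisely the
      derivative of the quadratic form that was split off.\<close>
    have D1: "(\<Sum>m\<in>?I. reflect m v $ i * (\<Sum>j\<le>2. dir_deriv j (?D1 i) x (reflect m \<xi>) / fact j)) =
        ?c * ?D2 i i x * (\<xi> $ i * v $ i)" for i
    proof -
      have "(\<Sum>m\<in>?I. reflect m v $ i * (\<Sum>j\<le>2. dir_deriv j (?D1 i) x (reflect m \<xi>) / fact j)) =
          (\<Sum>m\<in>?I. reflect m v $ i * dir_deriv 0 (?D1 i) x (reflect m \<xi>)) +
          (\<Sum>m\<in>?I. reflect m v $ i * dir_deriv 1 (?D1 i) x (reflect m \<xi>)) +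
          (\<Sum>m\<in>?I. reflect m v $ i * dir_deriv 2 (?D1 i) x (reflect m \<xi>)) / 2"
        by (simp add: atMost_Suc numeral_2_eq_2 algebra_simps sum.distrib sum_divide_distrib del: dir_deriv.simps)
      also have "\<dots> = (\<Sum>m\<in>?I. reflect m v $ i * dir_deriv 1 (?D1 i) x (reflect m \<xi>))"
        by (simp add: sum_reflect_nth_dir_deriv_even del: dir_deriv.simps)
      also have "\<dots> = (\<Sum>m\<in>?I. \<Sum>j\<in>UNIV. reflect m v $ i * reflect m \<xi> $ j * ?D2 i j x)"
        by (simp add: sum_distrib_left mult.assoc)
      also have "\<dots> = (\<Sum>j\<in>UNIV. (\<Sum>m\<in>?I. reflect m v $ i * reflect m \<xi> $ j) * ?D2 i j x)"
        by (subst sum.swap) (simp add: sum_distrib_right)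
      also have "\<dots> = ?c * (v $ i * \<xi> $ i) * ?D2 i i x"
        by (simp add: sum_reflect_nth_mult if_distrib[of "\<lambda>y. y * _"] cong: if_cong)
      finally show ?thesis by (simp add: mult_ac)
    qed
    have "second_diff_grad u x \<xi> v - (\<Sum>i\<in>UNIV. ?c * ?D2 i i x * (\<xi> $ i * v $ i)) =
        (\<Sum>i\<in>UNIV. \<Sum>m\<in>?I. reflect m v $ i *
          (?D1 i (x + reflect m \<xi>) - (\<Sum>j\<le>2. dir_deriv j (?D1 i) x (reflect m \<xi>) / fact j)))"
      by (simp add: second_diff_grad_def right_diff_distrib sum_subtractf D1)
    also have "\<bar>\<dots>\<bar> \<le> (\<Sum>i\<in>UNIV. real (card ?I) * (norm v * (K1 i * norm \<xi> powr (2 + s))))"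
      by (rule order_trans[OF sum_abs], rule sum_mono, rule abs_sum_mult_le[OF reflect_component_le],
          rule K1(2)[where v = "reflect _ _", unfolded norm_reflect])
    also have "\<dots> = B * norm \<xi> powr (3 + s - 1) * norm v"
      by (simp add: B_def card_multi_indices sum_distrib_left sum_distrib_right mult_ac)
    finally show "\<bar>second_diff_grad u x \<xi> v - (\<Sum>i\<in>UNIV. ?c * ?D2 i i x * (\<xi> $ i * v $ i))\<bar> \<le> \<dots>" .
    assume v: "norm v \<le> norm \<xi>"
    define f where "f t = second_diff u x (\<xi> + t *\<^sub>R v) - (\<Sum>i\<in>UNIV. ?c / 2 * ?D2 i i x * ((\<xi> + t *\<^sub>R v) $ i)\<^sup>2)" for t
    define f' where "f' t = second_diff_grad u x (\<xi> + t *\<^sub>R v) v -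
        (\<Sum>i\<in>UNIV. ?c * ?D2 i i x * ((\<xi> + t *\<^sub>R v) $ i * v $ i))" for t
    define f'' where "f'' t = (\<Sum>i\<in>UNIV. \<Sum>m\<in>?I. reflect m v $ i *
        (\<Sum>j\<in>UNIV. reflect m v $ j * ?D2 i j (x + reflect m (\<xi> + t *\<^sub>R v)))) -
        (\<Sum>i\<in>UNIV. ?c * ?D2 i i x * (v $ i * v $ i))" for t
    have "\<bar>f 1 - f 0 - f' 0\<bar> \<le> C * norm v powr 2 * norm \<xi> powr (3 + s - 2)"
    proof (rule second_order_remainder)
      fix t :: real
      assume t: "0 \<le> t" "t \<le> 1"
      have line: "x + reflect m (\<xi> + t *\<^sub>R v) = (x + reflect m \<xi>) + t *\<^sub>R reflect m v" for m t
        by (simp add: reflect_add reflect_scaleR)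
      have "((\<lambda>t. u (x + reflect m (\<xi> + t *\<^sub>R v))) has_real_derivative
          (\<Sum>i\<in>UNIV. reflect m v $ i * ?D1 i (x + reflect m (\<xi> + t *\<^sub>R v)))) (at t)" for m
        unfolding line using u by (intro has_real_derivative_along_line[of _ 2 s]) (simp add: eval_nat_numeral)
      then have "((\<lambda>t. second_diff u x (\<xi> + t *\<^sub>R v)) has_real_derivative
          second_diff_grad u x (\<xi> + t *\<^sub>R v) v) (at t)"
        unfolding second_diff_def second_diff_grad_def
        using DERIV_diff[OF DERIV_sum[of ?I] DERIV_const[of "2 ^ CARD('d) * u x"]]
        by (subst sum.swap) simp
      moreover have "((\<lambda>t. ?c / 2 * ?D2 i i x * ((\<xi> + t *\<^sub>R v) $ i)\<^sup>2) has_real_derivative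
          ?c * ?D2 i i x * ((\<xi> + t *\<^sub>R v) $ i * v $ i)) (at t)" for i
        unfolding vector_add_component vector_scaleR_component
        by (auto intro!: derivative_eq_intros)
      ultimately show "(f has_real_derivative f' t) (at t)"
        unfolding f_def f'_def by (rule DERIV_diff[OF _ DERIV_sum])
      have "((\<lambda>t. ?D1 i (x + reflect m (\<xi> + t *\<^sub>R v))) has_real_derivative
          (\<Sum>j\<in>UNIV. reflect m v $ j * ?D2 i j (x + reflect m (\<xi> + t *\<^sub>R v)))) (at t)" for m i
        unfolding line using u1 by (intro has_real_derivative_along_line[of _ 1 s]) (simp add: eval_nat_numeral)
      then have "((\<lambda>t. second_diff_grad u x (\<xi> + t *\<^sub>R v) v) has_real_derivative
          (\<Sum>i\<in>UNIV. \<Sum>m\<in>?I. reflect m v $ i *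
            (\<Sum>j\<in>UNIV. reflect m v $ j * ?D2 i j (x + reflect m (\<xi> + t *\<^sub>R v))))) (at t)"
        unfolding second_diff_grad_def by (intro DERIV_sum DERIV_cmult)
      moreover have "((\<lambda>t. ?c * ?D2 i i x * ((\<xi> + t *\<^sub>R v) $ i * v $ i)) has_real_derivative
          ?c * ?D2 i i x * (v $ i * v $ i)) (at t)" for i
        unfolding vector_add_component vector_scaleR_component
        by (auto intro!: derivative_eq_intros)
      ultimately show "(f' has_real_derivative f'' t) (at t)"
        unfolding f''_def f'_def by (rule DERIV_diff[OF _ DERIV_sum])
      \<comment> \<open>The Hessian of the quadratic form equals the contribution of the first-order
        Taylor polynomials of the second derivatives, whose linear terms cancel by parity. So
        \<open>f''\<close> is a sum of Taylor remainders and inherits their smallness near the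
        origin.\<close>
      have D0: "(\<Sum>i\<in>UNIV. \<Sum>j\<in>UNIV. \<Sum>m\<in>?I. reflect m v $ i * reflect m v $ j *
          (\<Sum>l\<le>1. dir_deriv l (?D2 i j) x (reflect m w) / fact l)) =
          (\<Sum>i\<in>UNIV. ?c * ?D2 i i x * (v $ i * v $ i))" for w
      proof -
        have "(\<Sum>m\<in>?I. reflect m v $ i * reflect m v $ j *
            (\<Sum>l\<le>1. dir_deriv l (?D2 i j) x (reflect m w) / fact l)) =
            (\<Sum>m\<in>?I. reflect m v $ i * reflect m v $ j) * ?D2 i j x +
            (\<Sum>m\<in>?I. reflect m v $ i * reflect m v $ j * dir_deriv 1 (?D2 i j) x (reflect m w))" for i j
          by (simp add: distrib_left sum.distrib sum_distrib_right del: dir_deriv.simps(2))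
        then have "(\<Sum>m\<in>?I. reflect m v $ i * reflect m v $ j *
            (\<Sum>l\<le>1. dir_deriv l (?D2 i j) x (reflect m w) / fact l)) =
            (if i = j then ?c * (v $ i * v $ i) else 0) * ?D2 i j x" for i j
          by (simp only: sum_reflect_nth_nth_dir_deriv_odd[OF odd_one] sum_reflect_nth_mult add_0_right)
        then show ?thesis
          by (simp only: if_distrib[of "\<lambda>y. y * _"]) (simp add: mult_ac cong: if_cong)
      qed
      have "f'' t = (\<Sum>i\<in>UNIV. \<Sum>j\<in>UNIV. \<Sum>m\<in>?I. reflect m v $ i * reflect m v $ j *
          ?D2 i j (x + reflect m (\<xi> + t *\<^sub>R v))) - (\<Sum>i\<in>UNIV. ?c * ?D2 i i x * (v $ i * v $ i))"
        unfolding f''_def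
        by (subst (2) sum.swap) (simp add: sum_distrib_left mult.assoc)
      also have "\<dots> = (\<Sum>i\<in>UNIV. \<Sum>j\<in>UNIV. \<Sum>m\<in>?I. reflect m v $ i * reflect m v $ j *
          (?D2 i j (x + reflect m (\<xi> + t *\<^sub>R v)) -
            (\<Sum>l\<le>1. dir_deriv l (?D2 i j) x (reflect m (\<xi> + t *\<^sub>R v)) / fact l)))" (is "_ = ?Z")
        by (simp only: right_diff_distrib sum_subtractf D0)
      finally have f''_eq: "f'' t = ?Z" .
      have "\<bar>f'' t\<bar> \<le> (\<Sum>i\<in>UNIV. \<Sum>j\<in>UNIV. real (card ?I) *
          (norm v * norm v * (K2 i j * norm (\<xi> + t *\<^sub>R v) powr (1 + s))))"
      proof -
        have "\<bar>reflect m v $ i * reflect m v $ j\<bar> \<le> norm v * norm v" for m i j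
          unfolding abs_mult by (intro mult_mono reflect_component_le) auto
        moreover have "\<bar>?D2 i j (x + reflect m (\<xi> + t *\<^sub>R v)) -
            (\<Sum>l\<le>1. dir_deriv l (?D2 i j) x (reflect m (\<xi> + t *\<^sub>R v)) / fact l)\<bar>
            \<le> K2 i j * norm (\<xi> + t *\<^sub>R v) powr (1 + s)" for i j m
          using K2(2)[of j i x "reflect m (\<xi> + t *\<^sub>R v)"] by (simp only: norm_reflect)
        ultimately have le: "\<bar>\<Sum>m\<in>?I. reflect m v $ i * reflect m v $ j * (?D2 i j (x + reflect m (\<xi> + t *\<^sub>R v)) -
              (\<Sum>l\<le>1. dir_deriv l (?D2 i j) x (reflect m (\<xi> + t *\<^sub>R v)) / fact l))\<bar>
            \<le> real (card ?I) * (norm v * norm v * (K2 i j * norm (\<xi> + t *\<^sub>R v) powr (1 + s)))" for i j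
          by (rule abs_sum_mult_le)
        show ?thesis
          unfolding f''_eq
          by (rule order_trans[OF sum_abs], rule sum_mono, rule order_trans[OF sum_abs], rule sum_mono, rule le)
      qed
      also have "\<dots> \<le> (\<Sum>i\<in>UNIV. \<Sum>j\<in>UNIV. real (card ?I) *
          (norm v * norm v * (K2 i j * (2 * norm \<xi>) powr (1 + s))))"
      proof (intro sum_mono mult_left_mono powr_mono2)
        have "norm (t *\<^sub>R v) \<le> norm v" using t by (simp add: mult_left_le_one_le)
        then show "norm (\<xi> + t *\<^sub>R v) \<le> 2 * norm \<xi>"
          using v norm_triangle_ineq[of \<xi> "t *\<^sub>R v"] by linarith
      qed (use K2 s in auto)
      also have "\<dots> = C * norm v powr 2 * norm \<xi> powr (3 + s - 2)"
        by (simp add: C_def card_multi_indices powr_mult sum_distrib_left sum_distrib_right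
            power2_eq_square mult_ac)
      finally show "\<bar>f'' t\<bar> \<le> C * norm v powr 2 * norm \<xi> powr (3 + s - 2)" .
    qed
    then show "\<bar>second_diff u x (\<xi> + v) - (\<Sum>i\<in>UNIV. ?c / 2 * ?D2 i i x * ((\<xi> + v) $ i)\<^sup>2) -
        (second_diff u x \<xi> - (\<Sum>i\<in>UNIV. ?c / 2 * ?D2 i i x * (\<xi> $ i)\<^sup>2)) -
        (second_diff_grad u x \<xi> v - (\<Sum>i\<in>UNIV. ?c * ?D2 i i x * (\<xi> $ i * v $ i)))\<bar>
        \<le> C * norm v powr 2 * norm \<xi> powr (3 + s - 2)"
      by (simp add: f_def f'_def)
  qed (use ABC in auto)
  then show ?thesis
    using ABC by (intro exI[of _ "A + B + C"]) auto
qed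

subsection \<open>Coordinatewise integration\<close>

lemma AE_cart_neq: "AE \<xi> :: real^'d::finite in lborel. \<forall>i. \<xi> $ i \<noteq> c i"
proof -
  have "AE \<xi> :: real^'d in lborel. \<xi> $ i \<noteq> c i" for i
    using AE_lborel_inner_neq[of "axis i 1 :: real^'d" "c i"] by (simp add: inner_axis)
  then show ?thesis by (simp add: AE_all_countable)
qed

lemma prod_Basis_cart: "(\<Prod>b\<in>(Basis :: (real^'d::finite) set). f b) = (\<Prod>i\<in>UNIV. f (axis i 1))"
proof -
  have "Basis = range (\<lambda>i. axis i (1::real) :: real^'d)"
    by (auto simp: Basis_vec_def)
  moreover have "inj (\<lambda>i. axis i (1::real) :: real^'d)"
    by (auto simp: inj_def axis_eq_axis)
  then have "prod f (range (\<lambda>i. axis i (1::real) :: real^'d)) = (\<Prod>i\<in>UNIV. f (axis i 1))"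
    by (subst prod.reindex) simp_all
  ultimately show ?thesis by (simp only:)
qed

lemma nn_integral_prod_cart:
  fixes g :: "real \<Rightarrow> ennreal"
  assumes "g \<in> borel_measurable borel"
  shows "(\<integral>\<^sup>+\<xi>. (\<Prod>i\<in>UNIV. g (\<xi> $ i)) \<partial>(lborel :: (real^'d::finite) measure)) =
           (\<integral>\<^sup>+t. g t \<partial>lborel) ^ CARD('d)"
  using nn_integral_lborel_prod[of "\<lambda>(b :: real^'d) t. g t"] assms
  by (simp add: prod_Basis_cart inner_axis)

lemma emeasure_lborel_box_cart:
  fixes l u :: "real^'d::finite"
  assumes "\<And>i. l $ i \<le> u $ i"
  shows "emeasure lborel (box l u) = ennreal (\<Prod>i\<in>UNIV. u $ i - l $ i)"
proof -
  have "\<forall>b\<in>Basis. l \<bullet> b \<le> u \<bullet> b"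
    using assms by (auto simp: Basis_vec_def inner_axis)
  then show ?thesis
    by (simp add: emeasure_lborel_box_eq prod_Basis_cart inner_axis)
qed

text \<open>Covers both symmetries in use: reflections are the case \<open>\<pi> = id\<close>,
  coordinate permutations the case of no sign change.\<close>

definition signed_perm :: "('d \<Rightarrow> bool) \<Rightarrow> ('d \<Rightarrow> 'd) \<Rightarrow> real^'d \<Rightarrow> real^'d" where
  "signed_perm \<sigma> \<pi> \<xi> = (\<chi> i. if \<sigma> i then - \<xi> $ \<pi> i else \<xi> $ \<pi> i)"

lemma signed_perm_measurable [measurable]:
  "(signed_perm \<sigma> \<pi> :: real^'d::finite \<Rightarrow> _) \<in> borel_measurable borel"
proof -
  have "linear (signed_perm \<sigma> \<pi> :: real^'d \<Rightarrow> _)"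
    by (rule linearI) (auto simp: signed_perm_def vec_eq_iff)
  then show ?thesis
    by (intro borel_measurable_continuous_onI linear_continuous_on) (simp add: linear_conv_bounded_linear)
qed

text \<open>Lebesgue measure is determined by its values on boxes. The preimage of a box is again a
  box: its edges are permuted, and where the sign changes the end points are negated and exchanged,
  so the product of the edge lengths is the same.\<close>

lemma lborel_distr_signed_perm:
  assumes "bij \<pi>"
  shows "distr lborel borel (signed_perm \<sigma> \<pi>) = (lborel :: (real^'d::finite) measure)"
proof (rule lborel_eqI[symmetric])
  fix l u :: "real^'d"
  assume "\<And>b. b \<in> Basis \<Longrightarrow> l \<bullet> b \<le> u \<bullet> b"
  from this[of "axis _ 1"] have le: "l $ i \<le> u $ i" for i
    by (simp add: inner_axis)
  define l' u' where
    "l' = (\<chi> j. if \<sigma> (inv \<pi> j) then - u $ inv \<pi> j else l $ inv \<pi> j)" and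
    "u' = (\<chi> j. if \<sigma> (inv \<pi> j) then - l $ inv \<pi> j else u $ inv \<pi> j)"
  have "(signed_perm \<sigma> \<pi> \<xi> \<in> box l u) \<longleftrightarrow> \<xi> \<in> box l' u'" for \<xi>
  proof -
    have "(\<xi> \<in> box l' u') \<longleftrightarrow> (\<forall>i. l' $ \<pi> i < \<xi> $ \<pi> i \<and> \<xi> $ \<pi> i < u' $ \<pi> i)"
      using bij_is_surj[OF assms] unfolding mem_box_cart surj_def by metis
    also have "\<dots> \<longleftrightarrow> signed_perm \<sigma> \<pi> \<xi> \<in> box l u"
      using bij_is_inj[OF assms]
      by (auto simp: mem_box_cart l'_def u'_def signed_perm_def)
    finally show ?thesis by simp
  qed
  then have "signed_perm \<sigma> \<pi> -` box l u = box l' u'" by auto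
  then have "emeasure (distr lborel borel (signed_perm \<sigma> \<pi>)) (box l u) = emeasure lborel (box l' u')"
    by (simp add: emeasure_distr)
  also have "\<dots> = ennreal (\<Prod>i\<in>UNIV. u' $ i - l' $ i)"
    by (rule emeasure_lborel_box_cart) (auto simp: l'_def u'_def le)
  also have "(\<Prod>i\<in>UNIV. u' $ i - l' $ i) = (\<Prod>i\<in>UNIV. u $ inv \<pi> i - l $ inv \<pi> i)"
    by (rule prod.cong) (auto simp: l'_def u'_def)
  also have "\<dots> = (\<Prod>i\<in>UNIV. u $ i - l $ i)"
    using assms by (intro prod.reindex_bij_betw[of "inv \<pi>"]) (simp add: bij_imp_bij_inv)
  finally show "emeasure (distr lborel borel (signed_perm \<sigma> \<pi>)) (box l u) =
      ennreal (\<Prod>b\<in>Basis. (u - l) \<bullet> b)"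
    by (simp add: prod_Basis_cart inner_axis)
qed simp

lemma integrable_signed_perm_iff:
  fixes f :: "real^'d::finite \<Rightarrow> real"
  assumes "bij \<pi>" "f \<in> borel_measurable borel"
  shows "integrable lborel (\<lambda>\<xi>. f (signed_perm \<sigma> \<pi> \<xi>)) \<longleftrightarrow> integrable lborel f"
  using integrable_distr_eq[of "signed_perm \<sigma> \<pi>" lborel borel f] assms
  by (simp add: lborel_distr_signed_perm)

lemma integral_signed_perm:
  fixes f :: "real^'d::finite \<Rightarrow> real"
  assumes "bij \<pi>" "f \<in> borel_measurable borel"
  shows "(LINT \<xi>|lborel. f (signed_perm \<sigma> \<pi> \<xi>)) = (LINT \<xi>|lborel. f \<xi>)"
  using integral_distr[of "signed_perm \<sigma> \<pi>" lborel borel f] assms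
  by (simp add: lborel_distr_signed_perm)

subsection \<open>Powers of the norm\<close>

lemma set_integrable_nn_bound:
  fixes f :: "real^'d::finite \<Rightarrow> real"
  assumes [measurable]: "f \<in> borel_measurable borel" "S \<in> sets borel" and f: "\<And>\<xi>. 0 \<le> f \<xi>"
    and le: "(\<integral>\<^sup>+\<xi>. ennreal (f \<xi>) * indicator S \<xi> \<partial>lborel) \<le> ennreal c" and "0 \<le> c"
  shows "set_integrable lborel S f" "(LINT \<xi>:S|lborel. f \<xi>) \<le> c"
proof -
  have eq: "ennreal (indicator S \<xi> * f \<xi>) = ennreal (f \<xi>) * indicator S \<xi>" for \<xi>
    by (simp add: indicator_def)
  have "(\<integral>\<^sup>+\<xi>. ennreal (norm (indicator S \<xi> * f \<xi>)) \<partial>lborel) < \<infinity>"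
    using le f by (simp add: eq abs_mult order_le_less_trans[OF le])
  then show int: "set_integrable lborel S f"
    unfolding set_integrable_def by (intro integrableI_bounded) simp_all
  have "ennreal (LINT \<xi>:S|lborel. f \<xi>) = (\<integral>\<^sup>+\<xi>. ennreal (indicator S \<xi> * f \<xi>) \<partial>lborel)"
    using int f unfolding set_integrable_def set_lebesgue_integral_def
    by (subst nn_integral_eq_integral) auto
  with le have "ennreal (LINT \<xi>:S|lborel. f \<xi>) \<le> ennreal c" by (simp add: eq)
  then show "(LINT \<xi>:S|lborel. f \<xi>) \<le> c"
    using \<open>0 \<le> c\<close> by (simp add: ennreal_le_iff)
qed

lemma norm_powr_eq_prod:
  fixes \<xi> :: "real^'d::finite"
  assumes "\<xi> \<noteq> 0"
  shows "norm \<xi> powr (real CARD('d) * e) = (\<Prod>i\<in>(UNIV::'d set). norm \<xi> powr e)"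
  using assms by (simp add: powr_powr[symmetric] powr_realpow mult.commute)

lemma ennreal_prod_powr: "(\<Prod>i\<in>A. ennreal (f i powr e)) = ennreal (\<Prod>i\<in>A. f i powr e)"
  by (simp add: prod_ennreal)

text \<open>The maximum of the coordinates dominates their geometric mean, which turns a negative power of
  the norm into a product of one-dimensional functions.\<close>

lemma norm_powr_near_zero:
  fixes s :: real
  assumes "0 < s"
  shows "\<exists>C\<ge>0. \<forall>L>0. set_integrable lborel (cbox 0 (\<chi> i. L)) (\<lambda>\<xi> :: real^'d::finite. norm \<xi> powr (s - real CARD('d)))
     \<and> (LINT \<xi> : cbox 0 (\<chi> i. L) | lborel. norm (\<xi> :: real^'d) powr (s - real CARD('d))) \<le> C * L powr s"
proof -
  define d where "d = real CARD('d)"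
  have d: "1 \<le> d" using zero_less_card_finite[where 'a='d] unfolding d_def by linarith
  \<comment> \<open>The comparison with coordinates needs an exponent \<open>e \<le> 0\<close>, that
    is at most \<open>d\<close> in place of \<open>s\<close>. The surplus
    \<open>norm \<xi> powr (s - s')\<close> is simply bounded on the cube by its value at
    \<open>d * L\<close>.\<close>
  define s' where "s' = min s d"
  define e where "e = s' / d - 1"
  have s': "0 < s'" "s' \<le> s" and e: "-1 < e" "e \<le> 0" and de: "d * e = s' - d"
    using assms d by (auto simp: s'_def e_def field_simps)
  define C where "C = d powr (s - s') * (1 / (e + 1)) ^ CARD('d)"
  have "set_integrable lborel (cbox 0 (\<chi> i. L)) (\<lambda>\<xi> :: real^'d. norm \<xi> powr (s - d)) \<and>
     (LINT \<xi> : cbox 0 (\<chi> i. L) | lborel. norm (\<xi> :: real^'d) powr (s - d)) \<le> C * L powr s" if L: "0 < L" for L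
  proof -
    define g where "g t = ennreal (t powr e) * indicator {0..L} t" for t :: real
    have [measurable]: "g \<in> borel_measurable borel" unfolding g_def by measurable
    have int_g: "(\<integral>\<^sup>+t. g t \<partial>lborel) = ennreal (L powr (e + 1) / (e + 1))"
      unfolding g_def
      by (rule nn_integral_has_integral_lebesgue'[OF _ has_integral_powr_from_0]) (use e L in auto)
    \<comment> \<open>On the coordinate hyperplanes the product on the right is zero, because
      \<open>0 powr e = 0\<close>, and the bound can fail; they form a null set.\<close>
    have le: "ennreal (norm \<xi> powr (s - d)) * indicator (cbox 0 (\<chi> i. L)) \<xi> \<le>
        ennreal ((d * L) powr (s - s')) * (\<Prod>i\<in>UNIV. g (\<xi> $ i))" if \<xi>: "\<And>i. \<xi> $ i \<noteq> 0" for \<xi> :: "real^'d"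
    proof (cases "\<xi> \<in> cbox 0 (\<chi> i. L)")
      case True
      then have \<xi>i: "0 < \<xi> $ i" "\<xi> $ i \<le> L" for i
        using \<xi>[of i] by (auto simp: mem_box_cart less_le)
      then have "\<xi> \<noteq> 0" by (metis less_irrefl zero_index)
      have "norm \<xi> \<le> (\<Sum>i\<in>UNIV. \<bar>\<xi> $ i\<bar>)" by (rule norm_le_l1_cart)
      also have "\<dots> \<le> (\<Sum>i\<in>(UNIV::'d set). L)"
        using \<xi>i by (intro sum_mono) (auto simp: less_imp_le)
      finally have "norm \<xi> \<le> d * L" by (simp add: d_def)
      then have 1: "norm \<xi> powr (s - s') \<le> (d * L) powr (s - s')"
        using s' by (intro powr_mono2) auto
      have "norm \<xi> powr (d * e) \<le> (\<Prod>i\<in>UNIV. \<xi> $ i powr e)"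
        unfolding d_def norm_powr_eq_prod[OF \<open>\<xi> \<noteq> 0\<close>]
      proof (intro prod_mono conjI powr_mono2' e \<xi>i)
        show "\<xi> $ i \<le> norm \<xi>" for i
          using component_le_norm_cart[of \<xi> i] by linarith
      qed auto
      then have "norm \<xi> powr (s - s') * norm \<xi> powr (d * e) \<le> (d * L) powr (s - s') * (\<Prod>i\<in>UNIV. \<xi> $ i powr e)"
        using 1 by (intro mult_mono) auto
      then have "norm \<xi> powr (s - d) \<le> (d * L) powr (s - s') * (\<Prod>i\<in>UNIV. \<xi> $ i powr e)"
        by (simp add: powr_add[symmetric] de)
      moreover have "(\<Prod>i\<in>UNIV. g (\<xi> $ i)) = ennreal (\<Prod>i\<in>UNIV. \<xi> $ i powr e)"
        unfolding ennreal_prod_powr[symmetric]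
        using \<xi>i by (intro prod.cong) (auto simp: g_def less_imp_le)
      ultimately show ?thesis
        using True by (simp add: ennreal_mult[symmetric] prod_nonneg ennreal_leI)
    qed simp
    have "(\<integral>\<^sup>+\<xi>. ennreal (norm \<xi> powr (s - d)) * indicator (cbox 0 (\<chi> i. L)) \<xi> \<partial>(lborel :: (real^'d) measure)) \<le>
        (\<integral>\<^sup>+\<xi>. ennreal ((d * L) powr (s - s')) * (\<Prod>i\<in>UNIV. g (\<xi> $ i)) \<partial>(lborel :: (real^'d) measure))"
      by (rule nn_integral_mono_AE, rule AE_mp[OF AE_cart_neq[of "\<lambda>_. 0"] AE_I2]) (use le in blast)
    also have "\<dots> = ennreal ((d * L) powr (s - s')) * ennreal (L powr (e + 1) / (e + 1)) ^ CARD('d)"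
      by (subst nn_integral_cmult) (simp_all add: nn_integral_prod_cart int_g)
    also have "\<dots> = ennreal ((d * L) powr (s - s') * (L powr (e + 1) / (e + 1)) ^ CARD('d))"
      using e by (simp add: ennreal_power ennreal_mult)
    also have "(L powr (e + 1)) ^ CARD('d) = L powr s'"
      using L d de by (simp add: powr_realpow[symmetric] powr_powr d_def algebra_simps)
    then have "(d * L) powr (s - s') * (L powr (e + 1) / (e + 1)) ^ CARD('d) = C * (L powr (s - s') * L powr s')"
      using d L by (simp add: C_def powr_mult power_divide)
    also have "L powr (s - s') * L powr s' = L powr s" by (simp add: powr_add[symmetric])
    finally have *: "(\<integral>\<^sup>+\<xi>. ennreal (norm \<xi> powr (s - d)) * indicator (cbox 0 (\<chi> i. L)) \<xi> \<partial>(lborel :: (real^'d) measure))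
      \<le> ennreal (C * L powr s)" .
    have "0 \<le> C * L powr s" using e by (simp add: C_def)
    with * show ?thesis
      using set_integrable_nn_bound[of "\<lambda>\<xi> :: real^'d. norm \<xi> powr (s - d)" "cbox 0 (\<chi> i. L)" "C * L powr s"]
      by simp
  qed
  moreover have "0 \<le> C" using e by (simp add: C_def)
  ultimately show ?thesis
    unfolding d_def[symmetric] by (intro exI[of _ C] conjI allI impI) simp_all
qed

text \<open>Again the power of the norm is a product of \<open>d\<close> equal factors
  \<open>norm \<xi> powr e\<close>. Where \<open>norm \<xi> \<ge> r\<close>, each factor is at most
  \<open>r powr e\<close> if its coordinate lies in the interval from -r to r, and at most the power
  \<open>e\<close> of the modulus of the coordinate otherwise. Since \<open>e < -1\<close>, this
  majorant \<open>g\<close> is integrable on the line.\<close>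

lemma norm_powr_near_infinity:
  fixes s :: real
  assumes "0 < s"
  shows "\<exists>C\<ge>0. \<forall>r>0. set_integrable lborel {\<xi>. r \<le> norm \<xi>} (\<lambda>\<xi> :: real^'d::finite. norm \<xi> powr (- s - real CARD('d)))
     \<and> (LINT \<xi> : {\<xi>. r \<le> norm \<xi>} | lborel. norm (\<xi> :: real^'d) powr (- s - real CARD('d))) \<le> C * r powr (- s)"
proof -
  define d where "d = real CARD('d)"
  have d: "1 \<le> d" using zero_less_card_finite[where 'a='d] unfolding d_def by linarith
  define e where "e = - s / d - 1"
  have e: "e < -1" and de: "d * e = - s - d"
    using assms d by (auto simp: e_def field_simps)
  define C where "C = (2 + 2 / (- e - 1)) ^ CARD('d)"
  have "set_integrable lborel {\<xi>. r \<le> norm \<xi>} (\<lambda>\<xi> :: real^'d. norm \<xi> powr (- s - d)) \<and>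
     (LINT \<xi> : {\<xi>. r \<le> norm \<xi>} | lborel. norm (\<xi> :: real^'d) powr (- s - d)) \<le> C * r powr (- s)" if r: "0 < r" for r
  proof -
    define k where "k t = ennreal (t powr e) * indicator {r..} t" for t :: real
    define g where "g t = ennreal (r powr e) * indicator {-r..r} t + (k t + k (- t))" for t :: real
    have [measurable]: "k \<in> borel_measurable borel" unfolding k_def by measurable
    then have [measurable]: "g \<in> borel_measurable borel" unfolding g_def by measurable
    have int_k: "(\<integral>\<^sup>+t. k t \<partial>lborel) = ennreal (r powr (e + 1) / (- e - 1))"
    proof -
      have "(\<integral>\<^sup>+t. k t \<partial>lborel) = ennreal (- (r powr (e + 1)) / (e + 1))"
        unfolding k_def
        by (rule nn_integral_has_integral_lebesgue'[OF _ has_integral_powr_to_inf]) (use e r in auto)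
      also have "- (r powr (e + 1)) / (e + 1) = r powr (e + 1) / (- e - 1)"
        using e by (simp add: field_simps)
      finally show ?thesis .
    qed
    have "(\<integral>\<^sup>+t. k (- t) \<partial>lborel) = (\<integral>\<^sup>+t. k t \<partial>lborel)"
      using nn_integral_real_affine[of k "- 1" 0] by simp
    moreover have "(\<integral>\<^sup>+t. ennreal (r powr e) * indicator {-r..r} t \<partial>lborel) = ennreal (2 * r powr (e + 1))"
    proof -
      have "r powr (e + 1) = r powr e * r" using r by (simp add: powr_add)
      then show ?thesis
        using r by (simp add: nn_integral_cmult_indicator ennreal_mult[symmetric] mult_ac)
    qed
    ultimately have "(\<integral>\<^sup>+t. g t \<partial>lborel) = ennreal (2 * r powr (e + 1)) +
        (ennreal (r powr (e + 1) / (- e - 1)) + ennreal (r powr (e + 1) / (- e - 1)))"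
      unfolding g_def by (subst nn_integral_add; (subst nn_integral_add)?) (simp_all add: int_k)
    also have "\<dots> = ennreal ((2 + 2 / (- e - 1)) * r powr (e + 1))"
      using e by (simp add: ennreal_plus[symmetric] distrib_right add_divide_distrib del: ennreal_plus)
    finally have int_g: "(\<integral>\<^sup>+t. g t \<partial>lborel) = ennreal ((2 + 2 / (- e - 1)) * r powr (e + 1))" .
    have le: "ennreal (norm \<xi> powr (- s - d)) * indicator {\<xi>. r \<le> norm \<xi>} \<xi> \<le>
        (\<Prod>i\<in>UNIV. g (\<xi> $ i))" for \<xi> :: "real^'d"
    proof (cases "r \<le> norm \<xi>")
      case True
      then have "\<xi> \<noteq> 0" using r by auto
      have g: "ennreal (norm \<xi> powr e) \<le> g (\<xi> $ i)" for i
      proof -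
        have n: "\<bar>\<xi> $ i\<bar> \<le> norm \<xi>" by (rule component_le_norm_cart)
        have a: "\<bar>t\<bar> \<le> r \<Longrightarrow> ennreal (r powr e) \<le> g t" for t
          unfolding g_def by (rule add_increasing2) (auto simp: indicator_def abs_le_iff)
        have "r \<le> t \<Longrightarrow> ennreal (t powr e) \<le> k t" for t
          by (simp add: k_def)
        then have b: "r \<le> t \<Longrightarrow> ennreal (t powr e) \<le> g t" "r \<le> t \<Longrightarrow> ennreal (t powr e) \<le> g (- t)" for t
          unfolding g_def minus_minus by (meson add_increasing add_increasing2 zero_le)+
        consider "\<bar>\<xi> $ i\<bar> \<le> r" | "r \<le> \<xi> $ i" | "r \<le> - \<xi> $ i" by linarith
        then show ?thesis
        proof cases
          case 1
          have "norm \<xi> powr e \<le> r powr e" using True e r by (intro powr_mono2') auto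
          then show ?thesis using a[OF 1] by (meson ennreal_leI order_trans)
        next
          case 2
          then have "norm \<xi> powr e \<le> (\<xi> $ i) powr e" using n e r by (intro powr_mono2') auto
          then show ?thesis using b(1)[OF 2] by (meson ennreal_leI order_trans)
        next
          case 3
          then have "norm \<xi> powr e \<le> (- \<xi> $ i) powr e" using n e r by (intro powr_mono2') auto
          then show ?thesis using b(2)[OF 3] by (metis ennreal_leI order_trans minus_minus)
        qed
      qed
      have "ennreal (norm \<xi> powr (- s - d)) = (\<Prod>i\<in>(UNIV::'d set). ennreal (norm \<xi> powr e))"
        using norm_powr_eq_prod[OF \<open>\<xi> \<noteq> 0\<close>, of e] unfolding ennreal_prod_powr d_def[symmetric] de by simp
      also have "\<dots> \<le> (\<Prod>i\<in>UNIV. g (\<xi> $ i))"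
        by (rule prod_mono_ennreal) (rule g)
      finally show ?thesis using True by simp
    qed simp
    have "(\<integral>\<^sup>+\<xi>. ennreal (norm \<xi> powr (- s - d)) * indicator {\<xi>. r \<le> norm \<xi>} \<xi> \<partial>(lborel :: (real^'d) measure)) \<le>
        (\<integral>\<^sup>+\<xi>. (\<Prod>i\<in>UNIV. g (\<xi> $ i)) \<partial>(lborel :: (real^'d) measure))"
      by (intro nn_integral_mono le)
    also have "\<dots> = ennreal ((2 + 2 / (- e - 1)) * r powr (e + 1)) ^ CARD('d)"
      by (simp add: nn_integral_prod_cart int_g)
    also have "\<dots> = ennreal (((2 + 2 / (- e - 1)) * r powr (e + 1)) ^ CARD('d))"
      using e by (intro ennreal_power) simp
    also have "(r powr (e + 1)) ^ CARD('d) = r powr (- s)"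
      using r d de by (simp add: powr_realpow[symmetric] powr_powr d_def algebra_simps)
    then have "((2 + 2 / (- e - 1)) * r powr (e + 1)) ^ CARD('d) = C * r powr (- s)"
      by (simp only: C_def power_mult_distrib)
    finally have *: "(\<integral>\<^sup>+\<xi>. ennreal (norm \<xi> powr (- s - d)) * indicator {\<xi>. r \<le> norm \<xi>} \<xi> \<partial>(lborel :: (real^'d) measure))
      \<le> ennreal (C * r powr (- s))" .
    have "0 \<le> C * r powr (- s)" using e by (simp add: C_def)
    with * show ?thesis
      using set_integrable_nn_bound[of "\<lambda>\<xi> :: real^'d. norm \<xi> powr (- s - d)" "{\<xi>. r \<le> norm \<xi>}" "C * r powr (- s)"]
      by simp
  qed
  moreover have "0 \<le> C" using e by (simp add: C_def)
  ultimately show ?thesis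
    unfolding d_def[symmetric] by (intro exI[of _ C] conjI allI impI) simp_all
qed

subsection \<open>Local expansions away from the origin\<close>

text \<open>Comparability is assumed in both directions so that one constant serves positive and
  negative exponents.\<close>

lemma powr_comparable:
  fixes a r D :: real
  assumes "1 \<le> D" "0 < a" "a \<le> D * r" "r \<le> D * a"
  shows "r powr q \<le> D powr \<bar>q\<bar> * a powr q"
proof (cases "0 \<le> q")
  case True
  have "0 < D * r" using assms by linarith
  then have "0 \<le> r" using assms(1) by (simp add: zero_less_mult_iff)
  then have "r powr q \<le> (D * a) powr q" using True assms by (intro powr_mono2) auto
  with True assms show ?thesis by (simp add: powr_mult)
next
  case False
  have "r powr q \<le> (a / D) powr q"
    using False assms by (intro powr_mono2') (auto simp: field_simps)
  with False assms show ?thesis by (simp add: powr_divide powr_minus field_simps)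
qed

text \<open>The derivative is bounded independently of \<open>lam\<close>: differentiating the
  exponential produces \<open>lam * t * exp (- (lam * t))\<close>, which is at most 1, times the
  same power \<open>t powr (\<beta> - 1)\<close> as the other term. This accounts for the summand 1
  in the constant.\<close>

lemma exp_powr_lipschitz:
  fixes a r r' D lam \<beta> :: real
  assumes "0 \<le> lam" "1 \<le> D" "0 < a"
    and r: "a \<le> D * r" "r \<le> D * a" and r': "a \<le> D * r'" "r' \<le> D * a"
  shows "\<bar>exp (- lam * r) * r powr \<beta> - exp (- lam * r') * r' powr \<beta>\<bar>
    \<le> (\<bar>\<beta>\<bar> + 1) * D powr \<bar>\<beta> - 1\<bar> * a powr (\<beta> - 1) * \<bar>r - r'\<bar>"
proof -
  define S where "S = {a / D .. D * a}"
  have "norm (exp (- lam * r) * r powr \<beta> - exp (- lam * r') * r' powr \<beta>)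
    \<le> (\<bar>\<beta>\<bar> + 1) * D powr \<bar>\<beta> - 1\<bar> * a powr (\<beta> - 1) * norm (r - r')"
  proof (rule field_differentiable_bound[where S = S])
    show "convex S" by (simp add: S_def)
    show "r \<in> S" "r' \<in> S" using assms by (auto simp: S_def field_simps)
    fix t assume "t \<in> S"
    then have "a / D \<le> t" "t \<le> D * a" by (simp_all add: S_def)
    moreover have "0 < a / D" using assms by simp
    ultimately have t: "0 < t" "a \<le> D * t" "t \<le> D * a"
      using assms by (linarith, simp_all add: field_simps)
    show "((\<lambda>t. exp (- lam * t) * t powr \<beta>) has_field_derivative
        (exp (- lam * t) * \<beta> - lam * t * exp (- (lam * t))) * t powr (\<beta> - 1)) (at t within S)"
    proof -
      have "t powr \<beta> = t * t powr (\<beta> - 1)" using t by (simp add: powr_diff)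
      then have eq: "(exp (- lam * t) * \<beta> - lam * t * exp (- (lam * t))) * t powr (\<beta> - 1) =
          exp (- lam * t) * (\<beta> * t powr (\<beta> - 1)) + exp (- lam * t) * (- lam) * t powr \<beta>"
        by (simp add: algebra_simps)
      have "((\<lambda>t. exp (- lam * t)) has_field_derivative exp (- lam * t) * (- lam)) (at t)"
        by (auto intro!: derivative_eq_intros)
      from DERIV_mult'[OF this has_real_derivative_powr[OF t(1)]] show ?thesis
        unfolding eq by (rule has_field_derivative_at_within)
    qed
    have "lam * t * exp (- (lam * t)) \<le> 1"
    proof -
      have "lam * t \<le> exp (lam * t)" using exp_ge_add_one_self[of "lam * t"] by linarith
      then show ?thesis by (simp add: exp_minus field_simps)
    qed
    moreover have "0 \<le> lam * t * exp (- (lam * t))" using assms t by simp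
    moreover have "\<bar>exp (- lam * t) * \<beta>\<bar> \<le> 1 * \<bar>\<beta>\<bar>"
      unfolding abs_mult using assms t by (intro mult_right_mono) auto
    ultimately have "\<bar>exp (- lam * t) * \<beta> - lam * t * exp (- (lam * t))\<bar> \<le> \<bar>\<beta>\<bar> + 1" by linarith
    moreover have "t powr (\<beta> - 1) \<le> D powr \<bar>\<beta> - 1\<bar> * a powr (\<beta> - 1)"
      using assms t by (intro powr_comparable) auto
    ultimately have "\<bar>exp (- lam * t) * \<beta> - lam * t * exp (- (lam * t))\<bar> * t powr (\<beta> - 1) \<le>
        (\<bar>\<beta>\<bar> + 1) * (D powr \<bar>\<beta> - 1\<bar> * a powr (\<beta> - 1))"
      by (intro mult_mono) auto
    then show "norm ((exp (- lam * t) * \<beta> - lam * t * exp (- (lam * t))) * t powr (\<beta> - 1)) \<le>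
        (\<bar>\<beta>\<bar> + 1) * D powr \<bar>\<beta> - 1\<bar> * a powr (\<beta> - 1)"
      by (simp add: abs_mult mult.assoc)
  qed
  then show ?thesis by simp
qed

text \<open>The first summand comes from the part \<open>(norm v)\<^sup>2\<close> of the increment
  of the squared norm, the factor 9 from the square of that increment, and the remaining product
  bounds the second derivative of the power - \<gamma> / 2.\<close>

definition norm_powr_const :: "real \<Rightarrow> real \<Rightarrow> real" where
  "norm_powr_const D \<gamma> = \<gamma> / 2 + 9 * (\<gamma> / 2 * (\<gamma> / 2 + 1) * (D\<^sup>2) powr (\<gamma> / 2 + 2))"

text \<open>The norm is regarded as a power of its square, and the squared norms of \<open>c\<close>
  and \<open>c + v\<close> are joined by linear interpolation \<open>z\<close> rather than by
  following the segment. Comparability with \<open>norm c\<close> at the two ends then passes to all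
  intermediate values by convexity, and a one-dimensional expansion suffices.\<close>

lemma norm_powr_taylor:
  fixes c v :: "real^'d::finite"
  assumes "2 \<le> D" "0 < \<gamma>" and c: "c \<noteq> 0" and v: "norm v \<le> norm c" and far: "norm c \<le> D * norm (c + v)"
  shows "\<bar>norm (c + v) powr (- \<gamma>) - norm c powr (- \<gamma>) - (- \<gamma> * norm c powr (- \<gamma> - 2) * (c \<bullet> v))\<bar>
    \<le> norm_powr_const D \<gamma> * norm c powr (- \<gamma> - 2) * (norm v)\<^sup>2"
proof -
  define a where "a = norm c"
  have a: "0 < a" using c by (simp add: a_def)
  define z0 where "z0 = a\<^sup>2"
  define w where "w = 2 * (c \<bullet> v) + (norm v)\<^sup>2"
  define e where "e = - \<gamma> / 2"
  define z where "z t = z0 + t * w" for t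
  have z1: "z 1 = (norm (c + v))\<^sup>2"
    by (simp add: z_def z0_def w_def a_def power2_norm_eq_inner inner_simps inner_commute)
  have za: "z0 \<le> D\<^sup>2 * z t" "z t \<le> D\<^sup>2 * z0" if t: "0 \<le> t" "t \<le> 1" for t
  proof -
    have D1: "1 \<le> D\<^sup>2" using assms by (simp add: one_le_power)
    have "norm (c + v) \<le> D * a"
    proof -
      have "norm (c + v) \<le> 2 * a" using norm_triangle_ineq[of c v] v by (simp add: a_def)
      also have "\<dots> \<le> D * a" using assms a by (intro mult_right_mono) auto
      finally show ?thesis .
    qed
    then have "z 1 \<le> D\<^sup>2 * z0"
      unfolding z1 z0_def power_mult_distrib[symmetric] by (rule power_mono) simp
    moreover have "z0 \<le> D\<^sup>2 * z 1"
      unfolding z1 z0_def power_mult_distrib[symmetric] using far by (intro power_mono) (auto simp: a_def)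
    moreover have "z 0 \<le> D\<^sup>2 * z0" "z0 \<le> D\<^sup>2 * z 0"
      using D1 by (simp_all add: z_def z0_def mult_le_cancel_right1)
    moreover have "z t = (1 - t) * z 0 + t * z 1"
      "D\<^sup>2 * z t = (1 - t) * (D\<^sup>2 * z 0) + t * (D\<^sup>2 * z 1)" "z0 = (1 - t) * z0 + t * z0"
      "D\<^sup>2 * z0 = (1 - t) * (D\<^sup>2 * z0) + t * (D\<^sup>2 * z0)"
      by (simp_all add: z_def algebra_simps)
    moreover have "(1 - t) * z 0 + t * z 1 \<le> (1 - t) * (D\<^sup>2 * z0) + t * (D\<^sup>2 * z0)"
      using t calculation by (intro add_mono mult_left_mono) auto
    moreover have "(1 - t) * z0 + t * z0 \<le> (1 - t) * (D\<^sup>2 * z 0) + t * (D\<^sup>2 * z 1)"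
      using t calculation by (intro add_mono mult_left_mono) auto
    ultimately show "z0 \<le> D\<^sup>2 * z t" "z t \<le> D\<^sup>2 * z0" by linarith+
  qed
  have z0: "0 < z0" using a by (simp add: z0_def)
  have zpos: "0 < z t" if t: "0 \<le> t" "t \<le> 1" for t
    using za(1)[OF t] z0 by (smt (verit) mult_nonneg_nonpos zero_le_power2)
  have cv: "\<bar>c \<bullet> v\<bar> \<le> a * norm v" unfolding a_def by (rule Cauchy_Schwarz_ineq2)
  have vv: "(norm v)\<^sup>2 \<le> a * norm v"
    unfolding power2_eq_square using v by (intro mult_right_mono) (auto simp: a_def)
  have "\<bar>w\<bar> \<le> 3 * (a * norm v)"
    unfolding w_def using cv vv zero_le_power2[of "norm v"] by linarith
  then have "\<bar>w\<bar>\<^sup>2 \<le> (3 * (a * norm v))\<^sup>2" by (intro power_mono) auto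
  then have w: "w\<^sup>2 \<le> 9 * (a\<^sup>2 * (norm v)\<^sup>2)" by (simp add: power_mult_distrib)
  define K where "K = \<gamma> / 2 * (\<gamma> / 2 + 1) * (D\<^sup>2) powr (\<gamma> / 2 + 2)"
  have K: "0 \<le> K" using assms by (simp add: K_def)
  have a_powr: "z0 powr (e - 2) * a\<^sup>2 = a powr (- \<gamma> - 2)" "z0 powr (e - 1) = a powr (- \<gamma> - 2)" "z0 powr e = a powr (- \<gamma>)"
  proof -
    have a2: "a\<^sup>2 = a powr 2" using a powr_realpow[of a 2] by simp
    show "z0 powr (e - 2) * a\<^sup>2 = a powr (- \<gamma> - 2)" "z0 powr (e - 1) = a powr (- \<gamma> - 2)" "z0 powr e = a powr (- \<gamma>)"
      unfolding z0_def a2 powr_powr powr_add[symmetric] e_def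
      by (rule arg_cong[where f = "\<lambda>x. a powr x"]; simp)+
  qed
  have "\<bar>z 1 powr e - z 0 powr e - e * z 0 powr (e - 1) * w\<bar> \<le> K * z0 powr (e - 2) * w\<^sup>2"
  proof (rule second_order_remainder[where f = "\<lambda>t. z t powr e" and f' = "\<lambda>t. e * z t powr (e - 1) * w"
        and f'' = "\<lambda>t. e * (e - 1) * z t powr (e - 2) * w\<^sup>2"])
    fix t :: real assume t: "0 \<le> t" "t \<le> 1"
    have dz: "(z has_real_derivative w) (at t)"
      unfolding z_def by (auto intro!: derivative_eq_intros)
    show "((\<lambda>t. z t powr e) has_real_derivative e * z t powr (e - 1) * w) (at t)"
      using DERIV_fun_powr[OF dz zpos[OF t], of e] by simp
    show "((\<lambda>t. e * z t powr (e - 1) * w) has_real_derivative e * (e - 1) * z t powr (e - 2) * w\<^sup>2) (at t)"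
      using DERIV_cmult[OF DERIV_cmult_right[OF DERIV_fun_powr[OF dz zpos[OF t], of "e - 1"], of w], of e]
      by (simp add: power2_eq_square mult_ac)
    have "z t powr (e - 2) \<le> (D\<^sup>2) powr \<bar>e - 2\<bar> * z0 powr (e - 2)"
      using assms by (intro powr_comparable za[OF t] z0) (simp add: one_le_power)
    also have "\<bar>e - 2\<bar> = \<gamma> / 2 + 2" using assms by (simp add: e_def)
    finally have zt: "z t powr (e - 2) \<le> (D\<^sup>2) powr (\<gamma> / 2 + 2) * z0 powr (e - 2)" .
    have ee: "e * (e - 1) = \<gamma> / 2 * (\<gamma> / 2 + 1)" by (simp add: e_def algebra_simps)
    have e0: "0 \<le> e * (e - 1)" unfolding ee using assms by simp
    then have nn: "0 \<le> e * (e - 1) * z t powr (e - 2)"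
      by (rule mult_nonneg_nonneg) simp
    have le: "e * (e - 1) * z t powr (e - 2) \<le> K * z0 powr (e - 2)"
      using mult_left_mono[OF zt e0] unfolding K_def ee[symmetric] by (simp only: mult.assoc)
    show "\<bar>e * (e - 1) * z t powr (e - 2) * w\<^sup>2\<bar> \<le> K * z0 powr (e - 2) * w\<^sup>2"
      unfolding abs_mult[of _ "w\<^sup>2"] abs_of_nonneg[OF nn] using le by (simp add: mult_right_mono)
  qed
  also have "\<dots> \<le> K * z0 powr (e - 2) * (9 * (a\<^sup>2 * (norm v)\<^sup>2))"
    using w K by (intro mult_left_mono) auto
  also have "\<dots> = 9 * K * (z0 powr (e - 2) * a\<^sup>2) * (norm v)\<^sup>2" by simp
  finally have 1: "\<bar>z 1 powr e - z0 powr e - e * z0 powr (e - 1) * w\<bar> \<le> 9 * K * a powr (- \<gamma> - 2) * (norm v)\<^sup>2"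
    unfolding a_powr by (simp add: z_def a_powr)
  have "z 1 powr e = norm (c + v) powr (- \<gamma>)"
  proof -
    have "0 < norm (c + v)" using zpos[of 1] unfolding z1 by simp
    then have "(norm (c + v))\<^sup>2 = norm (c + v) powr 2" using powr_realpow[of "norm (c + v)" 2] by simp
    then show ?thesis unfolding z1 e_def by (simp only: powr_powr) simp
  qed
  then have "\<bar>norm (c + v) powr (- \<gamma>) - a powr (- \<gamma>) - e * a powr (- \<gamma> - 2) * w\<bar> \<le> 9 * K * a powr (- \<gamma> - 2) * (norm v)\<^sup>2"
    using 1 unfolding a_powr by simp
  moreover have "e * a powr (- \<gamma> - 2) * w = - \<gamma> * a powr (- \<gamma> - 2) * (c \<bullet> v) - \<gamma> / 2 * a powr (- \<gamma> - 2) * (norm v)\<^sup>2"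
    by (simp add: e_def w_def algebra_simps)
  moreover have "0 \<le> \<gamma> / 2 * a powr (- \<gamma> - 2) * (norm v)\<^sup>2" using assms by simp
  ultimately show ?thesis
    unfolding norm_powr_const_def K_def[symmetric] a_def[symmetric] distrib_right by linarith
qed

lemma norm_powr_const_nonneg: "0 < \<gamma> \<Longrightarrow> 0 \<le> norm_powr_const D \<gamma>"
  by (simp add: norm_powr_const_def)

text \<open>\<open>1 + \<gamma>\<close> bounds the derivative of the quotient; \<gamma>,
  \<open>D powr \<gamma>\<close> and twice \<open>norm_powr_const\<close> bound the three terms of
  its remainder.\<close>

definition quotient_const :: "real \<Rightarrow> real \<Rightarrow> real" where
  "quotient_const D \<gamma> = 1 + \<gamma> + D powr \<gamma> + 2 * norm_powr_const D \<gamma>"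

lemma quotient_const_ge_1: "0 < \<gamma> \<Longrightarrow> 1 \<le> quotient_const D \<gamma>"
  using norm_powr_const_nonneg[of \<gamma> D] by (simp add: quotient_const_def)

text \<open>The product rule with remainders: besides the linear part \<open>G\<close> there remain
  the product of the two derivatives, the remainder \<open>\<rho>1\<close> of \<psi> times the
  shifted power, and the affine part of \<psi> times the remainder \<open>\<rho>2\<close> of the
  power.\<close>

lemma holder_profile_quotient:
  fixes \<psi> :: "real^'d::finite \<Rightarrow> real"
  assumes \<psi>: "holder_profile A p \<theta> \<psi>" and "0 \<le> A" "\<theta> \<le> 2" "2 \<le> D" "0 < \<gamma>" and c: "c \<noteq> 0"
  obtains G where "linear G"
    "\<And>v. \<bar>G v\<bar> \<le> quotient_const D \<gamma> * A * norm c powr (p - \<gamma> - 1) * norm v"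
    "\<And>v. norm v \<le> norm c \<Longrightarrow> norm c \<le> D * norm (c + v) \<Longrightarrow>
      \<bar>\<psi> (c + v) * norm (c + v) powr (- \<gamma>) - \<psi> c * norm c powr (- \<gamma>) - G v\<bar>
        \<le> quotient_const D \<gamma> * A * norm c powr (p - \<gamma> - \<theta>) * norm v powr \<theta>"
proof -
  from \<psi> obtain \<psi>' where \<psi>': "\<And>\<xi>. linear (\<psi>' \<xi>)" "\<And>\<xi>. \<bar>\<psi> \<xi>\<bar> \<le> A * norm \<xi> powr p"
     "\<And>\<xi> v. \<bar>\<psi>' \<xi> v\<bar> \<le> A * norm \<xi> powr (p - 1) * norm v"
     "\<And>\<xi> v. norm v \<le> norm \<xi> \<Longrightarrow>
        \<bar>\<psi> (\<xi> + v) - \<psi> \<xi> - \<psi>' \<xi> v\<bar> \<le> A * norm v powr \<theta> * norm \<xi> powr (p - \<theta>)"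
    unfolding holder_profile_def by blast
  define a where "a = norm c"
  have a: "0 < a" using c by (simp add: a_def)
  define g where "g v = - \<gamma> * norm c powr (- \<gamma> - 2) * (c \<bullet> v)" for v
  define G where "G v = \<psi>' c v * norm c powr (- \<gamma>) + \<psi> c * g v" for v
  define K where "K = norm_powr_const D \<gamma>"
  have K: "0 \<le> K" using norm_powr_const_nonneg[OF \<open>0 < \<gamma>\<close>] by (simp add: K_def)
  have "linear g"
    unfolding g_def by (rule linearI) (simp_all add: inner_add_right algebra_simps)
  then have linG: "linear G"
    unfolding G_def using \<psi>'(1)[of c]
    by (intro linearI) (simp_all add: linear_add linear_scale algebra_simps)
  have g: "\<bar>g v\<bar> \<le> \<gamma> * a powr (- \<gamma> - 1) * norm v" for v
  proof -
    have "\<bar>c \<bullet> v\<bar> \<le> a * norm v" unfolding a_def by (rule Cauchy_Schwarz_ineq2)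
    then have "\<bar>g v\<bar> \<le> \<gamma> * a powr (- \<gamma> - 2) * (a * norm v)"
      unfolding g_def a_def[symmetric] abs_mult using assms by (intro mult_mono) auto
    moreover have "a powr (- \<gamma> - 2) * a = a powr (- \<gamma> - 1)"
    proof -
      have "a powr (- \<gamma> - 1) = a powr ((- \<gamma> - 2) + 1)"
        by (rule arg_cong[where f = "\<lambda>x. a powr x"]) simp
      also have "\<dots> = a powr (- \<gamma> - 2) * a"
        unfolding powr_add using a by simp
      finally show ?thesis ..
    qed
    ultimately show ?thesis by (metis mult.assoc)
  qed
  have pw: "a powr x * a powr y = a powr (x + y)" for x y
    by (simp add: powr_add)
  show ?thesis
  proof (rule that[OF linG])
    fix v :: "real^'d"
    let ?\<delta> = "norm v"
    have "\<bar>G v\<bar> \<le> \<bar>\<psi>' c v\<bar> * a powr (- \<gamma>) + \<bar>\<psi> c\<bar> * \<bar>g v\<bar>"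
      unfolding G_def a_def by (rule order_trans[OF abs_triangle_ineq]) (simp add: abs_mult)
    also have "\<dots> \<le> (A * a powr (p - 1) * ?\<delta>) * a powr (- \<gamma>) + (A * a powr p) * (\<gamma> * a powr (- \<gamma> - 1) * ?\<delta>)"
      using \<psi>'(2)[of c] \<psi>'(3)[of c v] g[of v] assms unfolding a_def[symmetric]
      by (intro add_mono mult_mono) auto
    also have "\<dots> = (1 + \<gamma>) * A * (a powr (p - 1) * a powr (- \<gamma>)) * ?\<delta>"
    proof -
      have "a powr p * a powr (- \<gamma> - 1) = a powr (p - 1) * a powr (- \<gamma>)"
        unfolding pw by (rule arg_cong[where f = "\<lambda>x. a powr x"]) simp
      then show ?thesis by (simp add: algebra_simps)
    qed
    also have "\<dots> \<le> quotient_const D \<gamma> * A * (a powr (p - 1) * a powr (- \<gamma>)) * ?\<delta>"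
      using K assms by (intro mult_right_mono) (auto simp: quotient_const_def K_def)
    finally show "\<bar>G v\<bar> \<le> quotient_const D \<gamma> * A * norm c powr (p - \<gamma> - 1) * ?\<delta>"
      by (simp add: pw a_def[symmetric] algebra_simps)
    assume v: "norm v \<le> norm c" and far: "norm c \<le> D * norm (c + v)"
    define \<rho>1 where "\<rho>1 = \<psi> (c + v) - \<psi> c - \<psi>' c v"
    define \<rho>2 where "\<rho>2 = norm (c + v) powr (- \<gamma>) - norm c powr (- \<gamma>) - g v"
    define \<Theta> where "\<Theta> = a powr (p - \<gamma> - \<theta>) * ?\<delta> powr \<theta>"
    \<comment> \<open>Terms quadratic in \<open>v\<close> are downgraded to order \<theta>; this
      uses \<theta> \<le> 2 and \<open>norm v \<le> norm c\<close>.\<close>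
    have \<Theta>: "a powr (p - \<gamma> - 2) * ?\<delta>\<^sup>2 \<le> \<Theta>"
    proof (cases "v = 0")
      case False
      have "?\<delta>\<^sup>2 = ?\<delta> powr (2 - \<theta>) * ?\<delta> powr \<theta>"
        unfolding powr_add[symmetric] using False powr_realpow[of ?\<delta> 2] by simp
      also have "\<dots> \<le> a powr (2 - \<theta>) * ?\<delta> powr \<theta>"
        using v assms by (intro mult_right_mono powr_mono2) (auto simp: a_def)
      finally have "a powr (p - \<gamma> - 2) * ?\<delta>\<^sup>2 \<le> a powr (p - \<gamma> - 2) * (a powr (2 - \<theta>) * ?\<delta> powr \<theta>)"
        by (intro mult_left_mono) auto
      also have "a powr (p - \<gamma> - 2) * a powr (2 - \<theta>) = a powr (p - \<gamma> - \<theta>)"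
        unfolding pw by (rule arg_cong[where f = "\<lambda>x. a powr x"]) simp
      then have "a powr (p - \<gamma> - 2) * (a powr (2 - \<theta>) * ?\<delta> powr \<theta>) = \<Theta>"
        by (simp add: \<Theta>_def flip: mult.assoc)
      finally show ?thesis .
    qed (simp add: \<Theta>_def)
    have "norm (c + v) \<le> D * norm c"
    proof -
      have "norm (c + v) \<le> 2 * norm c" using norm_triangle_ineq[of c v] v by simp
      also have "\<dots> \<le> D * norm c" using assms by (intro mult_right_mono) auto
      finally show ?thesis .
    qed
    then have g_le: "norm (c + v) powr (- \<gamma>) \<le> D powr \<gamma> * a powr (- \<gamma>)"
      using powr_comparable[of D a "norm (c + v)" "- \<gamma>"] assms far a by (simp add: a_def)
    have \<rho>1: "\<bar>\<rho>1\<bar> \<le> A * ?\<delta> powr \<theta> * a powr (p - \<theta>)"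
      using \<psi>'(4)[OF v] by (simp add: \<rho>1_def a_def)
    have \<rho>2: "\<bar>\<rho>2\<bar> \<le> K * a powr (- \<gamma> - 2) * ?\<delta>\<^sup>2"
      using norm_powr_taylor[OF \<open>2 \<le> D\<close> \<open>0 < \<gamma>\<close> c v far] by (simp add: \<rho>2_def g_def K_def a_def)
    have b: "\<bar>\<psi> c\<bar> \<le> A * a powr p" "\<bar>\<psi>' c v\<bar> \<le> A * a powr (p - 1) * ?\<delta>"
      using \<psi>'(2)[of c] \<psi>'(3)[of c v] by (simp_all add: a_def)
    have "A * a powr (p - 1) * ?\<delta> \<le> A * a powr (p - 1) * a"
      using v assms by (intro mult_left_mono) (auto simp: a_def)
    also have "\<dots> = A * a powr p"
      using a powr_add[of a "p - 1" 1] by simp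
    finally have b': "\<bar>\<psi> c + \<psi>' c v\<bar> \<le> 2 * (A * a powr p)"
      using b abs_triangle_ineq[of "\<psi> c" "\<psi>' c v"] by linarith
    have "\<psi> (c + v) * norm (c + v) powr (- \<gamma>) - \<psi> c * norm c powr (- \<gamma>) - G v =
        \<psi>' c v * g v + \<rho>1 * norm (c + v) powr (- \<gamma>) + (\<psi> c + \<psi>' c v) * \<rho>2"
      by (simp add: G_def \<rho>1_def \<rho>2_def algebra_simps)
    also have "\<bar>\<dots>\<bar> \<le> \<bar>\<psi>' c v\<bar> * \<bar>g v\<bar> + \<bar>\<rho>1\<bar> * norm (c + v) powr (- \<gamma>) + \<bar>\<psi> c + \<psi>' c v\<bar> * \<bar>\<rho>2\<bar>"
      by (intro order_trans[OF abs_triangle_ineq] add_mono) (simp_all add: abs_mult)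
    also have "\<dots> \<le> (A * a powr (p - 1) * ?\<delta>) * (\<gamma> * a powr (- \<gamma> - 1) * ?\<delta>) +
        (A * ?\<delta> powr \<theta> * a powr (p - \<theta>)) * (D powr \<gamma> * a powr (- \<gamma>)) +
        (2 * (A * a powr p)) * (K * a powr (- \<gamma> - 2) * ?\<delta>\<^sup>2)"
      using b b' g \<rho>1 \<rho>2 g_le assms by (intro add_mono mult_mono) auto
    also have "\<dots> = (\<gamma> * A) * (a powr (p - 1) * a powr (- \<gamma> - 1) * ?\<delta>\<^sup>2) +
        D powr \<gamma> * A * (a powr (p - \<theta>) * a powr (- \<gamma>) * ?\<delta> powr \<theta>) +
        (2 * K * A) * (a powr p * a powr (- \<gamma> - 2) * ?\<delta>\<^sup>2)"
      by (simp add: power2_eq_square mult_ac)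
    also have "\<dots> = (\<gamma> * A) * (a powr (p - \<gamma> - 2) * ?\<delta>\<^sup>2) + D powr \<gamma> * A * \<Theta> +
        (2 * K * A) * (a powr (p - \<gamma> - 2) * ?\<delta>\<^sup>2)"
      unfolding pw \<Theta>_def by (simp add: algebra_simps)
    also have "\<dots> \<le> (\<gamma> * A) * \<Theta> + D powr \<gamma> * A * \<Theta> + (2 * K * A) * \<Theta>"
      using \<Theta> K assms by (intro add_mono mult_left_mono) auto
    also have "\<dots> \<le> (quotient_const D \<gamma> * A) * \<Theta>"
      using assms by (simp add: quotient_const_def K_def distrib_right \<Theta>_def)
    finally show "\<bar>\<psi> (c + v) * norm (c + v) powr (- \<gamma>) - \<psi> c * norm c powr (- \<gamma>) - G v\<bar>
        \<le> quotient_const D \<gamma> * A * norm c powr (p - \<gamma> - \<theta>) * norm v powr \<theta>"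
      by (simp add: \<Theta>_def a_def mult.assoc)
  qed
qed

subsection \<open>The quadrature error on one cell\<close>

lemma set_integral_abs_le:
  fixes f g :: "'a \<Rightarrow> real"
  assumes "set_integrable M S f" "set_integrable M S g" "\<And>x. x \<in> S \<Longrightarrow> \<bar>f x\<bar> \<le> g x"
  shows "\<bar>LINT x:S|M. f x\<bar> \<le> (LINT x:S|M. g x)"
  using assms unfolding set_integrable_def set_lebesgue_integral_def
  by (intro order_trans[OF integral_abs_bound] integral_mono) (auto simp: indicator_def)

lemma set_integral_sum:
  fixes f :: "'i \<Rightarrow> 'a \<Rightarrow> real"
  assumes "\<And>i. i \<in> I \<Longrightarrow> set_integrable M S (f i)"
  shows "(LINT x:S|M. \<Sum>i\<in>I. f i x) = (\<Sum>i\<in>I. LINT x:S|M. f i x)"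
  using assms unfolding set_integrable_def set_lebesgue_integral_def
  by (simp add: sum_distrib_left integral_sum)

definition cell_center :: "real \<Rightarrow> nat^'d \<Rightarrow> real^'d" where
  "cell_center h k = (\<chi> i. h * (real (k $ i) + 1 / 2))"

lemma grid_cell_iff:
  "\<xi> \<in> grid_cell h k \<longleftrightarrow> (\<forall>i. h * real (k $ i) \<le> \<xi> $ i \<and> \<xi> $ i \<le> h * (real (k $ i) + 1))"
  by (simp add: grid_cell_def grid_point_def mem_box_cart add.commute)

lemma grid_cell_borel [measurable, simp]: "grid_cell h k \<in> sets borel"
  by (simp add: grid_cell_def)

lemma measure_grid_cell:
  assumes "0 \<le> h"
  shows "measure lborel (grid_cell h k :: (real^'d::finite) set) = h ^ CARD('d)"
proof -
  have "(grid_point h k :: real^'d) \<in> grid_cell h k"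
    using assms by (simp add: grid_cell_iff grid_point_def algebra_simps)
  then have "grid_cell h k \<noteq> ({} :: (real^'d) set)" by blast
  then show ?thesis
    unfolding grid_cell_def by (subst content_cbox_cart) (simp_all add: grid_point_def algebra_simps)
qed

lemma set_integrable_const_grid_cell: "set_integrable lborel (grid_cell h k) (\<lambda>_. c :: real)"
  unfolding grid_cell_def set_integrable_def by (intro borel_integrable_compact) auto

lemma set_integral_const_grid_cell:
  "0 \<le> h \<Longrightarrow> (LINT \<xi> : grid_cell h k | lborel. c) = c * h ^ CARD('d)"
  for k :: "nat^'d::finite" and c :: real
  using measure_grid_cell[of h k] by (simp add: set_lebesgue_integral_def mult.commute)

lemma grid_point_in_cell:
  "n \<in> multi_indices 2 \<Longrightarrow> 0 \<le> h \<Longrightarrow> grid_point h (k + n) \<in> grid_cell h k"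
  by (auto simp: grid_cell_iff grid_point_def multi_indices_def less_2_cases_iff intro!: mult_left_mono)
    (metis One_nat_def less_2_cases_iff of_nat_0 of_nat_1 order.refl zero_le_one)

text \<open>Two facts give everything: a cell with \<open>k \<noteq> 0\<close> keeps distance
  \<open>h\<close> from the origin, and each coordinate deviates from the center by at most
  \<open>h / 2\<close>, while the coordinates of the center are at least \<open>h / 2\<close>. So
  the one constant 1 + d serves all these cells.\<close>

lemma cell_geometry:
  fixes \<xi> :: "real^'d::finite"
  assumes "0 < h" "k \<noteq> 0" "\<xi> \<in> grid_cell h k"
  shows "h \<le> norm \<xi>" "norm (\<xi> - cell_center h k) \<le> norm (cell_center h k :: real^'d)"
    and "norm (cell_center h k :: real^'d) \<le> (1 + real CARD('d)) * norm \<xi>"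
    and "norm (\<xi> - cell_center h k) \<le> (1 + real CARD('d)) * h"
    and "norm \<xi> \<le> (1 + real CARD('d)) * norm (cell_center h k :: real^'d)"
    and "cell_center h k \<noteq> (0 :: real^'d)"
proof -
  let ?c = "cell_center h k :: real^'d"
  have \<xi>: "h * real (k $ i) \<le> \<xi> $ i" "\<xi> $ i \<le> h * (real (k $ i) + 1)" for i
    using assms(3) by (auto simp: grid_cell_iff)
  obtain j where "k $ j \<noteq> 0" using assms(2) by (auto simp: vec_eq_iff)
  then have "h * 1 \<le> h * real (k $ j)" using assms(1) by (intro mult_left_mono) auto
  then have "h \<le> \<bar>\<xi> $ j\<bar>" using \<xi>(1)[of j] by linarith
  then show h: "h \<le> norm \<xi>" using component_le_norm_cart[of \<xi> j] by linarith
  have comp: "\<bar>(\<xi> - ?c) $ i\<bar> \<le> h / 2" for i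
  proof -
    have "(\<xi> - ?c) $ i = \<xi> $ i - h * real (k $ i) - h / 2"
      by (simp add: cell_center_def algebra_simps)
    moreover have "h * (real (k $ i) + 1) = h * real (k $ i) + h" by (simp add: algebra_simps)
    ultimately show ?thesis using \<xi>[of i] by linarith
  qed
  have "h / 2 \<le> ?c $ i" for i
    using assms(1) by (simp add: cell_center_def algebra_simps)
  then have "\<bar>(\<xi> - ?c) $ i\<bar> \<le> \<bar>?c $ i\<bar>" for i
    using comp[of i] by (meson abs_ge_self order_trans)
  then show n1: "norm (\<xi> - ?c) \<le> norm ?c"
    unfolding norm_vec_def by (intro L2_set_mono) auto
  have "norm (\<xi> - ?c) \<le> (\<Sum>i\<in>UNIV. \<bar>(\<xi> - ?c) $ i\<bar>)" by (rule norm_le_l1_cart)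
  also have "\<dots> \<le> (\<Sum>i\<in>(UNIV::'d set). h / 2)" by (intro sum_mono comp)
  also have "\<dots> \<le> real CARD('d) * h" using assms(1) by (simp add: field_simps)
  finally have n2: "norm (\<xi> - ?c) \<le> real CARD('d) * h" .
  then show "norm (\<xi> - ?c) \<le> (1 + real CARD('d)) * h" using assms(1) by (simp add: algebra_simps)
  have "real CARD('d) * h \<le> real CARD('d) * norm \<xi>" using h by (intro mult_left_mono) auto
  moreover have "norm ?c \<le> norm \<xi> + norm (\<xi> - ?c)"
    using norm_triangle_ineq4[of \<xi> "\<xi> - ?c"] by simp
  ultimately show "norm ?c \<le> (1 + real CARD('d)) * norm \<xi>" using n2 unfolding distrib_right by linarith
  have "1 * norm ?c \<le> real CARD('d) * norm ?c"
    by (intro mult_right_mono) (simp_all add: Suc_leI)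
  moreover have "norm \<xi> \<le> norm ?c + norm (\<xi> - ?c)"
    using norm_triangle_ineq[of ?c "\<xi> - ?c"] by simp
  ultimately show "norm \<xi> \<le> (1 + real CARD('d)) * norm ?c"
    using n1 by (simp add: algebra_simps)
  have "0 < ?c $ j" using assms(1) by (simp add: cell_center_def)
  then show "?c \<noteq> 0" by (metis less_irrefl zero_index)
qed

text \<open>The point reflection \<open>T\<close> in the center preserves the cell and Lebesgue
  measure and reverses the sign of the integrand.\<close>

lemma set_integral_linear_centered:
  fixes G :: "real^'d::finite \<Rightarrow> real"
  assumes G: "linear G"
  shows "set_integrable lborel (grid_cell h k) (\<lambda>\<xi>. G (\<xi> - cell_center h k))"
    and "(LINT \<xi> : grid_cell h k | lborel. G (\<xi> - cell_center h k)) = 0"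
proof -
  let ?c = "cell_center h k :: real^'d"
  have cont: "continuous_on UNIV (\<lambda>\<xi>. G (\<xi> - ?c))"
    using G by (intro continuous_on_compose2[OF linear_continuous_on[of G UNIV]] continuous_intros)
      (auto simp: linear_conv_bounded_linear)
  show "set_integrable lborel (grid_cell h k) (\<lambda>\<xi>. G (\<xi> - ?c))"
    unfolding grid_cell_def set_integrable_def
    by (intro borel_integrable_compact) (auto intro: continuous_on_subset[OF cont])
  have meas [measurable]: "(\<lambda>\<xi>. G (\<xi> - ?c)) \<in> borel_measurable borel"
    using cont by (rule borel_measurable_continuous_onI)
  define F where "F \<xi> = indicator (grid_cell h k) \<xi> * G (\<xi> - ?c)" for \<xi>
  have [measurable]: "F \<in> borel_measurable borel" unfolding F_def by measurable
  define T where "T \<xi> = 2 *\<^sub>R ?c + (- 1) *\<^sub>R \<xi>" for \<xi> :: "real^'d"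
  have [measurable]: "T \<in> borel_measurable borel" unfolding T_def by measurable
  have "lborel = distr lborel borel T"
    using lborel_affine[of "- 1" "2 *\<^sub>R ?c"] by (simp add: density_1 T_def[abs_def])
  then have "(LINT \<xi>|lborel. F \<xi>) = (LINT \<xi>|distr lborel borel T. F \<xi>)" by simp
  also have "\<dots> = (LINT \<xi>|lborel. F (T \<xi>))" by (subst integral_distr) simp_all
  finally have "(LINT \<xi>|lborel. F \<xi>) = (LINT \<xi>|lborel. F (T \<xi>))" .
  moreover have "F (T \<xi>) = - F \<xi>" for \<xi>
  proof -
    have "(T \<xi> \<in> grid_cell h k) = (\<xi> \<in> grid_cell h k)"
      unfolding grid_cell_iff by (intro all_cong1) (auto simp: T_def cell_center_def algebra_simps)
    moreover have "T \<xi> - ?c = - (\<xi> - ?c)" by (simp add: T_def vec_eq_iff)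
    ultimately show ?thesis by (simp add: F_def linear_neg[OF G] indicator_def del: minus_diff_eq)
  qed
  ultimately have "(LINT \<xi>|lborel. F \<xi>) = 0" by simp
  then show "(LINT \<xi> : grid_cell h k | lborel. G (\<xi> - ?c)) = 0"
    by (simp add: F_def set_lebesgue_integral_def)
qed

text \<open>The discrete counterpart: opposite corners cancel.\<close>

lemma sum_linear_centered:
  fixes G :: "real^'d::finite \<Rightarrow> real"
  assumes G: "linear G"
  shows "(\<Sum>n\<in>multi_indices 2. G (grid_point h (k + n) - cell_center h k)) = 0"
proof (rule sum_multi_indices_odd[where S = UNIV])
  fix n :: "nat^'d" assume n: "n \<in> multi_indices 2"
  have "real (Suc 0 - n $ i) = 1 - real (n $ i)" for i
  proof -
    have "n $ i = 0 \<or> n $ i = 1" using n by (simp add: multi_indices_2)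
    then show ?thesis by (elim disjE) simp_all
  qed
  then have "grid_point h (k + flip UNIV n) - cell_center h k = - (grid_point h (k + n) - cell_center h k)"
    unfolding vec_eq_iff
    by (simp add: grid_point_def cell_center_def flip_def) (simp add: algebra_simps)
  then show "G (grid_point h (k + flip UNIV n) - cell_center h k) = - G (grid_point h (k + n) - cell_center h k)"
    by (simp add: linear_neg[OF G] del: minus_diff_eq)
qed

definition corner_mean :: "real \<Rightarrow> nat^'d::finite \<Rightarrow> (real^'d \<Rightarrow> real) \<Rightarrow> real" where
  "corner_mean h k f = 1 / 2 ^ CARD('d) * (\<Sum>n\<in>multi_indices 2. f (grid_point h (k + n)))"

definition cell_error :: "real \<Rightarrow> nat^'d::finite \<Rightarrow> (real^'d \<Rightarrow> real) \<Rightarrow> (real^'d \<Rightarrow> real) \<Rightarrow> real" where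
  "cell_error h k w f = (LINT \<xi> : grid_cell h k | lborel. f \<xi> * w \<xi>) -
     corner_mean h k f * (LINT \<xi> : grid_cell h k | lborel. w \<xi>)"

text \<open>The affine part of \<open>f\<close> is integrated exactly against a constant weight; against \<open>w\<close> it costs
  the oscillation of \<open>w\<close>.\<close>

lemma cell_error_bound:
  fixes f w :: "real^'d::finite \<Rightarrow> real"
  assumes "0 < h" and G: "linear G"
    and f: "\<And>\<xi>. \<xi> \<in> grid_cell h k \<Longrightarrow> \<bar>f \<xi> - f0 - G (\<xi> - cell_center h k)\<bar> \<le> \<eta>"
    and GB: "\<And>\<xi>. \<xi> \<in> grid_cell h k \<Longrightarrow> \<bar>G (\<xi> - cell_center h k)\<bar> \<le> B"
    and w: "\<And>\<xi>. \<xi> \<in> grid_cell h k \<Longrightarrow> \<bar>w \<xi>\<bar> \<le> W"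
    and V: "\<And>\<xi>. \<xi> \<in> grid_cell h k \<Longrightarrow> \<bar>w \<xi> - w0\<bar> \<le> V"
    and int: "set_integrable lborel (grid_cell h k) (\<lambda>\<xi>. f \<xi> * w \<xi>)" "set_integrable lborel (grid_cell h k) w"
  shows "\<bar>cell_error h k w f\<bar> \<le> (2 * \<eta> * W + B * V) * h ^ CARD('d)"
proof -
  let ?c = "cell_center h k :: real^'d"
  let ?I = "grid_cell h k :: (real^'d) set"
  let ?m = "corner_mean h k f"
  define R where "R \<xi> = f \<xi> - f0 - G (\<xi> - ?c)" for \<xi>
  have "(\<Sum>n\<in>multi_indices 2. f (grid_point h (k + n))) =
      (\<Sum>n\<in>multi_indices 2. f0 + R (grid_point h (k + n)))"
    using sum_linear_centered[OF G, of h k] by (simp add: R_def sum_subtractf)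
  then have "?m - f0 = 1 / 2 ^ CARD('d) * (\<Sum>n\<in>multi_indices 2. R (grid_point h (k + n)))"
    by (simp add: corner_mean_def sum.distrib card_multi_indices field_simps)
  moreover have "\<bar>\<Sum>n\<in>multi_indices 2. R (grid_point h (k + n))\<bar> \<le> 2 ^ CARD('d) * \<eta>"
    using abs_sum_le_card[of "multi_indices 2" "\<lambda>n. R (grid_point h (k + n))" \<eta>] f grid_point_in_cell[of _ h k] \<open>0 < h\<close>
    by (simp add: R_def card_multi_indices)
  \<comment> \<open>The corner mean also reproduces the affine part, so it differs from
    \<open>f0\<close> by at most \<eta>; hence the factor 2 in front of \<eta> in the bound.\<close>
  ultimately have m: "\<bar>?m - f0\<bar> \<le> \<eta>"
    by (simp add: divide_le_eq mult.commute)
  \<comment> \<open>The inserted integral of \<open>w0 * G\<close> is zero. It makes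
    \<open>G\<close> appear multiplied by \<open>w - w0\<close> only.\<close>
  have "cell_error h k w f = (LINT \<xi> : ?I | lborel. f \<xi> * w \<xi>) - (LINT \<xi> : ?I | lborel. ?m * w \<xi>) -
      (LINT \<xi> : ?I | lborel. w0 * G (\<xi> - ?c))"
    using set_integral_linear_centered(2)[OF G, of h k] by (simp add: cell_error_def)
  also have "\<dots> = (LINT \<xi> : ?I | lborel. f \<xi> * w \<xi> - ?m * w \<xi> - w0 * G (\<xi> - ?c))"
    using int set_integral_linear_centered(1)[OF G, of h k]
    by (simp add: set_integral_diff set_integrable_mult_right)
  also have "\<bar>\<dots>\<bar> \<le> (LINT \<xi> : ?I | lborel. 2 * \<eta> * W + B * V)"
  proof (rule set_integral_abs_le)
    show "set_integrable lborel ?I (\<lambda>\<xi>. f \<xi> * w \<xi> - ?m * w \<xi> - w0 * G (\<xi> - ?c))"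
      using int set_integral_linear_centered(1)[OF G, of h k] by (intro set_integral_diff(1) set_integrable_mult_right)
    show "set_integrable lborel ?I (\<lambda>_. 2 * \<eta> * W + B * V)" by (rule set_integrable_const_grid_cell)
    fix \<xi> assume \<xi>: "\<xi> \<in> ?I"
    have "f \<xi> * w \<xi> - ?m * w \<xi> - w0 * G (\<xi> - ?c) = (R \<xi> - (?m - f0)) * w \<xi> + G (\<xi> - ?c) * (w \<xi> - w0)"
      by (simp add: R_def algebra_simps)
    also have "\<bar>\<dots>\<bar> \<le> \<bar>R \<xi> - (?m - f0)\<bar> * \<bar>w \<xi>\<bar> + \<bar>G (\<xi> - ?c)\<bar> * \<bar>w \<xi> - w0\<bar>"
      by (rule order_trans[OF abs_triangle_ineq]) (simp add: abs_mult)
    also have "\<dots> \<le> (2 * \<eta>) * W + B * V"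
    proof (intro add_mono mult_mono w V GB \<xi>)
      show "\<bar>R \<xi> - (?m - f0)\<bar> \<le> 2 * \<eta>" using f[OF \<xi>] m unfolding R_def by linarith
      show "0 \<le> 2 * \<eta>" using f[OF \<xi>] by linarith
      show "0 \<le> B" using GB[OF \<xi>] by linarith
    qed auto
    finally show "\<bar>f \<xi> * w \<xi> - ?m * w \<xi> - w0 * G (\<xi> - ?c)\<bar> \<le> 2 * \<eta> * W + B * V" .
  qed
  also have "\<dots> = (2 * \<eta> * W + B * V) * h ^ CARD('d)"
    using \<open>0 < h\<close> by (simp add: set_integral_const_grid_cell)
  finally show ?thesis .
qed

subsection \<open>The total quadrature error\<close>

lemma fd_weight_nonneg: "0 \<le> fd_weight \<alpha> lam \<gamma> \<xi>"
  by (simp add: fd_weight_def)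

lemma fd_weight_le:
  "0 \<le> lam \<Longrightarrow> fd_weight \<alpha> lam \<gamma> (\<xi> :: real^'d::finite) \<le> norm \<xi> powr (\<gamma> - \<alpha> - real CARD('d))"
  using mult_right_mono[of "exp (- lam * norm \<xi>)" 1 "norm \<xi> powr (\<gamma> - (real CARD('d) + \<alpha>))"]
  by (simp add: fd_weight_def algebra_simps)

lemma fd_weight_measurable [measurable]: "fd_weight \<alpha> lam \<gamma> \<in> borel_measurable borel"
  unfolding fd_weight_def by measurable

text \<open>The exponent of the bound on \<open>f\<close> is written so that the product with the
  weight has order \<open>q - d\<close>, which is integrable at the origin since
  \<open>q > 0\<close>.\<close>

lemma set_integrable_weighted:
  fixes f :: "real^'d::finite \<Rightarrow> real"
  assumes "0 \<le> lam" "0 < q" "0 \<le> A" and [measurable]: "f \<in> borel_measurable borel"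
    and f: "\<And>\<xi>. \<bar>f \<xi>\<bar> \<le> A * norm \<xi> powr (q + \<alpha> - \<gamma>)"
    and S: "S \<subseteq> cbox 0 (\<chi> i. L)" "S \<in> sets borel"
  shows "set_integrable lborel S (\<lambda>\<xi>. f \<xi> * fd_weight \<alpha> lam \<gamma> \<xi>)"
    and "\<bar>f \<xi> * fd_weight \<alpha> lam \<gamma> \<xi>\<bar> \<le> A * norm \<xi> powr (q - real CARD('d))"
proof -
  show bound: "\<bar>f \<xi> * fd_weight \<alpha> lam \<gamma> \<xi>\<bar> \<le> A * norm \<xi> powr (q - real CARD('d))" for \<xi>
  proof -
    have "\<bar>f \<xi> * fd_weight \<alpha> lam \<gamma> \<xi>\<bar> \<le>
        (A * norm \<xi> powr (q + \<alpha> - \<gamma>)) * norm \<xi> powr (\<gamma> - \<alpha> - real CARD('d))"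
      unfolding abs_mult using f[of \<xi>] fd_weight_le[OF \<open>0 \<le> lam\<close>, of \<alpha> \<gamma> \<xi>] fd_weight_nonneg[of \<alpha> lam \<gamma> \<xi>]
      by (intro mult_mono) auto
    also have "\<dots> = A * (norm \<xi> powr (q + \<alpha> - \<gamma>) * norm \<xi> powr (\<gamma> - \<alpha> - real CARD('d)))"
      by simp
    also have "norm \<xi> powr (q + \<alpha> - \<gamma>) * norm \<xi> powr (\<gamma> - \<alpha> - real CARD('d)) = norm \<xi> powr (q - real CARD('d))"
      unfolding powr_add[symmetric] by (rule arg_cong[where f = "\<lambda>x. norm \<xi> powr x"]) simp
    finally show ?thesis .
  qed
  obtain C where "\<forall>L>0. set_integrable lborel (cbox 0 (\<chi> i. L)) (\<lambda>\<xi> :: real^'d. norm \<xi> powr (q - real CARD('d)))"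
    using norm_powr_near_zero[OF \<open>0 < q\<close>, where 'd = 'd] by blast
  then have int: "set_integrable lborel (cbox 0 (\<chi> i. \<bar>L\<bar> + 1)) (\<lambda>\<xi> :: real^'d. norm \<xi> powr (q - real CARD('d)))"
    by simp
  have sub: "cbox 0 (\<chi> i. L) \<subseteq> (cbox 0 (\<chi> i. \<bar>L\<bar> + 1) :: (real^'d) set)"
  proof -
    have "t \<le> L \<Longrightarrow> t \<le> \<bar>L\<bar> + 1" for t by linarith
    then show ?thesis by (auto simp: mem_box_cart)
  qed
  have "set_integrable lborel S (\<lambda>\<xi> :: real^'d. norm \<xi> powr (q - real CARD('d)))"
    using set_integrable_subset[OF int _ order_trans[OF S(1) sub]] S(2) by simp
  then have "set_integrable lborel S (\<lambda>\<xi>. A * norm \<xi> powr (q - real CARD('d)))"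
    by (rule set_integrable_mult_right)
  then show "set_integrable lborel S (\<lambda>\<xi>. f \<xi> * fd_weight \<alpha> lam \<gamma> \<xi>)"
    by (rule set_integrable_bound)
      (use bound S assms in \<open>auto simp: set_borel_measurable_def intro!: AE_I2 order_trans[OF _ abs_ge_self]\<close>)
qed

lemma set_integrable_fd_weight:
  assumes "0 \<le> lam" "\<alpha> < \<gamma>" and S: "S \<subseteq> cbox 0 (\<chi> i. L)" "S \<in> sets borel"
  shows "set_integrable lborel S (fd_weight \<alpha> lam \<gamma> :: real^'d::finite \<Rightarrow> real)"
proof -
  \<comment> \<open>The constant \<open>1\<close> violates the bound below at the origin, since \<open>0 powr 0 = 0\<close>.\<close>
  have "AE \<xi> :: real^'d in lborel. \<xi> \<noteq> 0" by (rule AE_lborel_singleton)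
  moreover have "set_integrable lborel S (\<lambda>\<xi> :: real^'d. indicator (- {0}) \<xi> * fd_weight \<alpha> lam \<gamma> \<xi>)"
    by (rule set_integrable_weighted(1)[where A = 1 and q = "\<gamma> - \<alpha>" and L = L])
      (use assms in \<open>auto simp: indicator_def\<close>)
  ultimately show ?thesis
    using S by (subst set_integrable_cong_AE[where g = "\<lambda>\<xi>. indicator (- {0}) \<xi> * fd_weight \<alpha> lam \<gamma> \<xi>"])
      (auto simp: indicator_def)
qed

lemma grid_cell_subset_cbox:
  fixes k :: "nat^'d::finite"
  assumes "0 \<le> h"
  shows "\<exists>L. grid_cell h k \<subseteq> cbox 0 (\<chi> i. L)"
proof (intro exI[of _ "h * (real (\<Sum>j\<in>UNIV. k $ j) + 1)"] subsetI)
  fix \<xi> assume \<xi>: "\<xi> \<in> grid_cell h k"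
  have "0 \<le> \<xi> $ i \<and> \<xi> $ i \<le> h * (real (\<Sum>j\<in>UNIV. k $ j) + 1)" for i
  proof -
    have "h * (real (k $ i) + 1) \<le> h * (real (\<Sum>j\<in>UNIV. k $ j) + 1)"
      using assms member_le_sum[of i UNIV "vec_nth k"] by (intro mult_left_mono add_right_mono) (auto simp del: of_nat_sum)
    moreover have "0 \<le> h * real (k $ i)" using assms by simp
    ultimately show ?thesis using \<xi>[unfolded grid_cell_iff, rule_format, of i] by linarith
  qed
  then show "\<xi> \<in> cbox 0 (\<chi> i. h * (real (\<Sum>j\<in>UNIV. k $ j) + 1))"
    by (simp add: mem_box_cart)
qed

lemma grid_cell_0: "grid_cell h 0 = cbox 0 (\<chi> i. h)"
  by (auto simp: grid_cell_iff mem_box_cart)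

lemma grid_cell_subset_near_infinity:
  "0 < h \<Longrightarrow> k \<noteq> 0 \<Longrightarrow> grid_cell h k \<subseteq> {\<xi> :: real^'d::finite. h \<le> norm \<xi>}"
  using cell_geometry(1) by blast

lemma set_integrable_norm_powr_cell:
  assumes "0 < h" "k \<noteq> 0"
  shows "set_integrable lborel (grid_cell h k) (\<lambda>\<xi> :: real^'d::finite. norm \<xi> powr q)"
proof -
  have "continuous_on (grid_cell h k) (\<lambda>\<xi> :: real^'d. norm \<xi> powr q)"
    using cell_geometry(1)[OF assms] assms by (intro continuous_intros) (force dest: order.trans)
  then show ?thesis
    unfolding set_integrable_def grid_cell_def by (intro borel_integrable_compact) auto
qed

text \<open>The first summand stems from the remainder of the expansion, the second from the
  oscillation of the weight. The final factor \<open>D powr \<bar>q\<bar>\<close> passes from the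
  norm at the center to the integral over the cell. Neither \<open>h\<close>, the cell nor
  \<open>lam\<close> enters.\<close>

definition profile_cell_const :: "nat \<Rightarrow> real \<Rightarrow> real \<Rightarrow> real \<Rightarrow> real \<Rightarrow> real" where
  "profile_cell_const d \<theta> \<gamma> \<beta> q = (let D = 1 + real d in
     (2 * quotient_const D \<gamma> * D powr \<theta> * D powr \<bar>\<beta>\<bar> +
      quotient_const D \<gamma> * D * ((\<bar>\<beta>\<bar> + 1) * D powr \<bar>\<beta> - 1\<bar> * D) * D powr (2 - \<theta>)) * D powr \<bar>q\<bar>)"

lemma profile_cell_const_nonneg: "0 < \<gamma> \<Longrightarrow> 0 \<le> profile_cell_const d \<theta> \<gamma> \<beta> q"
  using quotient_const_ge_1[of \<gamma> "1 + real d"] by (simp add: profile_cell_const_def Let_def)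

text \<open>The expansion is taken at the center of the cell. Since the norm is comparable with its
  value \<open>a\<close> there, \<open>h ^ d * a powr q\<close> is at most a multiple of the
  integral of \<open>norm \<xi> powr q\<close> over the cell; in this form the bounds of different
  cells add up to one integral.\<close>

lemma cell_error_profile:
  fixes \<psi> :: "real^'d::finite \<Rightarrow> real"
  assumes \<psi>: "holder_profile A p \<theta> \<psi>" "\<psi> \<in> borel_measurable borel" "0 \<le> A" and \<theta>: "0 \<le> \<theta>" "\<theta> \<le> 2"
    and par: "0 < \<gamma>" "\<alpha> < \<gamma>" "\<alpha> < p" "0 \<le> lam" and h: "0 < h" and k: "k \<noteq> 0"
  defines "q \<equiv> p - \<theta> - \<alpha> - real CARD('d)" and "\<beta> \<equiv> \<gamma> - (real CARD('d) + \<alpha>)"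
  shows "\<bar>cell_error h k (fd_weight \<alpha> lam \<gamma>) (\<lambda>\<xi>. \<psi> \<xi> * norm \<xi> powr (- \<gamma>))\<bar>
    \<le> profile_cell_const CARD('d) \<theta> \<gamma> \<beta> q * A * h powr \<theta> * (LINT \<xi> : grid_cell h k | lborel. norm \<xi> powr q)"
proof -
  let ?c = "cell_center h k :: real^'d"
  let ?I = "grid_cell h k :: (real^'d) set"
  let ?w = "fd_weight \<alpha> lam \<gamma> :: real^'d \<Rightarrow> real"
  define a where "a = norm ?c"
  define D where "D = 1 + real CARD('d)"
  have D: "2 \<le> D" using zero_less_card_finite[where 'a='d] unfolding D_def by linarith
  define M where "M = quotient_const D \<gamma>"
  have M: "1 \<le> M" unfolding M_def by (rule quotient_const_ge_1[OF par(1)])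
  have geo: "h \<le> norm \<xi>" "norm (\<xi> - ?c) \<le> a" "a \<le> D * norm \<xi>" "norm (\<xi> - ?c) \<le> D * h"
    "norm \<xi> \<le> D * a" if "\<xi> \<in> ?I" for \<xi>
    using cell_geometry(1-5)[OF h k that] by (simp_all add: a_def D_def)
  have c_in: "?c \<in> ?I" using h by (auto simp: grid_cell_iff cell_center_def algebra_simps)
  have c0: "?c \<noteq> 0" using cell_geometry(6)[OF h k c_in] .
  have a: "0 < a" using c0 by (simp add: a_def)
  have ha: "h \<le> D * a" using geo(1,5)[OF c_in] by linarith
  obtain G where G: "linear G"
    "\<And>v. \<bar>G v\<bar> \<le> M * A * a powr (p - \<gamma> - 1) * norm v"
    "\<And>v. norm v \<le> a \<Longrightarrow> a \<le> D * norm (?c + v) \<Longrightarrow>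
      \<bar>\<psi> (?c + v) * norm (?c + v) powr (- \<gamma>) - \<psi> ?c * a powr (- \<gamma>) - G v\<bar>
        \<le> M * A * a powr (p - \<gamma> - \<theta>) * norm v powr \<theta>"
    using holder_profile_quotient[OF \<psi>(1,3) \<theta>(2) D par(1) c0] unfolding M_def a_def by blast
  define \<eta> where "\<eta> = M * A * a powr (p - \<gamma> - \<theta>) * (D * h) powr \<theta>"
  define B where "B = M * A * a powr (p - \<gamma> - 1) * (D * h)"
  define W where "W = D powr \<bar>\<beta>\<bar> * a powr \<beta>"
  define V where "V = (\<bar>\<beta>\<bar> + 1) * D powr \<bar>\<beta> - 1\<bar> * a powr (\<beta> - 1) * (D * h)"
  obtain L where L: "?I \<subseteq> cbox 0 (\<chi> i. L)" using grid_cell_subset_cbox[of h k] h by auto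
  define X where "X = M * D * ((\<bar>\<beta>\<bar> + 1) * D powr \<bar>\<beta> - 1\<bar> * D)"
  define Z where "Z = 2 * M * D powr \<theta> * D powr \<bar>\<beta>\<bar> + X * D powr (2 - \<theta>)"
  have X: "0 \<le> X" and Z: "0 \<le> Z" using M D by (simp_all add: X_def Z_def)
  have "\<bar>cell_error h k ?w (\<lambda>\<xi>. \<psi> \<xi> * norm \<xi> powr (- \<gamma>))\<bar> \<le> (2 * \<eta> * W + B * V) * h ^ CARD('d)"
  proof (rule cell_error_bound[OF h G(1), where ?f0.0 = "\<psi> ?c * a powr (- \<gamma>)" and ?w0.0 = "?w ?c"])
    fix \<xi> assume \<xi>: "\<xi> \<in> ?I"
    note g = geo[OF \<xi>]
    have "\<bar>\<psi> \<xi> * norm \<xi> powr (- \<gamma>) - \<psi> ?c * a powr (- \<gamma>) - G (\<xi> - ?c)\<bar>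
        \<le> M * A * a powr (p - \<gamma> - \<theta>) * norm (\<xi> - ?c) powr \<theta>"
      using G(3)[of "\<xi> - ?c"] g by simp
    also have "\<dots> \<le> \<eta>"
      unfolding \<eta>_def using g M \<psi> \<theta> by (intro mult_left_mono powr_mono2) auto
    finally show "\<bar>\<psi> \<xi> * norm \<xi> powr (- \<gamma>) - \<psi> ?c * a powr (- \<gamma>) - G (\<xi> - ?c)\<bar> \<le> \<eta>" .
    show "\<bar>G (\<xi> - ?c)\<bar> \<le> B"
      by (rule order_trans[OF G(2)]) (use g M \<psi> in \<open>auto simp: B_def intro!: mult_left_mono\<close>)
    have "?w \<xi> \<le> norm \<xi> powr \<beta>"
      using fd_weight_le[OF par(4), of \<alpha> \<gamma> \<xi>] by (simp add: \<beta>_def algebra_simps)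
    also have "\<dots> \<le> W" unfolding W_def using g D a by (intro powr_comparable) auto
    finally show "\<bar>?w \<xi>\<bar> \<le> W" using fd_weight_nonneg[of \<alpha> lam \<gamma> \<xi>] by simp
    have "\<bar>?w \<xi> - ?w ?c\<bar> \<le> (\<bar>\<beta>\<bar> + 1) * D powr \<bar>\<beta> - 1\<bar> * a powr (\<beta> - 1) * \<bar>norm \<xi> - a\<bar>"
      unfolding fd_weight_def \<beta>_def[symmetric] a_def[symmetric]
    proof (rule exp_powr_lipschitz)
      show "a \<le> D * a" using D a by simp
    qed (use g D a par in auto)
    also have "\<dots> \<le> V"
      unfolding V_def using g norm_triangle_ineq3[of \<xi> ?c]
      by (intro mult_left_mono) (auto simp: a_def)
    finally show "\<bar>?w \<xi> - ?w ?c\<bar> \<le> V" .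
  next
    have "\<bar>\<psi> \<xi>\<bar> \<le> A * norm \<xi> powr p" for \<xi> using \<psi>(1) unfolding holder_profile_def by blast
    then have "\<bar>\<psi> \<xi> * norm \<xi> powr (- \<gamma>)\<bar> \<le> A * norm \<xi> powr p * norm \<xi> powr (- \<gamma>)" for \<xi>
      by (simp add: abs_mult mult_right_mono)
    then have b: "\<bar>\<psi> \<xi> * norm \<xi> powr (- \<gamma>)\<bar> \<le> A * norm \<xi> powr ((p - \<alpha>) + \<alpha> - \<gamma>)" for \<xi>
      by (simp add: powr_add[symmetric] mult.assoc)
    show "set_integrable lborel ?I (\<lambda>\<xi>. \<psi> \<xi> * norm \<xi> powr (- \<gamma>) * ?w \<xi>)"
      by (rule set_integrable_weighted(1)[OF par(4) _ \<psi>(3) _ b L]) (use par \<psi>(2) in auto)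
    show "set_integrable lborel ?I ?w"
      using set_integrable_fd_weight[OF par(4,2) L] by simp
  qed
  also have "2 * \<eta> * W + B * V \<le> Z * (A * h powr \<theta> * a powr q)"
  proof -
    have q1: "a powr (p - \<gamma> - \<theta>) * a powr \<beta> = a powr q"
      unfolding powr_add[symmetric] q_def \<beta>_def by (rule arg_cong[where f = "\<lambda>x. a powr x"]) simp
    have q2: "a powr (p - \<gamma> - 1) * a powr (\<beta> - 1) * a powr (2 - \<theta>) = a powr q"
      unfolding powr_add[symmetric] q_def \<beta>_def by (rule arg_cong[where f = "\<lambda>x. a powr x"]) simp
    have "2 * \<eta> * W = 2 * M * D powr \<theta> * D powr \<bar>\<beta>\<bar> * (A * h powr \<theta> * (a powr (p - \<gamma> - \<theta>) * a powr \<beta>))"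
      using D h by (simp add: \<eta>_def W_def powr_mult)
    then have 1: "2 * \<eta> * W = 2 * M * D powr \<theta> * D powr \<bar>\<beta>\<bar> * (A * h powr \<theta> * a powr q)"
      unfolding q1 .
    \<comment> \<open>The oscillation term is of second order in \<open>h\<close>, possibly more
      than is asked for. The surplus \<open>h powr (2 - \<theta>)\<close> is traded for a power of
      \<open>a\<close>, using \<open>h \<le> D * a\<close>.\<close>
    have "h * h = h powr \<theta> * h powr (2 - \<theta>)"
      unfolding powr_add[symmetric] using h powr_realpow[of h 2] by (simp add: power2_eq_square)
    also have "\<dots> \<le> h powr \<theta> * (D * a) powr (2 - \<theta>)"
      using ha h \<theta> by (intro mult_left_mono powr_mono2) auto
    also have "\<dots> = D powr (2 - \<theta>) * (h powr \<theta> * a powr (2 - \<theta>))"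
      using D a by (simp add: powr_mult)
    finally have hh: "h * h \<le> D powr (2 - \<theta>) * (h powr \<theta> * a powr (2 - \<theta>))" .
    have "B * V = X * A * (a powr (p - \<gamma> - 1) * a powr (\<beta> - 1)) * (h * h)"
      by (simp add: B_def V_def X_def)
    also have "\<dots> \<le> X * A * (a powr (p - \<gamma> - 1) * a powr (\<beta> - 1)) *
        (D powr (2 - \<theta>) * (h powr \<theta> * a powr (2 - \<theta>)))"
      using X \<psi>(3) hh by (intro mult_left_mono) auto
    also have "\<dots> = X * D powr (2 - \<theta>) * (A * h powr \<theta> * (a powr (p - \<gamma> - 1) * a powr (\<beta> - 1) * a powr (2 - \<theta>)))"
      by simp
    finally have 2: "B * V \<le> X * D powr (2 - \<theta>) * (A * h powr \<theta> * a powr q)"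
      unfolding q2 .
    show ?thesis
      unfolding Z_def distrib_right using 1 2 by linarith
  qed
  also have "h ^ CARD('d) * a powr q \<le> D powr \<bar>q\<bar> * (LINT \<xi> : ?I | lborel. norm \<xi> powr q)"
  proof -
    have "(LINT \<xi> : ?I | lborel. a powr q) \<le> (LINT \<xi> : ?I | lborel. D powr \<bar>q\<bar> * norm \<xi> powr q)"
    proof (rule set_integral_mono)
      show "a powr q \<le> D powr \<bar>q\<bar> * norm \<xi> powr q" if "\<xi> \<in> ?I" for \<xi>
        using geo[OF that] D h by (intro powr_comparable) auto
    qed (intro set_integrable_mult_right set_integrable_norm_powr_cell h k set_integrable_const_grid_cell)+
    then show ?thesis using h by (simp add: set_integral_const_grid_cell mult.commute)
  qed
  from mult_left_mono[OF this, of "Z * (A * h powr \<theta>)"]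
  have "Z * (A * h powr \<theta> * a powr q) * h ^ CARD('d) \<le>
      Z * (A * h powr \<theta>) * (D powr \<bar>q\<bar> * (LINT \<xi> : ?I | lborel. norm \<xi> powr q))" (is "_ \<le> ?r")
    using Z \<psi>(3) by (simp add: mult_ac)
  also have "?r = profile_cell_const CARD('d) \<theta> \<gamma> \<beta> q * A * h powr \<theta> * (LINT \<xi> : ?I | lborel. norm \<xi> powr q)"
    unfolding profile_cell_const_def Let_def D_def[symmetric] M_def[symmetric] X_def[symmetric] Z_def[symmetric] by simp
  finally show ?thesis using h by (simp add: mult_right_mono)
qed

definition origin_error :: "real \<Rightarrow> real \<Rightarrow> (real^'d::finite \<Rightarrow> real) \<Rightarrow> (real^'d \<Rightarrow> real) \<Rightarrow> real" where
  "origin_error h \<gamma> w f = (LINT \<xi> : grid_cell h 0 | lborel. f \<xi> * w \<xi>) -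
     1 / 2 ^ CARD('d) * (\<Sum>n\<in>multi_indices 2 - {0}. fd_coeff \<gamma> n * f (grid_point h n)) *
       (LINT \<xi> : grid_cell h 0 | lborel. w \<xi>)"

definition quad_error :: "real \<Rightarrow> nat \<Rightarrow> real \<Rightarrow> (real^'d::finite \<Rightarrow> real) \<Rightarrow> (real^'d \<Rightarrow> real) \<Rightarrow> real" where
  "quad_error h N \<gamma> w f = origin_error h \<gamma> w f + (\<Sum>k\<in>multi_indices N - {0}. cell_error h k w f)"

section \<open>The cube as an almost disjoint union of grid cells\<close>

lemma AE_grid_cells_disjoint:
  fixes k k' :: "nat^'d::finite"
  assumes "0 < h" "k \<noteq> k'"
  shows "AE \<xi> in lborel. \<not> (\<xi> \<in> grid_cell h k \<and> \<xi> \<in> grid_cell h k')"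
proof -
  obtain i where i: "k $ i \<noteq> k' $ i" using assms by (auto simp: vec_eq_iff)
  define m where "m = max (k $ i) (k' $ i)"
  \<comment> \<open>Closed cells may share a face; in a coordinate where the indices differ it lies
    at the larger index, hence in a hyperplane.\<close>
  have "\<xi> \<in> grid_cell h k \<Longrightarrow> \<xi> \<in> grid_cell h k' \<Longrightarrow> \<xi> $ i = h * real m" for \<xi>
  proof -
    assume "\<xi> \<in> grid_cell h k" "\<xi> \<in> grid_cell h k'"
    then have b: "h * real (k $ i) \<le> \<xi> $ i" "\<xi> $ i \<le> h * (real (k $ i) + 1)"
      "h * real (k' $ i) \<le> \<xi> $ i" "\<xi> $ i \<le> h * (real (k' $ i) + 1)"
      by (auto simp: grid_cell_iff)
    show ?thesis
    proof (cases "k $ i < k' $ i")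
      case True
      then have "h * (real (k $ i) + 1) \<le> h * real (k' $ i)" using assms by (intro mult_left_mono) auto
      with b True show ?thesis by (simp add: m_def max_def)
    next
      case False
      then have "h * (real (k' $ i) + 1) \<le> h * real (k $ i)" using assms i by (intro mult_left_mono) auto
      with b False i show ?thesis by (simp add: m_def max_def)
    qed
  qed
  then show ?thesis
    by (intro eventually_mono[OF AE_cart_neq[of "\<lambda>_. h * real m"]]) blast
qed

lemma set_integral_grid_cells:
  fixes f :: "real^'d::finite \<Rightarrow> real"
  assumes "0 < h" "finite K" "\<And>k. k \<in> K \<Longrightarrow> set_integrable lborel (grid_cell h k) f"
  shows "(LINT \<xi> : (\<Union>k\<in>K. grid_cell h k) | lborel. f \<xi>) = (\<Sum>k\<in>K. LINT \<xi> : grid_cell h k | lborel. f \<xi>)"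
proof (rule set_integral_finite_UN_AE[OF assms(2)])
  show "AE \<xi> in lborel. \<xi> \<in> grid_cell h i \<and> \<xi> \<in> grid_cell h j \<longrightarrow> i = j" for i j :: "nat^'d"
    using AE_grid_cells_disjoint[OF assms(1), of i j] by (cases "i = j") auto
qed (use assms in auto)

lemma union_grid_cells:
  assumes "0 < L" "1 \<le> N"
  shows "(\<Union>k\<in>multi_indices N. grid_cell (L / real N) k) = (cbox 0 (\<chi> i. L) :: (real^'d::finite) set)"
proof (intro equalityI subsetI)
  define h where "h = L / real N"
  have h: "0 < h" "h * real N = L" using assms by (simp_all add: h_def)
  fix \<xi> :: "real^'d"
  {
    assume "\<xi> \<in> (\<Union>k\<in>multi_indices N. grid_cell (L / real N) k)"
    then obtain k where k: "k \<in> multi_indices N" "\<xi> \<in> grid_cell h k" by (auto simp: h_def)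
    have "0 \<le> \<xi> $ i \<and> \<xi> $ i \<le> L" for i
    proof -
      have "k $ i < N" using k by (simp add: multi_indices_def)
      then have "h * (real (k $ i) + 1) \<le> h * real N" using h by (intro mult_left_mono) auto
      moreover have "0 \<le> h * real (k $ i)" using h by simp
      ultimately show ?thesis using k(2)[unfolded grid_cell_iff, rule_format, of i] h(2) by linarith
    qed
    then show "\<xi> \<in> cbox 0 (\<chi> i. L)" by (simp add: mem_box_cart)
  next
    assume "\<xi> \<in> cbox 0 (\<chi> i. L)"
    then have \<xi>: "0 \<le> \<xi> $ i" "\<xi> $ i \<le> L" for i by (auto simp: mem_box_cart)
    \<comment> \<open>The minimum with \<open>N - 1\<close> puts the outer face, where the floor
      would be \<open>N\<close>, into the last cell.\<close>
    define k where "k = (\<chi> i. min (nat \<lfloor>\<xi> $ i / h\<rfloor>) (N - 1))"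
    have "h * real (k $ i) \<le> \<xi> $ i \<and> \<xi> $ i \<le> h * (real (k $ i) + 1)" for i
    proof -
      define t where "t = \<xi> $ i / h"
      have t: "0 \<le> t" "t \<le> real N" "\<xi> $ i = h * t"
        using \<xi>[of i] h by (auto simp: t_def divide_le_eq mult.commute)
      have k: "k $ i = min (nat \<lfloor>t\<rfloor>) (N - 1)" by (simp add: k_def t_def)
      have fl: "real (nat \<lfloor>t\<rfloor>) \<le> t" "t \<le> real (nat \<lfloor>t\<rfloor>) + 1" using t(1) by linarith+
      have "real (k $ i) \<le> t" using fl(1) unfolding k by linarith
      moreover have "t \<le> real (k $ i) + 1"
      proof (cases "nat \<lfloor>t\<rfloor> \<le> N - 1")
        case True
        then show ?thesis using fl(2) by (simp add: k)
      next
        case False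
        then show ?thesis using t(2) assms(2) by (simp add: k of_nat_diff)
      qed
      ultimately show ?thesis using h(1) unfolding t(3) by (simp add: mult_left_mono)
    qed
    then have "\<xi> \<in> grid_cell h k" by (simp add: grid_cell_iff)
    moreover have "k \<in> multi_indices N" using assms(2) by (auto simp: k_def multi_indices_def)
    ultimately show "\<xi> \<in> (\<Union>k\<in>multi_indices N. grid_cell (L / real N) k)" by (auto simp: h_def)
  }
qed

lemma sum_cells_le:
  fixes K :: "(nat^'d::finite) set"
  assumes "0 < h" "finite K" and S: "\<And>k. k \<in> K \<Longrightarrow> grid_cell h k \<subseteq> S"
    and int: "set_integrable lborel S f" and f: "\<And>\<xi>. 0 \<le> f \<xi>"
  shows "(\<Sum>k\<in>K. LINT \<xi> : grid_cell h k | lborel. f \<xi>) \<le> (LINT \<xi> : S | lborel. f \<xi> :: real)"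
proof -
  have sub: "(\<Union>k\<in>K. grid_cell h k) \<subseteq> S" using S by blast
  have U: "(\<Union>k\<in>K. grid_cell h k) \<in> sets borel" using \<open>finite K\<close> by auto
  have "(\<Sum>k\<in>K. LINT \<xi> : grid_cell h k | lborel. f \<xi>) = (LINT \<xi> : (\<Union>k\<in>K. grid_cell h k) | lborel. f \<xi>)"
    using S by (intro set_integral_grid_cells[symmetric] assms set_integrable_subset[OF int]) auto
  also have "\<dots> \<le> (LINT \<xi> : S | lborel. f \<xi>)"
    using set_integrable_subset[OF int _ sub] U int sub f
    unfolding set_lebesgue_integral_def set_integrable_def
    by (intro integral_mono) (auto simp: indicator_def)
  finally show ?thesis .
qed

section \<open>The error on the origin cell\<close>

lemma fd_coeff_bounds: "0 \<le> fd_coeff \<gamma> n" "fd_coeff \<gamma> (n :: nat^'d::finite) \<le> 2 ^ CARD('d)"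
proof -
  have "2 ^ CARD('d) / real CARD('d) \<le> 2 ^ CARD('d) / 1"
    by (intro divide_left_mono) (simp_all add: Suc_leI)
  then show "fd_coeff \<gamma> n \<le> 2 ^ CARD('d)" by (simp add: fd_coeff_def)
qed (simp add: fd_coeff_def)

lemma grid_point_norm:
  fixes n :: "nat^'d::finite"
  assumes "0 < h" "n \<in> multi_indices 2" "n \<noteq> 0"
  shows "h \<le> norm (grid_point h n :: real^'d)" "norm (grid_point h n :: real^'d) \<le> (1 + real CARD('d)) * h"
proof -
  have n: "n $ i = 0 \<or> n $ i = 1" for i using assms(2) by (simp add: multi_indices_2)
  have le: "\<bar>(grid_point h n :: real^'d) $ i\<bar> \<le> h" for i
    using n[of i] assms(1) by (elim disjE) (simp_all add: grid_point_def)
  obtain j where "n $ j \<noteq> 0" using assms(3) by (auto simp: vec_eq_iff)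
  then have "h * 1 \<le> h * real (n $ j)" using assms(1) by (intro mult_left_mono) auto
  then show "h \<le> norm (grid_point h n :: real^'d)"
    using component_le_norm_cart[of "grid_point h n :: real^'d" j] by (simp add: grid_point_def)
  have "norm (grid_point h n :: real^'d) \<le> (\<Sum>i\<in>UNIV. \<bar>(grid_point h n :: real^'d) $ i\<bar>)" by (rule norm_le_l1_cart)
  also have "\<dots> \<le> (\<Sum>i\<in>(UNIV::'d set). h)" by (intro sum_mono le)
  finally show "norm (grid_point h n :: real^'d) \<le> (1 + real CARD('d)) * h" using assms(1) by (simp add: algebra_simps)
qed

lemma holder_profile_quotient_le:
  assumes "holder_profile A p \<theta> \<psi>"
  shows "\<bar>\<psi> \<xi> * norm \<xi> powr (- \<gamma>)\<bar> \<le> A * norm \<xi> powr (p - \<gamma>)"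
proof -
  have "\<bar>\<psi> \<xi>\<bar> \<le> A * norm \<xi> powr p" using assms unfolding holder_profile_def by blast
  then have "\<bar>\<psi> \<xi> * norm \<xi> powr (- \<gamma>)\<bar> \<le> A * norm \<xi> powr p * norm \<xi> powr (- \<gamma>)"
    by (simp add: abs_mult mult_right_mono)
  also have "\<dots> = A * (norm \<xi> powr p * norm \<xi> powr (- \<gamma>))" by simp
  also have "norm \<xi> powr p * norm \<xi> powr (- \<gamma>) = norm \<xi> powr (p - \<gamma>)"
    unfolding powr_add[symmetric] by simp
  finally show ?thesis .
qed

text \<open>No cancellation is used. The integral has order p - \<alpha> because the weighted
  quotient is bounded by a multiple of \<open>norm \<xi> powr (p - \<alpha> - d)\<close>; the rule
  has the same order because the quotient is of order p - \<gamma> at the corners and the weight has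
  an integral of order \<gamma> - \<alpha>.\<close>

lemma origin_error_profile:
  assumes par: "0 < \<gamma>" "\<alpha> < \<gamma>" "\<alpha> < p" "0 \<le> lam"
  shows "\<exists>C\<ge>0. \<forall>A\<ge>0. \<forall>\<psi> :: real^'d::finite \<Rightarrow> real. \<forall>h>0.
      holder_profile A p \<theta> \<psi> \<longrightarrow> \<psi> \<in> borel_measurable borel \<longrightarrow>
      \<bar>origin_error h \<gamma> (fd_weight \<alpha> lam \<gamma>) (\<lambda>\<xi>. \<psi> \<xi> * norm \<xi> powr (- \<gamma>))\<bar> \<le> C * A * h powr (p - \<alpha>)"
proof -
  let ?w = "fd_weight \<alpha> lam \<gamma> :: real^'d \<Rightarrow> real"
  let ?D = "1 + real CARD('d)"
  obtain C1 where C1: "0 \<le> C1" "\<And>L. 0 < L \<Longrightarrow> set_integrable lborel (cbox 0 (\<chi> i. L)) (\<lambda>\<xi> :: real^'d. norm \<xi> powr (p - \<alpha> - real CARD('d)))"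
    "\<And>L. 0 < L \<Longrightarrow> (LINT \<xi> : cbox 0 (\<chi> i. L) | lborel. norm (\<xi> :: real^'d) powr (p - \<alpha> - real CARD('d))) \<le> C1 * L powr (p - \<alpha>)"
    using norm_powr_near_zero[of "p - \<alpha>", where 'd = 'd] par by auto
  obtain C2 where C2: "0 \<le> C2" "\<And>L. 0 < L \<Longrightarrow> set_integrable lborel (cbox 0 (\<chi> i. L)) (\<lambda>\<xi> :: real^'d. norm \<xi> powr (\<gamma> - \<alpha> - real CARD('d)))"
    "\<And>L. 0 < L \<Longrightarrow> (LINT \<xi> : cbox 0 (\<chi> i. L) | lborel. norm (\<xi> :: real^'d) powr (\<gamma> - \<alpha> - real CARD('d))) \<le> C2 * L powr (\<gamma> - \<alpha>)"
    using norm_powr_near_zero[of "\<gamma> - \<alpha>", where 'd = 'd] par by auto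
  define E where "E = 2 ^ CARD('d) * ?D powr \<bar>p - \<gamma>\<bar>"
  have E: "0 \<le> E" by (simp add: E_def)
  have "\<bar>origin_error h \<gamma> ?w (\<lambda>\<xi>. \<psi> \<xi> * norm \<xi> powr (- \<gamma>))\<bar> \<le> (C1 + E * C2) * A * h powr (p - \<alpha>)"
    if A: "0 \<le> A" and h: "0 < h" and \<psi>: "holder_profile A p \<theta> \<psi>" "\<psi> \<in> borel_measurable borel" for A h \<psi>
  proof -
    let ?f = "\<lambda>\<xi>. \<psi> \<xi> * norm \<xi> powr (- \<gamma>)"
    let ?I = "grid_cell h 0 :: (real^'d) set"
    note f = holder_profile_quotient_le[OF \<psi>(1), of _ \<gamma>]
    have f': "\<bar>?f \<xi>\<bar> \<le> A * norm \<xi> powr ((p - \<alpha>) + \<alpha> - \<gamma>)" for \<xi> using f[of \<xi>] by simp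
    have I: "?I \<subseteq> cbox 0 (\<chi> i. h)" by (simp add: grid_cell_0)
    have q: "0 < p - \<alpha>" using par by simp
    have m: "?f \<in> borel_measurable borel" using \<psi>(2) by measurable
    note int = set_integrable_weighted[OF par(4) q A m f']
    have "\<bar>LINT \<xi> : ?I | lborel. ?f \<xi> * ?w \<xi>\<bar> \<le> (LINT \<xi> : ?I | lborel. A * norm \<xi> powr (p - \<alpha> - real CARD('d)))"
      using int(1)[OF I] int(2)[OF I] C1(2)[OF h]
      by (intro set_integral_abs_le set_integrable_mult_right) (auto simp: grid_cell_0)
    also have "\<dots> \<le> A * (C1 * h powr (p - \<alpha>))"
      using C1(3)[OF h] A by (simp add: grid_cell_0 mult_left_mono)
    finally have 1: "\<bar>LINT \<xi> : ?I | lborel. ?f \<xi> * ?w \<xi>\<bar> \<le> A * (C1 * h powr (p - \<alpha>))" .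
    have "\<bar>LINT \<xi> : ?I | lborel. ?w \<xi>\<bar> \<le> (LINT \<xi> : ?I | lborel. norm \<xi> powr (\<gamma> - \<alpha> - real CARD('d)))"
      using set_integrable_fd_weight[OF par(4,2) I] C2(2)[OF h] fd_weight_le[OF par(4), where 'd = 'd, of \<alpha> \<gamma>]
      by (intro set_integral_abs_le) (auto simp: grid_cell_0 fd_weight_nonneg)
    also have "\<dots> \<le> C2 * h powr (\<gamma> - \<alpha>)"
      using C2(3)[OF h] by (simp add: grid_cell_0)
    finally have 2: "\<bar>LINT \<xi> : ?I | lborel. ?w \<xi>\<bar> \<le> C2 * h powr (\<gamma> - \<alpha>)" .
    have "\<bar>\<Sum>n\<in>multi_indices 2 - {0}. fd_coeff \<gamma> n * ?f (grid_point h n)\<bar> \<le>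
        real (card (multi_indices 2 - {0} :: (nat^'d) set)) * (2 ^ CARD('d) * (A * (?D powr \<bar>p - \<gamma>\<bar> * h powr (p - \<gamma>))))"
    proof (rule abs_sum_mult_le)
      fix n :: "nat^'d" assume n: "n \<in> multi_indices 2 - {0}"
      show "\<bar>fd_coeff \<gamma> n\<bar> \<le> 2 ^ CARD('d)" using fd_coeff_bounds[of \<gamma> n] by simp
      have gp: "h \<le> norm (grid_point h n :: real^'d)" "norm (grid_point h n :: real^'d) \<le> ?D * h"
        using grid_point_norm[OF h, of n] n by auto
      have "norm (grid_point h n :: real^'d) \<le> ?D * norm (grid_point h n :: real^'d)"
        by (simp add: algebra_simps)
      then have "norm (grid_point h n :: real^'d) powr (p - \<gamma>) \<le> ?D powr \<bar>p - \<gamma>\<bar> * h powr (p - \<gamma>)"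
        using gp h by (intro powr_comparable) auto
      then show "\<bar>?f (grid_point h n)\<bar> \<le> A * (?D powr \<bar>p - \<gamma>\<bar> * h powr (p - \<gamma>))"
        using f[of "grid_point h n"] A by (meson mult_left_mono order_trans)
    qed
    also have "\<dots> \<le> 2 ^ CARD('d) * (2 ^ CARD('d) * (A * (?D powr \<bar>p - \<gamma>\<bar> * h powr (p - \<gamma>))))"
    proof -
      have "card (multi_indices 2 - {0} :: (nat^'d) set) \<le> 2 ^ CARD('d)"
        using card_mono[OF finite_multi_indices, of "multi_indices 2 - {0} :: (nat^'d) set" 2] by (simp add: card_multi_indices)
      then have "real (card (multi_indices 2 - {0} :: (nat^'d) set)) \<le> 2 ^ CARD('d)"
        by (metis of_nat_le_iff of_nat_numeral of_nat_power)
      then show ?thesis using A by (intro mult_right_mono) auto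
    qed
    finally have 3: "\<bar>1 / 2 ^ CARD('d) * (\<Sum>n\<in>multi_indices 2 - {0}. fd_coeff \<gamma> n * ?f (grid_point h n))\<bar> \<le> E * A * h powr (p - \<gamma>)"
      by (simp add: E_def abs_mult divide_le_eq mult_ac)
    have "\<bar>origin_error h \<gamma> ?w ?f\<bar> \<le> \<bar>LINT \<xi> : ?I | lborel. ?f \<xi> * ?w \<xi>\<bar> +
        \<bar>1 / 2 ^ CARD('d) * (\<Sum>n\<in>multi_indices 2 - {0}. fd_coeff \<gamma> n * ?f (grid_point h n))\<bar> * \<bar>LINT \<xi> : ?I | lborel. ?w \<xi>\<bar>"
      unfolding origin_error_def abs_mult[symmetric] by (rule abs_triangle_ineq4)
    also have "\<dots> \<le> A * (C1 * h powr (p - \<alpha>)) + (E * A * h powr (p - \<gamma>)) * (C2 * h powr (\<gamma> - \<alpha>))"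
      using 1 2 3 E A by (intro add_mono mult_mono) auto
    also have "(E * A * h powr (p - \<gamma>)) * (C2 * h powr (\<gamma> - \<alpha>)) = E * A * C2 * (h powr (p - \<gamma>) * h powr (\<gamma> - \<alpha>))"
      by simp
    also have "h powr (p - \<gamma>) * h powr (\<gamma> - \<alpha>) = h powr (p - \<alpha>)"
      unfolding powr_add[symmetric] by simp
    finally show ?thesis by (simp add: algebra_simps)
  qed
  moreover have "0 \<le> C1 + E * C2" using C1 C2 E by simp
  ultimately show ?thesis by blast
qed

text \<open>The region \<open>S\<close> is left open because \<open>q\<close> may lie on either side
  of - d: for \<open>q < - d\<close> the integral converges at infinity, and \<open>S\<close> is the
  complement of a ball; for \<open>q > - d\<close> it converges at the origin, and \<open>S\<close>
  is the cube.\<close>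

lemma sum_cell_errors_profile:
  fixes \<psi> :: "real^'d::finite \<Rightarrow> real"
  assumes \<psi>: "holder_profile A p \<theta> \<psi>" "\<psi> \<in> borel_measurable borel" "0 \<le> A" and \<theta>: "0 \<le> \<theta>" "\<theta> \<le> 2"
    and par: "0 < \<gamma>" "\<alpha> < \<gamma>" "\<alpha> < p" "0 \<le> lam" and h: "0 < h"
  defines "q \<equiv> p - \<theta> - \<alpha> - real CARD('d)" and "\<beta> \<equiv> \<gamma> - (real CARD('d) + \<alpha>)"
  assumes S: "\<And>k. k \<in> multi_indices N - {0} \<Longrightarrow> grid_cell h k \<subseteq> S" "set_integrable lborel S (\<lambda>\<xi> :: real^'d. norm \<xi> powr q)"
  shows "\<bar>\<Sum>k\<in>multi_indices N - {0}. cell_error h k (fd_weight \<alpha> lam \<gamma>) (\<lambda>\<xi>. \<psi> \<xi> * norm \<xi> powr (- \<gamma>))\<bar>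
    \<le> profile_cell_const CARD('d) \<theta> \<gamma> \<beta> q * A * h powr \<theta> * (LINT \<xi> : S | lborel. norm \<xi> powr q)"
proof -
  let ?K = "multi_indices N - {0} :: (nat^'d) set"
  let ?C = "profile_cell_const CARD('d) \<theta> \<gamma> \<beta> q * A * h powr \<theta>"
  have "\<bar>\<Sum>k\<in>?K. cell_error h k (fd_weight \<alpha> lam \<gamma>) (\<lambda>\<xi>. \<psi> \<xi> * norm \<xi> powr (- \<gamma>))\<bar>
    \<le> (\<Sum>k\<in>?K. ?C * (LINT \<xi> : grid_cell h k | lborel. norm \<xi> powr q))"
    unfolding q_def \<beta>_def
    by (intro order_trans[OF sum_abs] sum_mono cell_error_profile[OF \<psi> \<theta> par h]) auto
  also have "\<dots> = ?C * (\<Sum>k\<in>?K. LINT \<xi> : grid_cell h k | lborel. norm \<xi> powr q)"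
    by (simp add: sum_distrib_left)
  also have "\<dots> \<le> ?C * (LINT \<xi> : S | lborel. norm \<xi> powr q)"
    using profile_cell_const_nonneg[OF par(1), of "CARD('d)" \<theta> \<beta> q] \<psi>(3) S
    by (intro mult_left_mono sum_cells_le[OF h]) (auto simp: finite_multi_indices)
  finally show ?thesis .
qed

text \<open>Here \<open>q = - \<alpha> - d\<close>, and the region of integration extends to
  infinity, so that no relation between \<open>h\<close> and \<open>N\<close> is needed.\<close>

proposition quad_error_first_order:
  assumes par: "0 < \<alpha>" "\<alpha> < \<gamma>" "0 \<le> lam" and \<epsilon>: "0 < \<epsilon>" "\<alpha> + \<epsilon> \<le> 2"
  shows "\<exists>C\<ge>0. \<forall>A\<ge>0. \<forall>\<psi> :: real^'d::finite \<Rightarrow> real. \<forall>h>0. \<forall>N.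
      holder_profile A (\<alpha> + \<epsilon>) (\<alpha> + \<epsilon>) \<psi> \<longrightarrow> \<psi> \<in> borel_measurable borel \<longrightarrow>
      \<bar>quad_error h N \<gamma> (fd_weight \<alpha> lam \<gamma>) (\<lambda>\<xi>. \<psi> \<xi> * norm \<xi> powr (- \<gamma>))\<bar> \<le> C * A * h powr \<epsilon>"
proof -
  let ?p = "\<alpha> + \<epsilon>"
  have \<gamma>: "0 < \<gamma>" using par by simp
  have p: "\<alpha> < ?p" "0 \<le> ?p" using par \<epsilon> by simp_all
  obtain C1 where C1: "0 \<le> C1" "\<And>A \<psi> h. 0 \<le> A \<Longrightarrow> 0 < h \<Longrightarrow> holder_profile A ?p ?p (\<psi> :: real^'d \<Rightarrow> real) \<Longrightarrow>
      \<psi> \<in> borel_measurable borel \<Longrightarrow>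
      \<bar>origin_error h \<gamma> (fd_weight \<alpha> lam \<gamma>) (\<lambda>\<xi>. \<psi> \<xi> * norm \<xi> powr (- \<gamma>))\<bar> \<le> C1 * A * h powr (?p - \<alpha>)"
    using origin_error_profile[OF \<gamma> par(2) p(1) par(3), of ?p, where 'd = 'd] by auto
  obtain C2 where C2: "0 \<le> C2" "\<And>r. 0 < r \<Longrightarrow> set_integrable lborel {\<xi>. r \<le> norm \<xi>} (\<lambda>\<xi> :: real^'d. norm \<xi> powr (- \<alpha> - real CARD('d)))"
    "\<And>r. 0 < r \<Longrightarrow> (LINT \<xi> : {\<xi>. r \<le> norm \<xi>} | lborel. norm (\<xi> :: real^'d) powr (- \<alpha> - real CARD('d))) \<le> C2 * r powr (- \<alpha>)"
    using norm_powr_near_infinity[OF par(1), where 'd = 'd] by auto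
  define M where "M = profile_cell_const CARD('d) ?p \<gamma> (\<gamma> - (real CARD('d) + \<alpha>)) (- \<alpha> - real CARD('d))"
  have M: "0 \<le> M" unfolding M_def by (rule profile_cell_const_nonneg[OF \<gamma>])
  have "\<bar>quad_error h N \<gamma> (fd_weight \<alpha> lam \<gamma>) (\<lambda>\<xi>. \<psi> \<xi> * norm \<xi> powr (- \<gamma>))\<bar> \<le> (C1 + M * C2) * A * h powr \<epsilon>"
    if A: "0 \<le> A" and h: "0 < h" and \<psi>: "holder_profile A ?p ?p \<psi>" "\<psi> \<in> borel_measurable borel"
    for A h N and \<psi> :: "real^'d \<Rightarrow> real"
  proof -
    let ?f = "\<lambda>\<xi>. \<psi> \<xi> * norm \<xi> powr (- \<gamma>)"
    have cells: "grid_cell h k \<subseteq> {\<xi> :: real^'d. h \<le> norm \<xi>}" if "k \<in> multi_indices N - {0}" for k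
      using grid_cell_subset_near_infinity[OF h, of k] that by auto
    have "\<bar>\<Sum>k\<in>multi_indices N - {0}. cell_error h k (fd_weight \<alpha> lam \<gamma>) ?f\<bar>
        \<le> M * A * h powr ?p * (LINT \<xi> : {\<xi>. h \<le> norm \<xi>} | lborel. norm (\<xi> :: real^'d) powr (- \<alpha> - real CARD('d)))"
      using sum_cell_errors_profile[OF \<psi> A p(2) \<epsilon>(2) \<gamma> par(2) p(1) par(3) h, where S = "{\<xi>. h \<le> norm \<xi>}" and N = N, OF cells]
        C2(2)[OF h] by (simp add: M_def)
    also have "\<dots> \<le> M * A * h powr ?p * (C2 * h powr (- \<alpha>))"
      using C2(3)[OF h] M A by (intro mult_left_mono) auto
    also have "\<dots> = M * C2 * A * (h powr ?p * h powr (- \<alpha>))" by simp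
    also have "h powr ?p * h powr (- \<alpha>) = h powr \<epsilon>" unfolding powr_add[symmetric] by simp
    finally have "\<bar>\<Sum>k\<in>multi_indices N - {0}. cell_error h k (fd_weight \<alpha> lam \<gamma>) ?f\<bar> \<le> M * C2 * A * h powr \<epsilon>" .
    moreover have "\<bar>origin_error h \<gamma> (fd_weight \<alpha> lam \<gamma>) ?f\<bar> \<le> C1 * A * h powr \<epsilon>"
      using C1(2)[OF A h \<psi>] by simp
    ultimately show ?thesis
      unfolding quad_error_def distrib_right by linarith
  qed
  moreover have "0 \<le> C1 + M * C2" using C1 C2 M by simp
  ultimately show ?thesis by blast
qed

text \<open>Here \<open>q = \<epsilon> - d\<close>, integrable at the origin but not at infinity:
  all cells are compared with the fixed cube, and the constant depends on \<open>L\<close>. The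
  origin cell has the order 2 + \<epsilon>, reduced to 2 by \<open>h \<le> L\<close>.\<close>

proposition quad_error_second_order:
  assumes par: "0 < \<alpha>" "\<alpha> < 2" "0 \<le> lam" and \<epsilon>: "0 < \<epsilon>" and L: "0 < L"
  shows "\<exists>C\<ge>0. \<forall>A\<ge>0. \<forall>\<psi> :: real^'d::finite \<Rightarrow> real. \<forall>N\<ge>1.
      holder_profile A (2 + \<alpha> + \<epsilon>) 2 \<psi> \<longrightarrow> \<psi> \<in> borel_measurable borel \<longrightarrow>
      \<bar>quad_error (L / real N) N 2 (fd_weight \<alpha> lam 2) (\<lambda>\<xi>. \<psi> \<xi> * norm \<xi> powr (- 2))\<bar> \<le> C * A * (L / real N)\<^sup>2"
proof -
  let ?p = "2 + \<alpha> + \<epsilon>"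
  have p: "\<alpha> < ?p" using par \<epsilon> by simp
  obtain C1 where C1: "0 \<le> C1" "\<And>A \<psi> h. 0 \<le> A \<Longrightarrow> 0 < h \<Longrightarrow> holder_profile A ?p 2 (\<psi> :: real^'d \<Rightarrow> real) \<Longrightarrow>
      \<psi> \<in> borel_measurable borel \<Longrightarrow>
      \<bar>origin_error h 2 (fd_weight \<alpha> lam 2) (\<lambda>\<xi>. \<psi> \<xi> * norm \<xi> powr (- 2))\<bar> \<le> C1 * A * h powr (?p - \<alpha>)"
    using origin_error_profile[of 2 \<alpha> ?p lam 2, where 'd = 'd] par p by auto
  obtain C2 where C2: "0 \<le> C2" "set_integrable lborel (cbox 0 (\<chi> i. L)) (\<lambda>\<xi> :: real^'d. norm \<xi> powr (\<epsilon> - real CARD('d)))"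
    "(LINT \<xi> : cbox 0 (\<chi> i. L) | lborel. norm (\<xi> :: real^'d) powr (\<epsilon> - real CARD('d))) \<le> C2 * L powr \<epsilon>"
    using norm_powr_near_zero[OF \<epsilon>, where 'd = 'd] L by auto
  define M where "M = profile_cell_const CARD('d) 2 2 (2 - (real CARD('d) + \<alpha>)) (\<epsilon> - real CARD('d))"
  have M: "0 \<le> M" unfolding M_def by (rule profile_cell_const_nonneg) simp
  have "\<bar>quad_error (L / real N) N 2 (fd_weight \<alpha> lam 2) (\<lambda>\<xi>. \<psi> \<xi> * norm \<xi> powr (- 2))\<bar>
      \<le> ((C1 + M * C2) * L powr \<epsilon>) * A * (L / real N)\<^sup>2"
    if A: "0 \<le> A" and N: "1 \<le> N" and \<psi>: "holder_profile A ?p 2 \<psi>" "\<psi> \<in> borel_measurable borel"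
    for A N and \<psi> :: "real^'d \<Rightarrow> real"
  proof -
    let ?f = "\<lambda>\<xi>. \<psi> \<xi> * norm \<xi> powr (- 2)"
    define h where "h = L / real N"
    have h: "0 < h" "h \<le> L" using L N by (auto simp: h_def field_simps)
    have h2: "h powr 2 = h\<^sup>2" using h by (simp add: powr_realpow)
    have cells: "grid_cell h k \<subseteq> cbox 0 (\<chi> i. L)" if "k \<in> multi_indices N - {0}" for k :: "nat^'d"
      unfolding union_grid_cells[OF L N, symmetric] h_def[symmetric] using that by blast
    have q: "?p - 2 - \<alpha> - real CARD('d) = \<epsilon> - real CARD('d)" by simp
    have "\<bar>\<Sum>k\<in>multi_indices N - {0}. cell_error h k (fd_weight \<alpha> lam 2) ?f\<bar>
        \<le> M * A * h powr 2 * (LINT \<xi> : cbox 0 (\<chi> i. L) | lborel. norm (\<xi> :: real^'d) powr (\<epsilon> - real CARD('d)))"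
      using sum_cell_errors_profile[OF \<psi> A _ _ _ par(2) p par(3) h(1), where S = "cbox 0 (\<chi> i. L)" and N = N, unfolded q]
        cells C2(2) by (simp add: M_def)
    also have "\<dots> \<le> M * A * h powr 2 * (C2 * L powr \<epsilon>)"
      using C2(3) M A by (intro mult_left_mono) auto
    finally have 1: "\<bar>\<Sum>k\<in>multi_indices N - {0}. cell_error h k (fd_weight \<alpha> lam 2) ?f\<bar> \<le> M * C2 * L powr \<epsilon> * A * h\<^sup>2"
      unfolding h2 by (simp add: mult_ac)
    have "h powr (?p - \<alpha>) = h powr 2 * h powr \<epsilon>"
      unfolding powr_add[symmetric] by (rule arg_cong[where f = "\<lambda>x. h powr x"]) simp
    also have "\<dots> \<le> h\<^sup>2 * L powr \<epsilon>"
      unfolding h2 using h \<epsilon> by (intro mult_left_mono powr_mono2) auto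
    finally have "C1 * A * h powr (?p - \<alpha>) \<le> C1 * A * (h\<^sup>2 * L powr \<epsilon>)"
      using C1 A by (intro mult_left_mono) auto
    then have 2: "\<bar>origin_error h 2 (fd_weight \<alpha> lam 2) ?f\<bar> \<le> C1 * L powr \<epsilon> * A * h\<^sup>2"
      using C1(2)[OF A h(1) \<psi>] by (simp add: mult_ac)
    from 1 2 show ?thesis
      unfolding quad_error_def distrib_right h_def[symmetric] by linarith
  qed
  moreover have "0 \<le> (C1 + M * C2) * L powr \<epsilon>" using C1 C2 M by simp
  ultimately show ?thesis by blast
qed

subsection \<open>Quadratic forms are integrated exactly\<close>

lemma cell_error_sum:
  fixes f :: "'i \<Rightarrow> real^'d::finite \<Rightarrow> real"
  assumes "\<And>i. i \<in> I \<Longrightarrow> set_integrable lborel (grid_cell h k) (\<lambda>\<xi>. f i \<xi> * w \<xi>)"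
  shows "cell_error h k w (\<lambda>\<xi>. \<Sum>i\<in>I. f i \<xi>) = (\<Sum>i\<in>I. cell_error h k w (f i))"
proof -
  have "(\<Sum>n\<in>multi_indices 2. \<Sum>i\<in>I. f i (grid_point h (k + n))) =
      (\<Sum>i\<in>I. \<Sum>n\<in>multi_indices 2. f i (grid_point h (k + n)))"
    by (rule sum.swap)
  then have "corner_mean h k (\<lambda>\<xi>. \<Sum>i\<in>I. f i \<xi>) = (\<Sum>i\<in>I. corner_mean h k (f i))"
    by (simp add: corner_mean_def sum_distrib_left)
  then show ?thesis
    using assms by (simp add: cell_error_def sum_distrib_right set_integral_sum sum_subtractf)
qed

lemma origin_error_sum:
  fixes f :: "'i \<Rightarrow> real^'d::finite \<Rightarrow> real"
  assumes "\<And>i. i \<in> I \<Longrightarrow> set_integrable lborel (grid_cell h 0) (\<lambda>\<xi>. f i \<xi> * w \<xi>)"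
  shows "origin_error h \<gamma> w (\<lambda>\<xi>. \<Sum>i\<in>I. f i \<xi>) = (\<Sum>i\<in>I. origin_error h \<gamma> w (f i))"
proof -
  let ?S = "\<lambda>f. 1 / 2 ^ CARD('d) * (\<Sum>n\<in>multi_indices 2 - {0}. fd_coeff \<gamma> n * f (grid_point h n))"
  have "(\<Sum>n\<in>multi_indices 2 - {0}. \<Sum>i\<in>I. fd_coeff \<gamma> n * f i (grid_point h n)) =
      (\<Sum>i\<in>I. \<Sum>n\<in>multi_indices 2 - {0}. fd_coeff \<gamma> n * f i (grid_point h n))"
    by (rule sum.swap)
  then have "?S (\<lambda>\<xi>. \<Sum>i\<in>I. f i \<xi>) = (\<Sum>i\<in>I. ?S (f i))"
    by (simp add: sum_distrib_left)
  then show ?thesis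
    using assms unfolding origin_error_def sum_subtractf
    by (simp only: sum_distrib_right set_integral_sum)
qed

lemma quad_error_sum:
  fixes f :: "'i \<Rightarrow> real^'d::finite \<Rightarrow> real"
  assumes "\<And>i k. i \<in> I \<Longrightarrow> set_integrable lborel (grid_cell h k) (\<lambda>\<xi>. f i \<xi> * w \<xi>)"
  shows "quad_error h N \<gamma> w (\<lambda>\<xi>. \<Sum>i\<in>I. f i \<xi>) = (\<Sum>i\<in>I. quad_error h N \<gamma> w (f i))"
proof -
  have "(\<Sum>k\<in>multi_indices N - {0}. \<Sum>i\<in>I. cell_error h k w (f i)) =
      (\<Sum>i\<in>I. \<Sum>k\<in>multi_indices N - {0}. cell_error h k w (f i))"
    by (rule sum.swap)
  then show ?thesis
    using assms by (simp add: quad_error_def cell_error_sum origin_error_sum sum.distrib)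
qed

lemma quad_error_add:
  fixes f g :: "real^'d::finite \<Rightarrow> real"
  assumes "\<And>k. set_integrable lborel (grid_cell h k) (\<lambda>\<xi>. f \<xi> * w \<xi>)"
    and "\<And>k. set_integrable lborel (grid_cell h k) (\<lambda>\<xi>. g \<xi> * w \<xi>)"
  shows "quad_error h N \<gamma> w (\<lambda>\<xi>. f \<xi> + g \<xi>) = quad_error h N \<gamma> w f + quad_error h N \<gamma> w g"
  using quad_error_sum[of UNIV h "\<lambda>b. if b then f else g" w N \<gamma>] assms
  by (simp add: UNIV_bool add.commute)

lemma quad_error_cmult:
  "quad_error h N \<gamma> w (\<lambda>\<xi>. c * f \<xi>) = c * quad_error h N \<gamma> w f"
proof -
  have "cell_error h k w (\<lambda>\<xi>. c * f \<xi>) = c * cell_error h k w f" for k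
    by (simp add: cell_error_def corner_mean_def mult.assoc sum_distrib_left[symmetric] right_diff_distrib mult.left_commute)
  moreover have "(\<Sum>n\<in>multi_indices 2 - {0}. fd_coeff \<gamma> n * (c * f (grid_point h n))) =
      c * (\<Sum>n\<in>multi_indices 2 - {0}. fd_coeff \<gamma> n * f (grid_point h n))"
    by (simp add: sum_distrib_left mult.left_commute)
  then have "origin_error h \<gamma> w (\<lambda>\<xi>. c * f \<xi>) = c * origin_error h \<gamma> w f"
    by (simp add: origin_error_def mult.assoc right_diff_distrib mult.left_commute)
  ultimately show ?thesis by (simp add: quad_error_def sum_distrib_left distrib_left)
qed

section \<open>Invariance under permutations of the coordinates\<close>

abbreviation (input) perm_real :: "('d \<Rightarrow> 'd) \<Rightarrow> real^'d \<Rightarrow> real^'d" where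
  "perm_real \<equiv> signed_perm (\<lambda>_. False)"

definition perm_nat :: "('d \<Rightarrow> 'd) \<Rightarrow> nat^'d \<Rightarrow> nat^'d" where
  "perm_nat \<tau> k = (\<chi> i. k $ \<tau> i)"

context
  fixes \<tau> :: "'d::finite \<Rightarrow> 'd"
  assumes invol: "\<And>i. \<tau> (\<tau> i) = i"
begin

lemma bij_invol: "bij \<tau>"
  by (rule o_bij[of \<tau>]) (simp_all add: fun_eq_iff invol)

lemma perm_real_cell: "perm_real \<tau> \<xi> \<in> grid_cell h k \<longleftrightarrow> \<xi> \<in> grid_cell h (perm_nat \<tau> k)"
  unfolding grid_cell_iff signed_perm_def perm_nat_def by (simp, metis invol)

lemma perm_nat_perm_nat: "perm_nat \<tau> (perm_nat \<tau> k) = k"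
  by (simp add: perm_nat_def invol vec_eq_iff)

lemma perm_nat_eq_0_iff: "perm_nat \<tau> k = 0 \<longleftrightarrow> k = 0"
  unfolding perm_nat_def vec_eq_iff by (simp, metis invol)

lemma perm_nat_multi_indices: "perm_nat \<tau> k \<in> multi_indices N \<longleftrightarrow> k \<in> multi_indices N"
  unfolding multi_indices_def perm_nat_def by (simp, metis invol)

lemma set_integral_perm:
  fixes g :: "real^'d \<Rightarrow> real"
  assumes [measurable]: "g \<in> borel_measurable borel"
  shows "(LINT \<xi> : grid_cell h k | lborel. g \<xi>) = (LINT \<xi> : grid_cell h (perm_nat \<tau> k) | lborel. g (perm_real \<tau> \<xi>))"
  using integral_signed_perm[OF bij_invol, of "\<lambda>\<xi>. indicator (grid_cell h k) \<xi> * g \<xi>" "\<lambda>_. False"]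
  by (simp add: set_lebesgue_integral_def indicator_def perm_real_cell)

lemma perm_real_grid_point: "perm_real \<tau> (grid_point h k) = grid_point h (perm_nat \<tau> k)"
  by (simp add: signed_perm_def grid_point_def perm_nat_def)

text \<open>A permutation carries cells to cells and corners to corners, fixes the origin cell, and
  keeps the coefficients, which depend only on the sum of a label. For an involution the inverse
  needs no separate notation.\<close>

lemma quad_error_perm:
  fixes f w :: "real^'d \<Rightarrow> real"
  assumes [measurable]: "f \<in> borel_measurable borel" "w \<in> borel_measurable borel"
    and w: "\<And>\<xi>. w (perm_real \<tau> \<xi>) = w \<xi>"
  shows "quad_error h N \<gamma> w (\<lambda>\<xi>. f (perm_real \<tau> \<xi>)) = quad_error h N \<gamma> w f"
proof -
  have cell: "cell_error h (perm_nat \<tau> k) w (\<lambda>\<xi>. f (perm_real \<tau> \<xi>)) = cell_error h k w f" for k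
  proof -
    have "corner_mean h (perm_nat \<tau> k) (\<lambda>\<xi>. f (perm_real \<tau> \<xi>)) = corner_mean h k f"
      unfolding corner_mean_def
    proof (rule arg_cong[where f = "\<lambda>x. 1 / 2 ^ CARD('d) * x"],
        rule sum.reindex_bij_witness[where i = "perm_nat \<tau>" and j = "perm_nat \<tau>"])
      show "f (grid_point h (k + perm_nat \<tau> n)) = f (perm_real \<tau> (grid_point h (perm_nat \<tau> k + n)))" for n
        unfolding perm_real_grid_point
        by (rule arg_cong[where f = f], rule arg_cong[where f = "grid_point h"]) (simp add: perm_nat_def vec_eq_iff invol)
    qed (simp_all add: perm_nat_perm_nat perm_nat_multi_indices)
    then show ?thesis
      unfolding cell_error_def using set_integral_perm[of "\<lambda>\<xi>. f \<xi> * w \<xi>" h k] set_integral_perm[of w h k]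
      by (simp add: w)
  qed
  have "(\<Sum>k\<in>multi_indices N - {0}. cell_error h k w (\<lambda>\<xi>. f (perm_real \<tau> \<xi>))) =
      (\<Sum>k\<in>multi_indices N - {0}. cell_error h k w f)"
  proof (rule sum.reindex_bij_witness[where i = "perm_nat \<tau>" and j = "perm_nat \<tau>"])
    show "cell_error h (perm_nat \<tau> k) w f = cell_error h k w (\<lambda>\<xi>. f (perm_real \<tau> \<xi>))" for k
      using cell[of "perm_nat \<tau> k"] by (simp add: perm_nat_perm_nat)
  qed (simp_all add: perm_nat_perm_nat perm_nat_multi_indices perm_nat_eq_0_iff)
  moreover have "(\<Sum>n\<in>multi_indices 2 - {0}. fd_coeff \<gamma> n * f (perm_real \<tau> (grid_point h n))) =
      (\<Sum>n\<in>multi_indices 2 - {0}. fd_coeff \<gamma> n * f (grid_point h n))"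
  proof (rule sum.reindex_bij_witness[where i = "perm_nat \<tau>" and j = "perm_nat \<tau>"])
    have "(\<Sum>i\<in>UNIV. n $ \<tau> i) = (\<Sum>i\<in>UNIV. n $ i)" for n :: "nat^'d"
      using sum.reindex_bij_betw[OF bij_invol, of "vec_nth n"] by simp
    then show "fd_coeff \<gamma> (perm_nat \<tau> n) * f (grid_point h (perm_nat \<tau> n)) = fd_coeff \<gamma> n * f (perm_real \<tau> (grid_point h n))" for n
      by (simp add: perm_real_grid_point fd_coeff_def perm_nat_def)
  qed (simp_all add: perm_nat_perm_nat perm_nat_multi_indices perm_nat_eq_0_iff)
  moreover have "perm_nat \<tau> 0 = 0" by (simp add: perm_nat_eq_0_iff)
  then have "(LINT \<xi> : grid_cell h 0 | lborel. f (perm_real \<tau> \<xi>) * w \<xi>) = (LINT \<xi> : grid_cell h 0 | lborel. f \<xi> * w \<xi>)"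
    using set_integral_perm[of "\<lambda>\<xi>. f \<xi> * w \<xi>" h 0] by (simp add: w)
  ultimately show ?thesis by (simp add: quad_error_def origin_error_def)
qed

end

lemma norm_perm_real:
  fixes \<xi> :: "real^'d::finite"
  assumes "bij \<tau>"
  shows "norm (perm_real \<tau> \<xi>) = norm \<xi>"
  using sum.reindex_bij_betw[OF assms, of "\<lambda>i. (\<xi> $ i)\<^sup>2"]
  by (simp add: norm_vec_def L2_set_def signed_perm_def)

text \<open>Each of the \<open>d\<close> unit corners carries the coefficient 2 ^ d / d. Together
  with the prefactor 1 / 2 ^ d of the rule this makes it exact for constants on the origin cell,
  although the corner at the origin is left out.\<close>

lemma sum_fd_coeff_2: "(\<Sum>n\<in>multi_indices 2 - {0}. fd_coeff 2 (n :: nat^'d::finite)) = 2 ^ CARD('d)"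
proof -
  let ?A = "range (\<lambda>j. axis j 1 :: nat^'d)"
  have sub: "?A \<subseteq> multi_indices 2 - {0}"
    by (auto simp: multi_indices_def axis_eq_0_iff) (simp add: axis_def)
  have iff: "(\<Sum>i\<in>UNIV. n $ i) = 1 \<longleftrightarrow> n \<in> ?A" for n :: "nat^'d"
  proof -
    have "(\<Sum>i\<in>UNIV. n $ i) = 1 \<longleftrightarrow> (\<exists>j. n $ j = 1 \<and> (\<forall>i. j \<noteq> i \<longrightarrow> n $ i = 0))"
      using sum_eq_1_iff[of UNIV "vec_nth n"] by simp
    also have "\<dots> \<longleftrightarrow> n \<in> ?A"
      by (auto simp: image_iff vec_eq_iff axis_def)
    finally show ?thesis .
  qed
  have "(\<Sum>n\<in>multi_indices 2 - {0}. fd_coeff 2 (n :: nat^'d)) = (\<Sum>n\<in>?A. 2 ^ CARD('d) / real CARD('d))"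
  proof (rule sum.mono_neutral_cong_right[OF _ sub])
    show "\<forall>n\<in>multi_indices 2 - {0} - ?A. fd_coeff 2 n = 0"
      unfolding fd_coeff_def iff by simp
    show "fd_coeff 2 n = 2 ^ CARD('d) / real CARD('d)" if "n \<in> ?A" for n
      unfolding fd_coeff_def iff using that by simp
  qed (simp add: finite_multi_indices)
  also have "\<dots> = real (card ?A) * (2 ^ CARD('d) / real CARD('d))" by simp
  also have "card ?A = CARD('d)"
    by (rule card_image) (auto simp: inj_def axis_eq_axis)
  finally show ?thesis by simp
qed

lemma norm_powr_minus_2: "\<xi> \<noteq> 0 \<Longrightarrow> (\<Sum>i\<in>UNIV. (\<xi> $ i)\<^sup>2 * norm \<xi> powr (- 2)) = 1"
  for \<xi> :: "real^'d::finite"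
proof -
  assume "\<xi> \<noteq> 0"
  have "(\<Sum>i\<in>UNIV. (\<xi> $ i)\<^sup>2) = (norm \<xi>)\<^sup>2"
    by (simp add: norm_vec_def L2_set_def sum_nonneg)
  moreover have "norm \<xi> powr (- 2) = inverse ((norm \<xi>)\<^sup>2)"
    using \<open>\<xi> \<noteq> 0\<close> by (simp add: powr_minus powr_realpow[of "norm \<xi>" 2, simplified])
  ultimately show ?thesis
    using \<open>\<xi> \<noteq> 0\<close> by (simp add: sum_distrib_right[symmetric])
qed

text \<open>By symmetry under transpositions of coordinates, all squares \<open>(\<xi> $ i)\<^sup>2\<close> have the same error; these
  errors add up to that of \<open>(norm \<xi>)\<^sup>2\<close>, whose quotient is constant.\<close>

lemma quad_error_square:
  fixes i :: "'d::finite"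
  assumes par: "0 \<le> lam" "\<alpha> < 2" and h: "0 < h"
  shows "quad_error h N 2 (fd_weight \<alpha> lam 2) (\<lambda>\<xi> :: real^'d. (\<xi> $ i)\<^sup>2 * norm \<xi> powr (- 2)) = 0"
    and "set_integrable lborel (grid_cell h k) (\<lambda>\<xi> :: real^'d. (\<xi> $ i)\<^sup>2 * norm \<xi> powr (- 2) * fd_weight \<alpha> lam 2 \<xi>)"
proof -
  let ?w = "fd_weight \<alpha> lam 2 :: real^'d \<Rightarrow> real"
  let ?f = "\<lambda>i (\<xi> :: real^'d). (\<xi> $ i)\<^sup>2 * norm \<xi> powr (- 2)"
  \<comment> \<open>The exponent is zero, left in the form \<open>q + \<alpha> - \<gamma>\<close>
    with \<open>q = 2 - \<alpha>\<close> and \<open>\<gamma> = 2\<close> that the integrability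
    criterion expects. At the origin both sides are zero, as \<open>0 powr 0 = 0\<close>.\<close>
  have f_le: "\<bar>?f i \<xi>\<bar> \<le> 1 * norm \<xi> powr ((2 - \<alpha>) + \<alpha> - 2)" for i and \<xi> :: "real^'d"
  proof (cases "\<xi> = 0")
    case False
    have "?f i \<xi> \<le> (\<Sum>i\<in>UNIV. ?f i \<xi>)" by (rule member_le_sum) auto
    then show ?thesis using norm_powr_minus_2[OF False] False by simp
  qed simp
  have int: "set_integrable lborel (grid_cell h k) (\<lambda>\<xi>. ?f i \<xi> * ?w \<xi>)" for i k
  proof -
    obtain L where L: "grid_cell h k \<subseteq> (cbox 0 (\<chi> i. L) :: (real^'d) set)"
      using grid_cell_subset_cbox[of h k] h by auto
    show ?thesis
      by (rule set_integrable_weighted(1)[OF par(1) _ _ _ f_le L]) (use par in auto)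
  qed
  then show "set_integrable lborel (grid_cell h k) (\<lambda>\<xi>. ?f i \<xi> * ?w \<xi>)" .
  have eq: "quad_error h N 2 ?w (?f i) = quad_error h N 2 ?w (?f j)" for i j
  proof -
    define \<tau> where "\<tau> = id(i := j, j := i)"
    have \<tau>: "\<tau> (\<tau> l) = l" for l by (auto simp: \<tau>_def)
    have n: "norm (perm_real \<tau> \<xi>) = norm \<xi>" for \<xi> :: "real^'d"
      by (rule norm_perm_real[OF bij_invol[of \<tau>, OF \<tau>]])
    have "quad_error h N 2 ?w (\<lambda>\<xi>. ?f j (perm_real \<tau> \<xi>)) = quad_error h N 2 ?w (?f j)"
      by (rule quad_error_perm[of \<tau>, OF \<tau>]) (simp_all add: fd_weight_def n)
    moreover have "perm_real \<tau> \<xi> $ j = \<xi> $ i" for \<xi> :: "real^'d"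
      by (simp add: signed_perm_def \<tau>_def)
    ultimately show ?thesis by (simp add: n)
  qed
  have "(\<Sum>i\<in>UNIV. quad_error h N 2 ?w (?f i)) = quad_error h N 2 ?w (\<lambda>\<xi>. \<Sum>i\<in>UNIV. ?f i \<xi>)"
    using int by (intro quad_error_sum[symmetric]) auto
  also have "\<dots> = 0"
  proof -
    let ?g = "\<lambda>\<xi> :: real^'d. \<Sum>i\<in>UNIV. ?f i \<xi>"
    have "cell_error h k ?w ?g = 0" if k: "k \<noteq> 0" for k
    proof -
      have 1: "?g \<xi> = 1" if "\<xi> \<in> grid_cell h k" for \<xi>
        using cell_geometry(1)[OF h k that] h by (intro norm_powr_minus_2) auto
      then have "corner_mean h k ?g = 1"
        using grid_point_in_cell[of _ h k] h by (simp add: corner_mean_def card_multi_indices)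
      moreover have "(LINT \<xi> : grid_cell h k | lborel. ?g \<xi> * ?w \<xi>) = (LINT \<xi> : grid_cell h k | lborel. ?w \<xi>)"
        by (rule set_lebesgue_integral_cong) (simp_all add: 1)
      ultimately show ?thesis by (simp add: cell_error_def)
    qed
    moreover have "origin_error h 2 ?w ?g = 0"
    proof -
      \<comment> \<open>At the origin \<open>?g\<close> is 0 and not 1, but the weight is 0 there as
        well, being a power of 0.\<close>
      have gw: "?g \<xi> * ?w \<xi> = ?w \<xi>" for \<xi>
        by (cases "\<xi> = 0") (simp_all add: norm_powr_minus_2 fd_weight_def)
      have "(\<Sum>n\<in>multi_indices 2 - {0}. fd_coeff 2 n * ?g (grid_point h n)) = (\<Sum>n\<in>multi_indices 2 - {0}. fd_coeff 2 (n :: nat^'d))"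
      proof (rule sum.cong[OF refl])
        fix n :: "nat^'d" assume "n \<in> multi_indices 2 - {0}"
        then have "grid_point h n \<noteq> (0 :: real^'d)"
          using grid_point_norm(1)[OF h, of n] h by auto
        then show "fd_coeff 2 n * ?g (grid_point h n) = fd_coeff 2 n"
          by (simp only: norm_powr_minus_2[OF \<open>grid_point h n \<noteq> 0\<close>] mult_1_right)
      qed
      then show ?thesis by (simp only: origin_error_def gw sum_fd_coeff_2) simp
    qed
    ultimately show ?thesis by (simp add: quad_error_def)
  qed
  finally have "(\<Sum>j\<in>(UNIV::'d set). quad_error h N 2 ?w (?f j)) = 0" .
  moreover have "(\<Sum>j\<in>(UNIV::'d set). quad_error h N 2 ?w (?f j)) = (\<Sum>j\<in>(UNIV::'d set). quad_error h N 2 ?w (?f i))"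
    by (rule sum.cong[OF refl eq])
  ultimately show "quad_error h N 2 ?w (?f i) = 0" by simp
qed

subsection \<open>The principal value as an integral over the positive orthant\<close>

definition orthant :: "(real^'d) set" where
  "orthant = {\<xi>. \<forall>i. 0 \<le> \<xi> $ i}"

lemma orthant_borel [measurable, simp]: "(orthant :: (real^'d::finite) set) \<in> sets borel"
proof -
  have "closed (orthant :: (real^'d) set)"
    unfolding orthant_def by (intro closed_Collect_all closed_Collect_le continuous_intros)
  then show ?thesis by (rule borel_closed)
qed

lemma reflect_eq_signed_perm: "reflect m = signed_perm (\<lambda>i. odd (m $ i)) id"
  by (simp add: fun_eq_iff reflect_def signed_perm_def vec_eq_iff)

lemma reflect_measurable [measurable]: "(reflect m :: real^'d::finite \<Rightarrow> _) \<in> borel_measurable borel"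
  unfolding reflect_eq_signed_perm by measurable

text \<open>Off the coordinate hyperplanes exactly one sign pattern makes all coordinates
  nonnegative. The reflected orthants thus form a partition of unity almost everywhere.\<close>

lemma sum_indicator_orthant:
  fixes \<xi> :: "real^'d::finite"
  assumes "\<forall>i. \<xi> $ i \<noteq> 0"
  shows "(\<Sum>m\<in>multi_indices 2. indicator orthant (reflect m \<xi>)) = (1 :: real)"
proof -
  define m0 where "m0 = (\<chi> i. if \<xi> $ i < 0 then 1 else (0 :: nat))"
  have "reflect m \<xi> \<in> orthant \<longleftrightarrow> m = m0" if "m \<in> multi_indices 2" for m
  proof -
    have "0 \<le> (-1) ^ (m $ i) * \<xi> $ i \<longleftrightarrow> m $ i = (if \<xi> $ i < 0 then 1 else 0)" for i
    proof -
      have "m $ i = 0 \<or> m $ i = 1" using that by (simp add: multi_indices_2)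
      then show ?thesis using assms[rule_format, of i] by (elim disjE) auto
    qed
    then show ?thesis by (simp add: orthant_def reflect_def m0_def vec_eq_iff)
  qed
  then have "(\<Sum>m\<in>multi_indices 2. indicator orthant (reflect m \<xi>)) = (\<Sum>m\<in>multi_indices 2. if m = m0 then 1 else 0 :: real)"
    by (intro sum.cong) (auto simp: indicator_def)
  moreover have "m0 \<in> multi_indices 2" by (simp add: m0_def multi_indices_def)
  ultimately show ?thesis by (simp add: finite_multi_indices)
qed

text \<open>The partition into reflected orthants splits the integral, and each piece is moved to
  the positive orthant by a reflection, which preserves Lebesgue measure.\<close>

lemma integral_orthant:
  fixes f :: "real^'d::finite \<Rightarrow> real"
  assumes int: "integrable lborel f"
  shows "set_integrable lborel orthant (\<lambda>\<xi>. \<Sum>m\<in>multi_indices 2. f (reflect m \<xi>))"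
    and "(LINT \<xi>|lborel. f \<xi>) = (LINT \<xi> : orthant | lborel. \<Sum>m\<in>multi_indices 2. f (reflect m \<xi>))"
proof -
  let ?I = "indicator orthant :: real^'d \<Rightarrow> real"
  have [measurable]: "f \<in> borel_measurable borel" using int by simp
  have int1: "integrable lborel (\<lambda>\<xi>. ?I (reflect m \<xi>) * f \<xi>)" for m
    by (rule Bochner_Integration.integrable_bound[OF int]) (auto simp: indicator_def)
  have 1: "integrable lborel (\<lambda>\<xi>. ?I \<xi> * f (reflect m \<xi>))" for m
    using integrable_signed_perm_iff[of id "\<lambda>\<xi>. ?I (reflect m \<xi>) * f \<xi>" "\<lambda>i. odd (m $ i)"] int1[of m]
    by (simp flip: reflect_eq_signed_perm)
  have 2: "(LINT \<xi>|lborel. ?I (reflect m \<xi>) * f \<xi>) = (LINT \<xi>|lborel. ?I \<xi> * f (reflect m \<xi>))" for m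
    using integral_signed_perm[of id "\<lambda>\<xi>. ?I (reflect m \<xi>) * f \<xi>" "\<lambda>i. odd (m $ i)"]
    by (simp flip: reflect_eq_signed_perm)
  show "set_integrable lborel orthant (\<lambda>\<xi>. \<Sum>m\<in>multi_indices 2. f (reflect m \<xi>))"
    unfolding set_integrable_def using 1 by (simp add: sum_distrib_left)
  have "(LINT \<xi>|lborel. f \<xi>) = (LINT \<xi>|lborel. (\<Sum>m\<in>multi_indices 2. ?I (reflect m \<xi>) * f \<xi>))"
  proof (rule integral_cong_AE)
    show "AE \<xi> in lborel. f \<xi> = (\<Sum>m\<in>multi_indices 2. ?I (reflect m \<xi>) * f \<xi>)"
      by (rule eventually_mono[OF AE_cart_neq[of "\<lambda>_. 0"]])
        (simp add: sum_indicator_orthant flip: sum_distrib_right)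
  qed simp_all
  also have "\<dots> = (\<Sum>m\<in>multi_indices 2. (LINT \<xi>|lborel. ?I \<xi> * f (reflect m \<xi>)))"
    using int1 by (simp add: 2)
  also have "\<dots> = (LINT \<xi> : orthant | lborel. \<Sum>m\<in>multi_indices 2. f (reflect m \<xi>))"
    using 1 by (simp add: set_lebesgue_integral_def sum_distrib_left)
  finally show "(LINT \<xi>|lborel. f \<xi>) = \<dots>" .
qed

lemma set_integral_shift:
  fixes f :: "real^'d::finite \<Rightarrow> real"
  assumes [measurable]: "f \<in> borel_measurable borel"
  shows "(LINT y : - ball x \<delta> | lborel. f y) = (LINT \<xi> : {\<xi>. \<delta> \<le> norm \<xi>} | lborel. f (x + \<xi>))"
    and "set_integrable lborel (- ball x \<delta>) f \<longleftrightarrow> set_integrable lborel {\<xi>. \<delta> \<le> norm \<xi>} (\<lambda>\<xi>. f (x + \<xi>))"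
proof -
  have ind: "indicator (- ball x \<delta>) (x + \<xi>) = (indicator {\<xi>. \<delta> \<le> norm \<xi>} \<xi> :: real)" for \<xi>
    by (simp add: indicator_def dist_norm)
  have [measurable]: "(\<lambda>y. indicator (- ball x \<delta>) y * f y) \<in> borel_measurable borel" by measurable
  show "(LINT y : - ball x \<delta> | lborel. f y) = (LINT \<xi> : {\<xi>. \<delta> \<le> norm \<xi>} | lborel. f (x + \<xi>))"
    using integral_distr[of "(+) x" lborel borel "\<lambda>y. indicator (- ball x \<delta>) y * f y"]
    by (simp add: lborel_distr_plus set_lebesgue_integral_def ind)
  show "set_integrable lborel (- ball x \<delta>) f \<longleftrightarrow> set_integrable lborel {\<xi>. \<delta> \<le> norm \<xi>} (\<lambda>\<xi>. f (x + \<xi>))"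
    using integrable_distr_eq[of "(+) x" lborel borel "\<lambda>y. indicator (- ball x \<delta>) y * f y"]
    by (simp add: lborel_distr_plus set_integrable_def ind)
qed

text \<open>The tempered kernel is the weight with splitting parameter 0, so that both share the
  same estimates.\<close>

lemma tfl_integrand_shift:
  "tfl_integrand \<alpha> lam u x (x + \<xi>) = (u x - u (x + \<xi>)) * fd_weight \<alpha> lam 0 \<xi>"
  for \<xi> :: "real^'d::finite"
proof -
  have "norm \<xi> powr (0 - (real CARD('d) + \<alpha>)) = inverse (norm \<xi> powr (real CARD('d) + \<alpha>))"
    by (simp only: diff_0 powr_minus)
  then show ?thesis
    by (simp only: tfl_integrand_def fd_weight_def) (simp add: exp_minus divide_inverse)
qed

lemma fd_weight_reflect: "fd_weight \<alpha> lam \<gamma> (reflect m \<xi>) = fd_weight \<alpha> lam \<gamma> (\<xi> :: real^'d::finite)"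
  by (simp add: fd_weight_def)

lemma set_integrable_fd_weight_far:
  fixes S :: "(real^'d::finite) set"
  assumes "0 < \<alpha>" "0 \<le> lam" "0 < r" "S \<subseteq> {\<xi>. r \<le> norm \<xi>}" "S \<in> sets borel"
  shows "set_integrable lborel S (fd_weight \<alpha> lam 0)"
proof -
  have "set_integrable lborel {\<xi>. r \<le> norm \<xi>} (\<lambda>\<xi> :: real^'d. norm \<xi> powr (- \<alpha> - real CARD('d)))"
    using norm_powr_near_infinity[OF assms(1), where 'd = 'd] assms(3) by blast
  then have "set_integrable lborel S (\<lambda>\<xi>. norm \<xi> powr (- \<alpha> - real CARD('d)))"
    by (rule set_integrable_subset) (use assms in auto)
  then show ?thesis
    by (rule set_integrable_bound)
      (use assms fd_weight_le[OF assms(2), where 'd = 'd, of \<alpha> 0] in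
        \<open>auto simp: set_borel_measurable_def fd_weight_nonneg intro!: AE_I2\<close>)
qed

lemma set_integrable_bounded_mult:
  fixes f g :: "'a \<Rightarrow> real"
  assumes "set_integrable M S g" and [measurable]: "f \<in> borel_measurable M" "g \<in> borel_measurable M" "S \<in> sets M"
    and f: "\<And>x. \<bar>f x\<bar> \<le> B"
  shows "set_integrable M S (\<lambda>x. f x * g x)"
proof -
  have "0 \<le> B" using f[of undefined] by linarith
  have "set_integrable M S (\<lambda>x. B * g x)" using assms(1) by simp
  then show ?thesis
    by (rule set_integrable_bound)
      (use f \<open>0 \<le> B\<close> in \<open>auto simp: set_borel_measurable_def abs_mult intro!: AE_I2 mult_right_mono\<close>)
qed

text \<open>The cut-off region is invariant under reflections, so every truncated integral folds
  onto the orthant, where the differences combine to minus the second difference. By assumption that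
  is integrable against the kernel up to the origin, and dominated convergence removes the cut-off.
  Boundedness of \<open>u\<close> ensures that the truncated integrals exist.\<close>

proposition has_pv_integral_tfl:
  fixes u :: "real^'d::finite \<Rightarrow> real"
  assumes par: "0 < \<alpha>" "0 \<le> lam" and u [measurable]: "u \<in> borel_measurable borel" and B: "\<And>x. \<bar>u x\<bar> \<le> B"
    and int: "set_integrable lborel orthant (\<lambda>\<xi>. second_diff u x \<xi> * fd_weight \<alpha> lam 0 \<xi>)"
  shows "has_pv_integral (tfl_integrand \<alpha> lam u x) x
    (- (LINT \<xi> : orthant | lborel. second_diff u x \<xi> * fd_weight \<alpha> lam 0 \<xi>))"
proof -
  let ?K = "fd_weight \<alpha> lam 0 :: real^'d \<Rightarrow> real"
  let ?F = "\<lambda>\<xi>. (u x - u (x + \<xi>)) * ?K \<xi>"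
  let ?H = "\<lambda>\<xi>. second_diff u x \<xi> * ?K \<xi>"
  let ?far = "\<lambda>\<delta>. {\<xi> :: real^'d. \<delta> \<le> norm \<xi>}"
  have [measurable]: "tfl_integrand \<alpha> lam u x \<in> borel_measurable borel"
    unfolding tfl_integrand_def by measurable
  have intF: "set_integrable lborel (?far \<delta>) ?F" if "0 < \<delta>" for \<delta>
  proof (rule set_integrable_bounded_mult[where B = "2 * B"])
    show "set_integrable lborel (?far \<delta>) ?K"
      using that par by (intro set_integrable_fd_weight_far[of \<alpha> lam \<delta>]) auto
    show "\<bar>u x - u (x + \<xi>)\<bar> \<le> 2 * B" for \<xi>
      using B[of x] B[of "x + \<xi>"] by linarith
  qed simp_all
  have eq: "(LINT y : - ball x \<delta> | lborel. tfl_integrand \<alpha> lam u x y) =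
      (LINT \<xi>|lborel. indicator (?far \<delta>) \<xi> * (indicator orthant \<xi> * (- ?H \<xi>)))" if "0 < \<delta>" for \<delta>
  proof -
    have sum: "(\<Sum>m\<in>multi_indices 2. indicator (?far \<delta>) (reflect m \<xi>) * ?F (reflect m \<xi>)) =
        indicator (?far \<delta>) \<xi> * (- ?H \<xi>)" for \<xi>
    proof -
      have "(\<Sum>m\<in>multi_indices 2. indicator (?far \<delta>) (reflect m \<xi>) * ?F (reflect m \<xi>)) =
          indicator (?far \<delta>) \<xi> * ((\<Sum>m\<in>multi_indices 2. u x - u (x + reflect m \<xi>)) * ?K \<xi>)"
        by (simp add: fd_weight_reflect indicator_def sum_distrib_right)
      also have "(\<Sum>m\<in>multi_indices 2. u x - u (x + reflect m \<xi>)) = - second_diff u x \<xi>"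
        by (simp add: second_diff_def sum_subtractf card_multi_indices)
      finally show ?thesis by simp
    qed
    have "(LINT y : - ball x \<delta> | lborel. tfl_integrand \<alpha> lam u x y) = (LINT \<xi>|lborel. indicator (?far \<delta>) \<xi> * ?F \<xi>)"
      by (subst set_integral_shift(1)) (simp_all add: tfl_integrand_shift set_lebesgue_integral_def)
    also have "\<dots> = (LINT \<xi> : orthant | lborel. indicator (?far \<delta>) \<xi> * (- ?H \<xi>))"
      unfolding sum[symmetric] using intF[OF that] by (intro integral_orthant(2)) (simp add: set_integrable_def)
    also have "\<dots> = (LINT \<xi>|lborel. indicator (?far \<delta>) \<xi> * (indicator orthant \<xi> * (- ?H \<xi>)))"
      unfolding set_lebesgue_integral_def by (rule arg_cong[where f = "integral\<^sup>L lborel"]) (simp add: fun_eq_iff)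
    finally show ?thesis .
  qed
  have "((\<lambda>\<delta>. LINT y : - ball x \<delta> | lborel. tfl_integrand \<alpha> lam u x y) \<longlongrightarrow>
      (LINT \<xi>|lborel. indicator orthant \<xi> * (- ?H \<xi>))) (at_right 0)"
  \<comment> \<open>Dominated convergence is a statement about sequences, so the one-sided limit is
    tested along them.\<close>
  proof (rule tendsto_at_right_sequentially[of 0 1])
    fix S :: "nat \<Rightarrow> real"
    assume S: "\<And>n. 0 < S n" "S \<longlonglongrightarrow> 0"
    have H [measurable]: "(\<lambda>\<xi>. indicator orthant \<xi> * (- ?H \<xi>)) \<in> borel_measurable borel"
      using int by (simp add: set_integrable_def)
    have "(\<lambda>n. LINT \<xi>|lborel. indicator (?far (S n)) \<xi> * (indicator orthant \<xi> * (- ?H \<xi>))) \<longlonglongrightarrow>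
        (LINT \<xi>|lborel. indicator orthant \<xi> * (- ?H \<xi>))"
    proof (rule integral_dominated_convergence[where w = "\<lambda>\<xi>. \<bar>indicator orthant \<xi> * (- ?H \<xi>)\<bar>"])
      show "integrable lborel (\<lambda>\<xi>. \<bar>indicator orthant \<xi> * (- ?H \<xi>)\<bar>)"
        using int by (simp add: set_integrable_def)
      show "AE \<xi> in lborel. (\<lambda>n. indicator (?far (S n)) \<xi> * (indicator orthant \<xi> * (- ?H \<xi>))) \<longlonglongrightarrow> indicator orthant \<xi> * (- ?H \<xi>)"
      proof (rule eventually_mono[OF AE_lborel_singleton[of 0]])
        fix \<xi> :: "real^'d" assume "\<xi> \<noteq> 0"
        then have "eventually (\<lambda>n. S n < norm \<xi>) sequentially"
          using S(2) by (intro order_tendstoD(2)) auto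
        then have "eventually (\<lambda>n. indicator orthant \<xi> * (- ?H \<xi>) = indicator (?far (S n)) \<xi> * (indicator orthant \<xi> * (- ?H \<xi>))) sequentially"
          by eventually_elim (simp add: indicator_def)
        then show "(\<lambda>n. indicator (?far (S n)) \<xi> * (indicator orthant \<xi> * (- ?H \<xi>))) \<longlonglongrightarrow> indicator orthant \<xi> * (- ?H \<xi>)"
          by (rule Lim_transform_eventually[OF tendsto_const])
      qed
      show "AE \<xi> in lborel. norm (indicator (?far (S n)) \<xi> * (indicator orthant \<xi> * (- ?H \<xi>))) \<le> \<bar>indicator orthant \<xi> * (- ?H \<xi>)\<bar>" for n
        by (intro AE_I2) (simp add: indicator_def)
      show "(\<lambda>\<xi>. indicator (?far (S n)) \<xi> * (indicator orthant \<xi> * (- ?H \<xi>))) \<in> borel_measurable lborel" for n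
        using H by measurable
    qed (use H in simp)
    then show "(\<lambda>n. LINT y : - ball x (S n) | lborel. tfl_integrand \<alpha> lam u x y) \<longlonglongrightarrow>
        (LINT \<xi>|lborel. indicator orthant \<xi> * (- ?H \<xi>))"
      by (simp only: eq[OF S(1)])
  qed simp
  moreover have "(LINT \<xi>|lborel. indicator orthant \<xi> * (- ?H \<xi>)) = - (LINT \<xi> : orthant | lborel. ?H \<xi>)"
    by (simp add: set_lebesgue_integral_def)
  moreover have "set_integrable lborel (- ball x \<delta>) (tfl_integrand \<alpha> lam u x)" if "0 < \<delta>" for \<delta>
    by (subst set_integral_shift(2)) (simp_all add: tfl_integrand_shift intF[OF that])
  ultimately show ?thesis by (simp add: has_pv_integral_def)
qed

lemma has_pv_integral_unique: "has_pv_integral f x I \<Longrightarrow> pv_integral f x = I"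
  unfolding pv_integral_def has_pv_integral_def
  by (rule the_equality) (auto intro: tendsto_unique[OF trivial_limit_at_right_real])

subsection \<open>The discretisation error as a quadrature error\<close>

lemma fd_phi_eq: "fd_phi \<gamma> u x \<xi> = second_diff u x \<xi> * norm \<xi> powr (- \<gamma>)"
  by (simp add: fd_phi_def second_diff_def powr_minus divide_inverse mult.commute)

text \<open>The splitting parameter cancels, even at the origin, where both sides are 0. It affects
  the rule but not the integral.\<close>

lemma fd_weight_split: "norm \<xi> powr (- \<gamma>) * fd_weight \<alpha> lam \<gamma> \<xi> = fd_weight \<alpha> lam 0 \<xi>"
  for \<xi> :: "real^'d::finite"
proof -
  have "norm \<xi> powr (- \<gamma>) * norm \<xi> powr (\<gamma> - (real CARD('d) + \<alpha>)) = norm \<xi> powr (0 - (real CARD('d) + \<alpha>))"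
    unfolding powr_add[symmetric] by simp
  then show ?thesis by (simp add: fd_weight_def mult.left_commute)
qed

lemma orthant_split:
  assumes "0 \<le> L"
  shows "(orthant :: (real^'d::finite) set) = cbox 0 (\<chi> i. L) \<union> far_region L" "cbox 0 (\<chi> i. L) \<inter> far_region L = ({} :: (real^'d) set)"
  using assms by (auto simp: orthant_def far_region_def mem_box_cart)

lemma far_region_borel [measurable, simp]: "(far_region L :: (real^'d::finite) set) \<in> sets borel"
proof -
  have "far_region L = (orthant - cbox 0 (\<chi> i. L) :: (real^'d) set)"
    by (simp add: far_region_def orthant_def)
  then show ?thesis by simp
qed

lemma far_regionD:
  assumes "\<xi> \<in> far_region L"
  shows "\<exists>j. L < \<xi> $ j"
proof (rule ccontr)
  assume "\<nexists>j. L < \<xi> $ j"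
  then have "\<xi> $ j \<le> L" for j by (simp add: not_less)
  with assms show False by (auto simp: far_region_def mem_box_cart)
qed

lemma far_region_subset: "0 \<le> L \<Longrightarrow> far_region L \<subseteq> {\<xi> :: real^'d::finite. L \<le> norm \<xi>}"
proof
  fix \<xi> :: "real^'d" assume "0 \<le> L" "\<xi> \<in> far_region L"
  then obtain j where "L < \<xi> $ j" using far_regionD by blast
  then show "\<xi> \<in> {\<xi>. L \<le> norm \<xi>}"
    using component_le_norm_cart[of \<xi> j] by auto
qed

lemma box_length_ge: "b $ i - a $ i \<le> box_length a b" for a b :: "real^'d::finite"
  unfolding box_length_def by (rule Max_ge) auto

text \<open>Some coordinate of \<xi> exceeds every edge length, so each reflected shift leaves the
  box in that direction, whatever the sign.\<close>

lemma second_diff_far: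
  fixes x :: "real^'d::finite"
  assumes zero: "\<forall>x. x \<notin> box a b \<longrightarrow> u x = 0" and x: "x \<in> box a b" and \<xi>: "\<xi> \<in> far_region (box_length a b)"
  shows "second_diff u x \<xi> = - (2 ^ CARD('d) * u x)"
proof -
  obtain j where j: "box_length a b < \<xi> $ j" using far_regionD[OF \<xi>] by blast
  have "x + reflect m \<xi> \<notin> box a b" for m
  proof -
    have "b $ j - a $ j < \<xi> $ j" using box_length_ge[of b j a] j by linarith
    moreover have "a $ j < x $ j" "x $ j < b $ j" using x by (auto simp: mem_box_cart)
    moreover have "reflect m \<xi> $ j = \<xi> $ j \<or> reflect m \<xi> $ j = - \<xi> $ j"
      by (cases "even (m $ j)") (simp_all add: reflect_def)
    ultimately have "\<not> (a $ j < (x + reflect m \<xi>) $ j \<and> (x + reflect m \<xi>) $ j < b $ j)" by auto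
    then show ?thesis by (auto simp: mem_box_cart)
  qed
  then show ?thesis using zero by (simp add: second_diff_def)
qed

text \<open>The tail over the far region occurs identically in the operator and in the scheme and
  cancels. What remains is, cell by cell, integral minus rule over the cube. The minus sign is that
  between the principal value and the orthant integral.\<close>

proposition fd_error_eq_quad_error:
  fixes u :: "real^'d::finite \<Rightarrow> real"
  assumes par: "0 < \<alpha>" "0 \<le> lam" and u: "u \<in> borel_measurable borel" "\<And>x. \<bar>u x\<bar> \<le> B"
    and zero: "\<forall>x. x \<notin> box a b \<longrightarrow> u x = 0" and x: "x \<in> box a b" and N: "1 \<le> N"
    and int: "set_integrable lborel (cbox 0 (\<chi> i. box_length a b))
      (\<lambda>\<xi>. second_diff u x \<xi> * norm \<xi> powr (- \<gamma>) * fd_weight \<alpha> lam \<gamma> \<xi>)"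
  shows "\<exists>I. has_pv_integral (tfl_integrand \<alpha> lam u x) x I"
    and "fd_error a b N \<alpha> lam \<gamma> u x = - tfl_const CARD('d) \<alpha> lam *
      quad_error (box_length a b / real N) N \<gamma> (fd_weight \<alpha> lam \<gamma>) (\<lambda>\<xi>. second_diff u x \<xi> * norm \<xi> powr (- \<gamma>))"
proof -
  define L where "L = box_length a b"
  define h where "h = L / real N"
  let ?K = "fd_weight \<alpha> lam 0 :: real^'d \<Rightarrow> real"
  let ?w = "fd_weight \<alpha> lam \<gamma> :: real^'d \<Rightarrow> real"
  let ?f = "\<lambda>\<xi>. second_diff u x \<xi> * norm \<xi> powr (- \<gamma>)"
  let ?H = "\<lambda>\<xi>. second_diff u x \<xi> * ?K \<xi>"
  let ?Q = "cbox 0 (\<chi> i. L) :: (real^'d) set"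
  let ?D = "far_region L :: (real^'d) set"
  have "a $ i < x $ i \<and> x $ i < b $ i" for i using x by (auto simp: mem_box_cart)
  then have L: "0 < L" using box_length_ge[of b undefined a] unfolding L_def by (meson diff_gt_0_iff_gt less_le_trans less_trans)
  have h: "0 < h" using L N by (simp add: h_def)
  have fw: "?f \<xi> * ?w \<xi> = ?H \<xi>" for \<xi>
    unfolding mult.assoc fd_weight_split ..
  have intQ: "set_integrable lborel ?Q ?H" using int by (simp only: fw L_def)
  have far: "second_diff u x \<xi> = - (2 ^ CARD('d) * u x)" if "\<xi> \<in> ?D" for \<xi>
    using second_diff_far[OF zero x] that by (simp add: L_def)
  have "set_integrable lborel ?D (\<lambda>\<xi>. - (2 ^ CARD('d) * u x) * ?K \<xi>)"
    using L far_region_subset[of L, where 'd = 'd]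
    by (intro set_integrable_mult_right set_integrable_fd_weight_far[OF par, of L]) auto
  then have intD: "set_integrable lborel ?D ?H"
    by (rule set_integrable_cong[THEN iffD1, rotated -1]) (simp_all add: far)
  have orth: "orthant = ?Q \<union> ?D" "?Q \<inter> ?D = {}" using orthant_split[of L] L by auto
  have int_orth: "set_integrable lborel orthant ?H"
    unfolding orth(1) by (intro set_integrable_Un intQ intD) simp_all
  have pv: "has_pv_integral (tfl_integrand \<alpha> lam u x) x (- (LINT \<xi> : orthant | lborel. ?H \<xi>))"
    by (rule has_pv_integral_tfl[OF par u int_orth])
  then show "\<exists>I. has_pv_integral (tfl_integrand \<alpha> lam u x) x I" ..
  have "(LINT \<xi> : orthant | lborel. ?H \<xi>) = (LINT \<xi> : ?Q | lborel. ?H \<xi>) + (LINT \<xi> : ?D | lborel. ?H \<xi>)"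
    unfolding orth(1) by (rule set_integral_Un[OF orth(2) intQ intD])
  also have "(LINT \<xi> : ?D | lborel. ?H \<xi>) = (LINT \<xi> : ?D | lborel. - (2 ^ CARD('d) * u x) * ?K \<xi>)"
    by (rule set_lebesgue_integral_cong) (simp_all add: far)
  also have "\<dots> = - (2 ^ CARD('d) * u x) * (LINT \<xi> : ?D | lborel. ?K \<xi>)"
    by (rule set_integral_mult_right)
  also have "(LINT \<xi> : ?Q | lborel. ?H \<xi>) = (\<Sum>k\<in>multi_indices N. LINT \<xi> : grid_cell h k | lborel. ?H \<xi>)"
  proof -
    have Q: "?Q = (\<Union>k\<in>multi_indices N. grid_cell h k)"
      using union_grid_cells[OF L N, where 'd = 'd] by (simp add: h_def)
    show ?thesis
      unfolding Q
      by (intro set_integral_grid_cells h finite_multi_indices set_integrable_subset[OF intQ[unfolded Q]]) auto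
  qed
  also have "\<dots> = (LINT \<xi> : grid_cell h 0 | lborel. ?H \<xi>) + (\<Sum>k\<in>multi_indices N - {0}. LINT \<xi> : grid_cell h k | lborel. ?H \<xi>)"
    using N by (intro sum.remove finite_multi_indices) (simp add: multi_indices_def)
  finally have I: "pv_integral (tfl_integrand \<alpha> lam u x) x =
      - ((LINT \<xi> : grid_cell h 0 | lborel. ?H \<xi>) + (\<Sum>k\<in>multi_indices N - {0}. LINT \<xi> : grid_cell h k | lborel. ?H \<xi>) +
        - (2 ^ CARD('d) * u x) * (LINT \<xi> : ?D | lborel. ?K \<xi>))"
    using has_pv_integral_unique[OF pv] by simp
  have K: "exp (- lam * norm \<xi>) * norm \<xi> powr (- (real CARD('d) + \<alpha>)) = ?K \<xi>" for \<xi>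
    by (simp add: fd_weight_def)
  have A: "fd_tempered_frac_laplacian a b N \<alpha> lam \<gamma> u x = - tfl_const CARD('d) \<alpha> lam *
      (1 / 2 ^ CARD('d) * (\<Sum>n\<in>multi_indices 2 - {0}. fd_coeff \<gamma> n * ?f (grid_point h n)) * (LINT \<xi> : grid_cell h 0 | lborel. ?w \<xi>)
       + (\<Sum>k\<in>multi_indices N - {0}. corner_mean h k ?f * (LINT \<xi> : grid_cell h k | lborel. ?w \<xi>))
       - 2 ^ CARD('d) * u x * (LINT \<xi> : ?D | lborel. ?K \<xi>))"
    unfolding fd_tempered_frac_laplacian_def Let_def L_def[symmetric] h_def[symmetric] K fd_phi_eq corner_mean_def
    by (simp only: sum_distrib_right mult.assoc)
  have E: "quad_error h N \<gamma> ?w ?f = (LINT \<xi> : grid_cell h 0 | lborel. ?H \<xi>)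
      - 1 / 2 ^ CARD('d) * (\<Sum>n\<in>multi_indices 2 - {0}. fd_coeff \<gamma> n * ?f (grid_point h n)) * (LINT \<xi> : grid_cell h 0 | lborel. ?w \<xi>)
      + ((\<Sum>k\<in>multi_indices N - {0}. LINT \<xi> : grid_cell h k | lborel. ?H \<xi>) -
        (\<Sum>k\<in>multi_indices N - {0}. corner_mean h k ?f * (LINT \<xi> : grid_cell h k | lborel. ?w \<xi>)))"
    unfolding quad_error_def origin_error_def cell_error_def fw sum_subtractf ..
  show "fd_error a b N \<alpha> lam \<gamma> u x = - tfl_const CARD('d) \<alpha> lam * quad_error (box_length a b / real N) N \<gamma> ?w ?f"
    unfolding fd_error_def tempered_frac_laplacian_def A I L_def[symmetric] h_def[symmetric] E
    by (simp add: algebra_simps)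
qed

lemma bounded_if_supported_in_box:
  fixes u :: "real^'d::finite \<Rightarrow> real"
  assumes "continuous_on UNIV u" "\<forall>x. x \<notin> box a b \<longrightarrow> u x = 0"
  shows "\<exists>B. \<forall>x. \<bar>u x\<bar> \<le> B"
proof -
  have "compact (u ` cbox a b)"
    using assms(1) by (intro compact_continuous_image) (auto intro: continuous_on_subset)
  then have "bounded (u ` cbox a b)" by (rule compact_imp_bounded)
  then obtain B where B: "\<And>x. x \<in> cbox a b \<Longrightarrow> \<bar>u x\<bar> \<le> B" unfolding bounded_iff by auto
  have "\<bar>u x\<bar> \<le> max B 0" for x
    using B[of x] assms(2) box_subset_cbox[of a b] by (cases "x \<in> box a b") (auto simp: le_max_iff_disj)
  then show ?thesis by blast
qed

lemma second_diff_measurable [measurable]: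
  fixes u :: "real^'d::finite \<Rightarrow> real"
  assumes [measurable]: "u \<in> borel_measurable borel"
  shows "second_diff u x \<in> borel_measurable borel"
  unfolding second_diff_def[abs_def] by measurable

lemma sup_norm_on_le: "(\<And>x. x \<in> S \<Longrightarrow> \<bar>f x\<bar> \<le> c) \<Longrightarrow> sup_norm_on S f \<le> ereal c"
  unfolding sup_norm_on_def by (rule SUP_least) simp

theorem theorem3p2:
  fixes a b :: "real^'d::finite" and u :: "real^'d \<Rightarrow> real" and \<alpha> lam \<epsilon> :: real
  assumes "CARD('d) \<in> {1, 2, 3}"
    and "1 \<le> \<alpha>" and "\<alpha> < 2" and "0 \<le> lam"
    and "\<forall>i. a $ i < b $ i"
    and "\<forall>x. x \<notin> box a b \<longrightarrow> u x = 0"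
    and "0 < \<epsilon>" and "\<epsilon> \<le> 2 - \<alpha>"
  shows "(\<forall>\<gamma>. u \<in> holder_space 1 (\<alpha> - 1 + \<epsilon>) \<and> \<alpha> < \<gamma> \<and> \<gamma> \<le> 2 \<longrightarrow>
            tfl_well_defined_on (box a b) \<alpha> lam u \<and>
            (\<exists>C>0. \<forall>N\<ge>1. sup_norm_on (box a b) (fd_error a b N \<alpha> lam \<gamma> u)
                      \<le> ereal (C * (box_length a b / real N) powr \<epsilon>)))
       \<and> (u \<in> holder_space 3 (\<alpha> - 1 + \<epsilon>) \<longrightarrow>
            tfl_well_defined_on (box a b) \<alpha> lam u \<and>
            (\<exists>C>0. \<forall>N\<ge>1. sup_norm_on (box a b) (fd_error a b N \<alpha> lam 2 u)
                      \<le> ereal (C * (box_length a b / real N)\<^sup>2)))"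
proof -
  define s where "s = \<alpha> - 1 + \<epsilon>"
  have s: "0 < s" and \<alpha>: "0 < \<alpha>" using assms by (simp_all add: s_def)
  define L where "L = box_length a b"
  have "0 < b $ undefined - a $ undefined" using assms(5) by simp
  then have L: "0 < L" using box_length_ge[of b undefined a] by (simp add: L_def)
  define c where "c = tfl_const CARD('d) \<alpha> lam"
  \<comment> \<open>Common to both parts: \<open>r\<close> is the rate,
    \<open>h powr \<epsilon>\<close> or \<open>h\<^sup>2\<close>, and the constant \<open>E\<close>
    does not depend on \<open>x\<close> or \<open>N\<close>.\<close>
  have main: "tfl_well_defined_on (box a b) \<alpha> lam u \<and>
      (\<exists>C>0. \<forall>N\<ge>1. sup_norm_on (box a b) (fd_error a b N \<alpha> lam \<gamma> u) \<le> ereal (C * r (box_length a b / real N)))"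
    if cont: "continuous_on UNIV u"
      and int: "\<And>x. set_integrable lborel (cbox 0 (\<chi> i. L)) (\<lambda>\<xi>. second_diff u x \<xi> * norm \<xi> powr (- \<gamma>) * fd_weight \<alpha> lam \<gamma> \<xi>)"
      and E: "0 \<le> E" "\<And>x N. 1 \<le> N \<Longrightarrow>
        \<bar>quad_error (L / real N) N \<gamma> (fd_weight \<alpha> lam \<gamma>) (\<lambda>\<xi>. second_diff u x \<xi> * norm \<xi> powr (- \<gamma>))\<bar> \<le> E * r (L / real N)"
      and r: "\<And>h. 0 \<le> r h"
    for \<gamma> E :: real and r :: "real \<Rightarrow> real"
  proof -
    obtain B where B: "\<And>x. \<bar>u x\<bar> \<le> B" using bounded_if_supported_in_box[OF cont assms(6)] by blast
    have meas: "u \<in> borel_measurable borel" using cont by (rule borel_measurable_continuous_onI)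
    note eq = fd_error_eq_quad_error[OF \<alpha> assms(4) meas B assms(6) _ _ int[unfolded L_def]]
    \<comment> \<open>The existence of the principal value does not involve the mesh, so
      \<open>N = 1\<close> is an arbitrary choice.\<close>
    have "tfl_well_defined_on (box a b) \<alpha> lam u"
      unfolding tfl_well_defined_on_def using eq(1)[of _ 1] by blast
    \<comment> \<open>The summand 1 only makes the constant strictly positive.\<close>
    moreover have "sup_norm_on (box a b) (fd_error a b N \<alpha> lam \<gamma> u) \<le> ereal ((\<bar>c\<bar> * E + 1) * r (L / real N))" if N: "1 \<le> N" for N
    proof (rule sup_norm_on_le)
      fix x assume "x \<in> box a b"
      then have "\<bar>fd_error a b N \<alpha> lam \<gamma> u x\<bar> = \<bar>c\<bar> *
          \<bar>quad_error (L / real N) N \<gamma> (fd_weight \<alpha> lam \<gamma>) (\<lambda>\<xi>. second_diff u x \<xi> * norm \<xi> powr (- \<gamma>))\<bar>"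
        using eq(2)[OF _ N] by (simp add: abs_mult c_def L_def)
      also have "\<dots> \<le> \<bar>c\<bar> * (E * r (L / real N))" by (intro mult_left_mono E(2) N) simp
      also have "\<dots> \<le> (\<bar>c\<bar> * E + 1) * r (L / real N)" using r by (simp add: algebra_simps)
      finally show "\<bar>fd_error a b N \<alpha> lam \<gamma> u x\<bar> \<le> (\<bar>c\<bar> * E + 1) * r (L / real N)" .
    qed
    moreover have "0 < \<bar>c\<bar> * E + 1" using E(1) by (simp add: add_nonneg_pos)
    ultimately show ?thesis
      unfolding L_def by blast
  qed
  show ?thesis
  proof (intro conjI allI impI; (elim conjE)?)
    fix \<gamma>
    assume u: "u \<in> holder_space 1 (\<alpha> - 1 + \<epsilon>)" and \<gamma>: "\<alpha> < \<gamma>" "\<gamma> \<le> 2"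
    have cont: "continuous_on UNIV u" using u by (rule holder_space_continuous)
    then have [measurable]: "u \<in> borel_measurable borel" by (rule borel_measurable_continuous_onI)
    obtain A where A: "0 \<le> A" "\<And>x. holder_profile A (\<alpha> + \<epsilon>) (\<alpha> + \<epsilon>) (second_diff u x)"
      using holder_profile_second_diff_1[OF u[folded s_def] s] by (auto simp: s_def)
    obtain C where C: "0 \<le> C" "\<And>x h N. 0 < h \<Longrightarrow>
        \<bar>quad_error h N \<gamma> (fd_weight \<alpha> lam \<gamma>) (\<lambda>\<xi>. second_diff u x \<xi> * norm \<xi> powr (- \<gamma>))\<bar> \<le> C * A * h powr \<epsilon>"
      using quad_error_first_order[OF \<alpha> \<gamma>(1) assms(4,7), where 'd = 'd] A assms(8) by fastforce
    have int: "set_integrable lborel (cbox 0 (\<chi> i. L)) (\<lambda>\<xi>. second_diff u x \<xi> * norm \<xi> powr (- \<gamma>) * fd_weight \<alpha> lam \<gamma> \<xi>)" for x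
      by (rule set_integrable_weighted(1)[OF assms(4,7) A(1)])
        (use holder_profile_quotient_le[OF A(2), of x _ \<gamma>] in \<open>auto simp: add.commute\<close>)
    have "tfl_well_defined_on (box a b) \<alpha> lam u \<and>
        (\<exists>C>0. \<forall>N\<ge>1. sup_norm_on (box a b) (fd_error a b N \<alpha> lam \<gamma> u) \<le> ereal (C * (box_length a b / real N) powr \<epsilon>))"
      by (rule main[OF cont int, where r = "\<lambda>h. h powr \<epsilon>" and E = "C * A"]) (use C A L in auto)
    then show "tfl_well_defined_on (box a b) \<alpha> lam u"
      "\<exists>C>0. \<forall>N\<ge>1. sup_norm_on (box a b) (fd_error a b N \<alpha> lam \<gamma> u) \<le> ereal (C * (box_length a b / real N) powr \<epsilon>)"
      by blast+
  next
    assume u: "u \<in> holder_space 3 (\<alpha> - 1 + \<epsilon>)"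
    have cont: "continuous_on UNIV u" using u by (rule holder_space_continuous)
    then have [measurable]: "u \<in> borel_measurable borel" by (rule borel_measurable_continuous_onI)
    define q where "q x i = 2 ^ CARD('d) / 2 * partial_deriv i (partial_deriv i u) x" for x i
    define R where "R x \<xi> = second_diff u x \<xi> - (\<Sum>i\<in>UNIV. q x i * (\<xi> $ i)\<^sup>2)" for x \<xi>
    let ?w = "fd_weight \<alpha> lam 2 :: real^'d \<Rightarrow> real"
    have [measurable]: "R x \<in> borel_measurable borel" for x
      unfolding R_def[abs_def] by measurable
    have s3: "3 + s = 2 + \<alpha> + \<epsilon>" by (simp add: s_def)
    obtain A where A: "0 \<le> A" "\<And>x. holder_profile A (2 + \<alpha> + \<epsilon>) 2 (R x)"
      using holder_profile_second_diff_3[OF u[folded s_def] s] unfolding R_def[abs_def] q_def s3 by blast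
    obtain C where C: "0 \<le> C" "\<And>x N. 1 \<le> N \<Longrightarrow>
        \<bar>quad_error (L / real N) N 2 ?w (\<lambda>\<xi>. R x \<xi> * norm \<xi> powr (- 2))\<bar> \<le> C * A * (L / real N)\<^sup>2"
      using quad_error_second_order[OF \<alpha> assms(3,4,7) L, where 'd = 'd] A by fastforce
    have split: "second_diff u x \<xi> * norm \<xi> powr (- 2) =
        R x \<xi> * norm \<xi> powr (- 2) + (\<Sum>i\<in>UNIV. q x i * ((\<xi> $ i)\<^sup>2 * norm \<xi> powr (- 2)))" for x \<xi>
      by (simp add: R_def sum_distrib_right left_diff_distrib mult.assoc)
    have intR: "set_integrable lborel (grid_cell h k) (\<lambda>\<xi>. R x \<xi> * norm \<xi> powr (- 2) * ?w \<xi>)" if h: "0 < h" for x h k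
    proof -
      obtain L' where L': "grid_cell h k \<subseteq> (cbox 0 (\<chi> i. L') :: (real^'d) set)"
        using grid_cell_subset_cbox[of h k] h by auto
      \<comment> \<open>The value \<open>q = 2 + \<epsilon>\<close> is p - \<alpha> for the
        remainder \<open>R x\<close>.\<close>
      show ?thesis
        by (rule set_integrable_weighted(1)[OF assms(4) _ A(1) _ _ L', where q = "2 + \<epsilon>"])
          (use holder_profile_quotient_le[OF A(2), of x _ 2] assms(7) in \<open>auto simp: algebra_simps\<close>)
    qed
    have intq: "set_integrable lborel (grid_cell h k) (\<lambda>\<xi>. q x i * ((\<xi> $ i)\<^sup>2 * norm \<xi> powr (- 2)) * ?w \<xi>)" if h: "0 < h" for x i h k
      using set_integrable_mult_right[OF quad_error_square(2)[OF assms(4,3) h], where a = "q x i"] by (simp only: mult.assoc)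
    have intS: "set_integrable lborel (grid_cell h k) (\<lambda>\<xi>. (\<Sum>i\<in>UNIV. q x i * ((\<xi> $ i)\<^sup>2 * norm \<xi> powr (- 2))) * ?w \<xi>)" if h: "0 < h" for x h k
      using intq[OF h] unfolding set_integrable_def real_scaleR_def sum_distrib_right sum_distrib_left
      by (intro Bochner_Integration.integrable_sum)
    \<comment> \<open>The cube is itself the origin cell of mesh size \<open>L\<close>.\<close>
    have int: "set_integrable lborel (cbox 0 (\<chi> i. L)) (\<lambda>\<xi>. second_diff u x \<xi> * norm \<xi> powr (- 2) * ?w \<xi>)" for x
      unfolding split distrib_right using intR[OF L, of 0 x] intS[OF L, of 0 x]
      by (simp only: grid_cell_0 set_integral_add(1))
    have eq: "quad_error h N 2 ?w (\<lambda>\<xi>. second_diff u x \<xi> * norm \<xi> powr (- 2)) = quad_error h N 2 ?w (\<lambda>\<xi>. R x \<xi> * norm \<xi> powr (- 2))"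
      if h: "0 < h" for x h N
    proof -
      have "quad_error h N 2 ?w (\<lambda>\<xi>. \<Sum>i\<in>UNIV. q x i * ((\<xi> $ i)\<^sup>2 * norm \<xi> powr (- 2))) =
          (\<Sum>i\<in>UNIV. quad_error h N 2 ?w (\<lambda>\<xi>. q x i * ((\<xi> $ i)\<^sup>2 * norm \<xi> powr (- 2))))"
        by (rule quad_error_sum) (rule intq[OF h])
      also have "\<dots> = 0"
        unfolding quad_error_cmult quad_error_square(1)[OF assms(4,3) h] by simp
      finally show ?thesis
        unfolding split using quad_error_add[OF intR[OF h, of _ x] intS[OF h, of _ x]] by simp
    qed
    have "tfl_well_defined_on (box a b) \<alpha> lam u \<and>
        (\<exists>C>0. \<forall>N\<ge>1. sup_norm_on (box a b) (fd_error a b N \<alpha> lam 2 u) \<le> ereal (C * (box_length a b / real N)\<^sup>2))"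
      by (rule main[OF cont int, where r = "\<lambda>h. h\<^sup>2" and E = "C * A"]) (use C A L in \<open>auto simp: eq\<close>)
    then show "tfl_well_defined_on (box a b) \<alpha> lam u"
      "\<exists>C>0. \<forall>N\<ge>1. sup_norm_on (box a b) (fd_error a b N \<alpha> lam 2 u) \<le> ereal (C * (box_length a b / real N)\<^sup>2)"
      by blast+
  qed
qed

end
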